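(* Let $X:V\to W$ be a centered stationary Gaussian field with continuous non-degenerate covariance function $\Omega$ and spectral measure $\mu$, let $\eta$ be the law of $X(0)$, let $f\in L^2(\eta)$ with chaotic coefficients $(f_q)_{q\ge0}$, and let $\phi$ be a test function. Then for every $q\ge1$ $$\liminf_{\lambda\to+\infty}\operatorname{Var}\big(Z^{(q)}_\lambda(\phi)\big)\ \ge\ \frac1{q!}\,\|\gamma^-\|_1\,D^-\big(\mu^{*q}(f_q)\big)$$ and $$\limsup_{\lambda\to+\infty}\operatorname{Var}\big(Z^{(q)}_\lambda(\phi)\big)\ \le\ \frac1{q!}\,\|\gamma^+\|_1\,D^+\big(\mu^{*q}(f_q)\big).$$
   Context: $V,W$ are finite-dimensional real vector spaces of dimensions $d,n$; $V$ carries a Euclidean norm and its Lebesgue measure, $V^*$ the dual norm and Lebesgue measure. $X:V\to W$ is a (measurable) centered stationary Gaussian field whose covariance $\Omega(v)(\ell,m)=\mathbb E[\ell(X(v))\,m(X(0))]$, $\ell,m\in W^*$, is continuous in $v$, with $\Omega(0)$ positive definite. Hermite expansion: $\Omega(0)$ is a scalar product on $W^*$; it is transported by duality to $W$, and to $(W^* )^{\otimes q}$ by $\langle \ell_1\otimes\cdots\otimes\ell_q,m_1\otimes\cdots\otimes m_q\rangle=\prod_k\langle\ell_k,m_k\rangle$. For $x\in W$, $H^q_x=(-1)^q e^{\|x\|^2/2}D^q_x\big[e^{-\|\cdot\|^2/2}\big]$ is a symmetric $q$-linear form on $W$. For $f\in L^2(\eta)$ set $f_q=\int_W f(x)H^q_x\,\mathrm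 d\eta(x)$ and $\pi_q(f)(x)=\frac1{q!}\langle f_q,H^q_x\rangle$. Set $Z^{(q)}_\lambda(\phi)=\lambda^{-d/2}\int_V\phi(v/\lambda)\,\pi_q(f)(X(v))\,\mathrm dv$. Test functions: with $\hat\phi(\xi)=\int_V\phi(v)e^{-2i\pi\xi(v)}\mathrm dv$ and $\gamma=|\hat\phi|^2$ on $V^*$, let $\gamma^+(x)=\sup_{\|y\|\ge\|x\|}\gamma(y)$ and $\gamma^-(x)=\inf_{\|y\|\le\|x\|}\gamma(y)$. A test function is a real-valued $\phi\in L^1\cap L^2(V)$ with $\|\phi\|_2=1$ and $\gamma^+\in L^1(V^* )$. Spectral measure: with $W_{\mathbb C}$ the complexification of $W$, $\mu$ is the measure on $V^*$ with values in positive semi-definite Hermitian forms on $W_{\mathbb C}^*$ such that $\Omega(v)=\int_{V^*}e^{2i\pi\xi(v)}\mathrm d\mu(\xi)$. Its $q$-fold convolution $\mu^{*q}$ is the measure with values in positive semi-definite Hermitian forms on $(W_{\mathbb C}^* )^{\otimes q}$ determined by $\mu^{*q}(\ell_1\otimes\cdots\otimes\ell_q,m_1\otimes\cdots\otimes m_q)=\mu(\ell_1,m_1)*\cdots*\mu(\ell_q,m_q)$, and $\mu^{*q}(g)$ denotes the non-negative finite measure $E\mapsto\mu^{*q}(E)(g,g)$. For a finite measure $\nu$ on $V^*$: $D^+\nu=\limsup_{R\to0}\frac{\nu(B(0,R))}{\operatorname{Vol}(B(0,R))}$ and $D^-\nu=\liminf_{R\to0}\frac{\nu(B(0,R))}{\operatorname{Vol}(B(0,R))}$,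 in $[0,+\infty]$ for non-negative $\nu$; convention $0\cdot\infty=0$. *)

theory Defs
  imports "HOL-Probability.Probability"
begin

text \<open>
  Conventions. The dual of the Euclidean space \<open>'v\<close> is identified isometrically with \<open>'v\<close> itself
  by the Riesz map, so that \<open>\<xi>(v)\<close> is written \<open>\<xi> \<bullet> v\<close> and the Lebesgue measure of the dual is
  \<^const>\<open>lborel\<close>.
  The space \<open>'w\<close> is only used as a finite-dimensional real vector space: elements of its dual are
  linear functions \<open>'w \<Rightarrow> real\<close>, and elements of the dual of its complexification are real-linear
  functions \<open>'w \<Rightarrow> complex\<close>. The inner product of \<open>'w\<close> serves only to name a linear basis
  \<^const>\<open>Basis\<close> together with its dual basis \<open>\<lambda>x. x \<bullet> b\<close>; no definition depends on the choice of
  that basis.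
  An element of the \<open>q\<close>-fold tensor power of a dual space is a \<open>q\<close>-linear form, represented as a
  function of a family \<open>nat \<Rightarrow> 'w\<close> of which only the entries with index below \<open>q\<close> matter.
\<close>

definition gaussian_rv :: "'a measure \<Rightarrow> ('a \<Rightarrow> real) \<Rightarrow> bool" where
  "gaussian_rv M Y \<longleftrightarrow> Y \<in> borel_measurable M \<and>
     ((\<exists>m \<sigma>. \<sigma> > 0 \<and> distributed M lborel Y (normal_density m \<sigma>)) \<or>
      (\<exists>m. AE \<omega> in M. Y \<omega> = m))"

definition gaussian_field ::
    "'a measure \<Rightarrow> ('v \<Rightarrow> 'a \<Rightarrow> 'w::euclidean_space) \<Rightarrow> bool" where
  "gaussian_field M X \<longleftrightarrow>
     (\<forall>J l. finite J \<longrightarrow> (\<forall>v\<in>J. linear (l v)) \<longrightarrow> gaussian_rv M (\<lambda>\<omega>. \<Sum>v\<in>J. l v (X v \<omega>)))"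

definition measurable_field ::
    "'a measure \<Rightarrow> ('v::euclidean_space \<Rightarrow> 'a \<Rightarrow> 'w::euclidean_space) \<Rightarrow> bool" where
  "measurable_field M X \<longleftrightarrow> (\<lambda>(v, \<omega>). X v \<omega>) \<in> borel_measurable (borel \<Otimes>\<^sub>M M)"

definition centered_field ::
    "'a measure \<Rightarrow> ('v \<Rightarrow> 'a \<Rightarrow> 'w::euclidean_space) \<Rightarrow> bool" where
  "centered_field M X \<longleftrightarrow> (\<forall>v. (LINT \<omega>|M. X v \<omega>) = 0)"

definition stationary_field ::
    "'a measure \<Rightarrow> ('v::euclidean_space \<Rightarrow> 'a \<Rightarrow> 'w::euclidean_space) \<Rightarrow> bool" where
  "stationary_field M X \<longleftrightarrow>
     (\<forall>h J. finite J \<longrightarrow>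
        distr M (Pi\<^sub>M J (\<lambda>_. borel)) (\<lambda>\<omega>. \<lambda>v\<in>J. X (v + h) \<omega>) =
        distr M (Pi\<^sub>M J (\<lambda>_. borel)) (\<lambda>\<omega>. \<lambda>v\<in>J. X v \<omega>))"

definition field_cov ::
    "'a measure \<Rightarrow> ('v::zero \<Rightarrow> 'a \<Rightarrow> 'w) \<Rightarrow> 'v \<Rightarrow> ('w \<Rightarrow> real) \<Rightarrow> ('w \<Rightarrow> real) \<Rightarrow> real" where
  "field_cov M X v l m = (LINT \<omega>|M. l (X v \<omega>) * m (X 0 \<omega>))"

definition continuous_cov ::
    "('v::topological_space \<Rightarrow> ('w::real_vector \<Rightarrow> real) \<Rightarrow> ('w \<Rightarrow> real) \<Rightarrow> real) \<Rightarrow> bool" where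
  "continuous_cov \<Omega> \<longleftrightarrow>
     (\<forall>l m. linear l \<longrightarrow> linear m \<longrightarrow> continuous_on UNIV (\<lambda>v. \<Omega> v l m))"

definition pos_def_form ::
    "(('w::real_vector \<Rightarrow> real) \<Rightarrow> ('w \<Rightarrow> real) \<Rightarrow> real) \<Rightarrow> bool" where
  "pos_def_form B \<longleftrightarrow> (\<forall>l. linear l \<longrightarrow> l \<noteq> (\<lambda>_. 0) \<longrightarrow> B l l > 0)"

text \<open>Below, \<open>B\<close> is a scalar product on the dual of \<open>'w\<close>, later \<open>field_cov M X 0\<close>.\<close>

definition riesz_form ::
    "(('w::real_vector \<Rightarrow> real) \<Rightarrow> ('w \<Rightarrow> real) \<Rightarrow> real) \<Rightarrow> 'w \<Rightarrow> ('w \<Rightarrow> real)" where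
  "riesz_form B x = (THE l. linear l \<and> (\<forall>m. linear m \<longrightarrow> B l m = m x))"

definition norm_sq ::
    "(('w::real_vector \<Rightarrow> real) \<Rightarrow> ('w \<Rightarrow> real) \<Rightarrow> real) \<Rightarrow> 'w \<Rightarrow> real" where
  "norm_sq B x = B (riesz_form B x) (riesz_form B x)"

primrec iterated_deriv ::
    "nat \<Rightarrow> ('w::real_normed_vector \<Rightarrow> real) \<Rightarrow> 'w \<Rightarrow> (nat \<Rightarrow> 'w) \<Rightarrow> real" where
  "iterated_deriv 0 g x w = g x"
| "iterated_deriv (Suc q) g x w =
     frechet_derivative (\<lambda>y. iterated_deriv q g y w) (at x) (w q)"

definition hermite_form ::
    "(('w::real_normed_vector \<Rightarrow> real) \<Rightarrow> ('w \<Rightarrow> real) \<Rightarrow> real) \<Rightarrow> nat \<Rightarrow> 'w \<Rightarrow> (nat \<Rightarrow> 'w) \<Rightarrow> real"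
  where
  "hermite_form B q x w =
     (-1) ^ q * exp (norm_sq B x / 2) * iterated_deriv q (\<lambda>y. exp (- norm_sq B y / 2)) x w"

text \<open>
  Bilinear extension of
  \<open>\<langle>l\<^sub>1 \<otimes> \<dots> \<otimes> l\<^sub>q, m\<^sub>1 \<otimes> \<dots> \<otimes> m\<^sub>q\<rangle> = \<Prod>\<^sub>k B l\<^sub>k m\<^sub>k\<close>: a \<open>q\<close>-linear form \<open>S\<close> is the sum over all
  multi-indices \<open>i\<close> of \<open>S i\<close> times the tensor product of the dual basis forms \<open>\<lambda>x. x \<bullet> i k\<close>.
\<close>

definition multi_indices :: "nat \<Rightarrow> (nat \<Rightarrow> 'w::euclidean_space) set" where
  "multi_indices q = {..<q} \<rightarrow>\<^sub>E Basis"

definition tensor_inner ::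
    "(('w::euclidean_space \<Rightarrow> real) \<Rightarrow> ('w \<Rightarrow> real) \<Rightarrow> real) \<Rightarrow> nat \<Rightarrow>
     ((nat \<Rightarrow> 'w) \<Rightarrow> real) \<Rightarrow> ((nat \<Rightarrow> 'w) \<Rightarrow> real) \<Rightarrow> real" where
  "tensor_inner B q S T =
     (\<Sum>i\<in>multi_indices q. \<Sum>j\<in>multi_indices q.
        S i * T j * (\<Prod>k<q. B (\<lambda>x. x \<bullet> i k) (\<lambda>x. x \<bullet> j k)))"

lemma tensor_inner_elementary:
  fixes B :: "('w::euclidean_space \<Rightarrow> real) \<Rightarrow> ('w \<Rightarrow> real) \<Rightarrow> real"
  assumes add_left: "\<And>l l' m. linear l \<Longrightarrow> linear l' \<Longrightarrow> linear m \<Longrightarrow>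
      B (\<lambda>x. l x + l' x) m = B l m + B l' m"
    and scale_left: "\<And>c l m. linear l \<Longrightarrow> linear m \<Longrightarrow> B (\<lambda>x. c * l x) m = c * B l m"
    and sym: "\<And>l m. linear l \<Longrightarrow> linear m \<Longrightarrow> B l m = B m l"
    and lin: "\<And>k. k < q \<Longrightarrow> linear (l k)" "\<And>k. k < q \<Longrightarrow> linear (m k)"
  shows "tensor_inner B q (\<lambda>w. \<Prod>k<q. l k (w k)) (\<lambda>w. \<Prod>k<q. m k (w k)) = (\<Prod>k<q. B (l k) (m k))"
proof -
  have lin_sum: "linear (\<lambda>x. \<Sum>b\<in>A. a b * (x \<bullet> b))" for A :: "'w set" and a :: "'w \<Rightarrow> real"
    by (auto intro!: linear_compose_sum linearI simp: algebra_simps inner_add_left)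
  have linb: "linear (\<lambda>x. x \<bullet> b)" "linear (\<lambda>x. c * (x \<bullet> b))" for b :: 'w and c :: real
    by (auto intro!: linearI simp: algebra_simps inner_add_left)
  have zero: "B (\<lambda>x. 0) n = 0" if "linear n" for n
    using scale_left[OF linb(1) that, of 0] by simp
  have sum_left: "B (\<lambda>x. \<Sum>b\<in>A. a b * (x \<bullet> b)) n = (\<Sum>b\<in>A. a b * B (\<lambda>x. x \<bullet> b) n)"
    if "finite A" "linear n" for A :: "'w set" and a :: "'w \<Rightarrow> real" and n
    using that(1)
  proof (induction A rule: finite_induct)
    case empty
    then show ?case using zero[OF that(2)] by simp
  next
    case (insert b A)
    then show ?case
      using add_left[OF linb(2) lin_sum that(2)] scale_left[OF linb(1) that(2)] by simp
  qed
  have rep: "g = (\<lambda>x. \<Sum>b\<in>Basis. g b * (x \<bullet> b))" if "linear g" for g :: "'w \<Rightarrow> real"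
  proof
    fix x
    have "g x = g (\<Sum>b\<in>Basis. (x \<bullet> b) *\<^sub>R b)" by (simp add: euclidean_representation)
    also have "\<dots> = (\<Sum>b\<in>Basis. g b * (x \<bullet> b))"
      using that by (simp add: linear_sum linear_scale mult.commute)
    finally show "g x = (\<Sum>b\<in>Basis. g b * (x \<bullet> b))" .
  qed
  have expand: "B g h = (\<Sum>b\<in>Basis. \<Sum>c\<in>Basis. g b * h c * B (\<lambda>x. x \<bullet> b) (\<lambda>x. x \<bullet> c))"
    if g: "linear g" and h: "linear h" for g h
  proof -
    have *: "B n h = (\<Sum>c\<in>Basis. h c * B n (\<lambda>x. x \<bullet> c))" if n: "linear n" for n
    proof -
      have "B n h = B (\<lambda>x. \<Sum>c\<in>Basis. h c * (x \<bullet> c)) n"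
        using sym[OF n h] rep[OF h] by simp
      then show ?thesis
        using sum_left[OF finite_Basis n] sym[OF n linb(1)] by simp
    qed
    have "B g h = B (\<lambda>x. \<Sum>b\<in>Basis. g b * (x \<bullet> b)) h" using rep[OF g] by simp
    also have "\<dots> = (\<Sum>b\<in>Basis. g b * B (\<lambda>x. x \<bullet> b) h)" by (rule sum_left[OF finite_Basis h])
    also have "\<dots> = (\<Sum>b\<in>Basis. \<Sum>c\<in>Basis. g b * h c * B (\<lambda>x. x \<bullet> b) (\<lambda>x. x \<bullet> c))"
      by (intro sum.cong refl, subst *[OF linb(1)]) (simp add: sum_distrib_left mult.assoc)
    finally show ?thesis .
  qed
  have "(\<Prod>k<q. B (l k) (m k)) =
    (\<Prod>k<q. \<Sum>b\<in>Basis. \<Sum>c\<in>Basis. l k b * m k c * B (\<lambda>x. x \<bullet> b) (\<lambda>x. x \<bullet> c))"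
    by (intro prod.cong refl expand lin) auto
  also have "\<dots> = (\<Sum>i\<in>multi_indices q. \<Prod>k<q. \<Sum>c\<in>Basis.
      l k (i k) * m k c * B (\<lambda>x. x \<bullet> i k) (\<lambda>x. x \<bullet> c))"
    unfolding multi_indices_def by (rule prod_sum_PiE) auto
  also have "\<dots> = (\<Sum>i\<in>multi_indices q. \<Sum>j\<in>multi_indices q. \<Prod>k<q.
      l k (i k) * m k (j k) * B (\<lambda>x. x \<bullet> i k) (\<lambda>x. x \<bullet> j k))"
    unfolding multi_indices_def by (intro sum.cong refl prod_sum_PiE) auto
  finally show ?thesis
    by (simp add: tensor_inner_def prod.distrib)
qed

definition chaos_coeff ::
    "(('w::euclidean_space \<Rightarrow> real) \<Rightarrow> ('w \<Rightarrow> real) \<Rightarrow> real) \<Rightarrow> 'w measure \<Rightarrow> ('w \<Rightarrow> real) \<Rightarrow> nat \<Rightarrow>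
     (nat \<Rightarrow> 'w) \<Rightarrow> real" where
  "chaos_coeff B \<eta> f q w = (LINT x|\<eta>. f x * hermite_form B q x w)"

definition chaos_proj ::
    "(('w::euclidean_space \<Rightarrow> real) \<Rightarrow> ('w \<Rightarrow> real) \<Rightarrow> real) \<Rightarrow> 'w measure \<Rightarrow> ('w \<Rightarrow> real) \<Rightarrow> nat \<Rightarrow>
     'w \<Rightarrow> real" where
  "chaos_proj B \<eta> f q x = tensor_inner B q (chaos_coeff B \<eta> f q) (hermite_form B q x) / fact q"

abbreviation field_law ::
    "'a measure \<Rightarrow> ('v::zero \<Rightarrow> 'a \<Rightarrow> 'w::euclidean_space) \<Rightarrow> 'w measure" where
  "field_law M X \<equiv> distr M borel (X 0)"

definition chaos_Z ::
    "'a measure \<Rightarrow> ('v::euclidean_space \<Rightarrow> 'a \<Rightarrow> 'w::euclidean_space) \<Rightarrow> ('w \<Rightarrow> real) \<Rightarrow> nat \<Rightarrow>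
     ('v \<Rightarrow> real) \<Rightarrow> real \<Rightarrow> 'a \<Rightarrow> real" where
  "chaos_Z M X f q \<phi> r \<omega> =
     r powr (- real DIM('v) / 2) *
     (LINT v|lborel. \<phi> (v /\<^sub>R r) * chaos_proj (field_cov M X 0) (field_law M X) f q (X v \<omega>))"

definition fourier :: "('v::euclidean_space \<Rightarrow> real) \<Rightarrow> 'v \<Rightarrow> complex" where
  "fourier \<phi> \<xi> = (LINT v|lborel. complex_of_real (\<phi> v) * exp (- 2 * \<i> * pi * (\<xi> \<bullet> v)))"

definition power_spectrum :: "('v::euclidean_space \<Rightarrow> real) \<Rightarrow> 'v \<Rightarrow> real" where
  "power_spectrum \<phi> \<xi> = (cmod (fourier \<phi> \<xi>))\<^sup>2"

definition radial_sup :: "('v::real_normed_vector \<Rightarrow> real) \<Rightarrow> 'v \<Rightarrow> real" where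
  "radial_sup g x = (SUP y\<in>{y. norm y \<ge> norm x}. g y)"

definition radial_inf :: "('v::real_normed_vector \<Rightarrow> real) \<Rightarrow> 'v \<Rightarrow> real" where
  "radial_inf g x = (INF y\<in>{y. norm y \<le> norm x}. g y)"

definition test_function :: "('v::euclidean_space \<Rightarrow> real) \<Rightarrow> bool" where
  "test_function \<phi> \<longleftrightarrow>
     integrable lborel \<phi> \<and> integrable lborel (\<lambda>v. (\<phi> v)\<^sup>2) \<and>
     sqrt (LINT v|lborel. (\<phi> v)\<^sup>2) = 1 \<and>
     integrable lborel (radial_sup (power_spectrum \<phi>))"

definition L1_norm :: "('v::euclidean_space \<Rightarrow> real) \<Rightarrow> ennreal" where
  "L1_norm g = (\<integral>\<^sup>+x. ennreal \<bar>g x\<bar> \<partial>lborel)"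

definition complex_measure :: "('v::topological_space set \<Rightarrow> complex) \<Rightarrow> bool" where
  "complex_measure \<nu> \<longleftrightarrow>
     (\<forall>A :: nat \<Rightarrow> 'v set. range A \<subseteq> sets borel \<longrightarrow> disjoint_family A \<longrightarrow>
        (\<lambda>n. \<nu> (A n)) sums \<nu> (\<Union>n. A n))"

text \<open>
  The positive part in the Jordan decomposition of a real-valued measure. The function
  \<^const>\<open>ennreal\<close> truncates negative values to \<open>0\<close>, which is harmless here as \<open>F = {}\<close> is admissible.
\<close>

definition jordan_pos :: "('v::topological_space set \<Rightarrow> real) \<Rightarrow> 'v measure" where
  "jordan_pos r =
     measure_of UNIV (sets borel) (\<lambda>E. SUP F\<in>{F \<in> sets borel. F \<subseteq> E}. ennreal (r F))"

definition complex_measure_integral ::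
    "('v::topological_space set \<Rightarrow> complex) \<Rightarrow> ('v \<Rightarrow> complex) \<Rightarrow> complex" where
  "complex_measure_integral \<nu> g =
     (LINT x|jordan_pos (\<lambda>E. Re (\<nu> E)). g x) - (LINT x|jordan_pos (\<lambda>E. - Re (\<nu> E)). g x) +
     \<i> * ((LINT x|jordan_pos (\<lambda>E. Im (\<nu> E)). g x) - (LINT x|jordan_pos (\<lambda>E. - Im (\<nu> E)). g x))"

definition complex_measure_conv ::
    "('v::euclidean_space set \<Rightarrow> complex) \<Rightarrow> ('v set \<Rightarrow> complex) \<Rightarrow> 'v set \<Rightarrow> complex" where
  "complex_measure_conv \<nu>1 \<nu>2 E = complex_measure_integral \<nu>2 (\<lambda>y. \<nu>1 {x. x + y \<in> E})"

text \<open>The convolution of \<open>\<nu> 0, \<dots>, \<nu> (q - 1)\<close>; the empty one is the Dirac measure at the origin.\<close>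

primrec complex_measure_convs ::
    "nat \<Rightarrow> (nat \<Rightarrow> 'v::euclidean_space set \<Rightarrow> complex) \<Rightarrow> 'v set \<Rightarrow> complex" where
  "complex_measure_convs 0 \<nu> = (\<lambda>E. indicator E 0)"
| "complex_measure_convs (Suc q) \<nu> = complex_measure_conv (complex_measure_convs q \<nu>) (\<nu> q)"

definition psd_hermitian_form ::
    "(('w::real_vector \<Rightarrow> complex) \<Rightarrow> ('w \<Rightarrow> complex) \<Rightarrow> complex) \<Rightarrow> bool" where
  "psd_hermitian_form B \<longleftrightarrow>
     (\<forall>l l' m c. linear l \<longrightarrow> linear l' \<longrightarrow> linear m \<longrightarrow>
        B (\<lambda>x. c * l x + l' x) m = c * B l m + B l' m) \<and>
     (\<forall>l m. linear l \<longrightarrow> linear m \<longrightarrow> B m l = cnj (B l m)) \<and>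
     (\<forall>l. linear l \<longrightarrow> 0 \<le> Re (B l l))"

text \<open>
  The identity \<open>\<Omega> v = \<integral> exp (2 \<pi> \<i> \<xi> \<bullet> v) d\<mu>(\<xi>)\<close> is tested on real linear forms only; it extends
  to complex ones by sesquilinearity.
\<close>

definition is_spectral_measure ::
    "('v::euclidean_space \<Rightarrow> ('w::real_vector \<Rightarrow> real) \<Rightarrow> ('w \<Rightarrow> real) \<Rightarrow> real) \<Rightarrow>
     ('v set \<Rightarrow> ('w \<Rightarrow> complex) \<Rightarrow> ('w \<Rightarrow> complex) \<Rightarrow> complex) \<Rightarrow> bool" where
  "is_spectral_measure \<Omega> \<mu> \<longleftrightarrow>
     (\<forall>E\<in>sets borel. psd_hermitian_form (\<mu> E)) \<and>
     (\<forall>l m. linear l \<longrightarrow> linear m \<longrightarrow> complex_measure (\<lambda>E. \<mu> E l m)) \<and>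
     (\<forall>v l m. linear l \<longrightarrow> linear m \<longrightarrow>
        complex_of_real (\<Omega> v l m) =
        complex_measure_integral (\<lambda>E. \<mu> E (\<lambda>x. complex_of_real (l x)) (\<lambda>x. complex_of_real (m x)))
          (\<lambda>\<xi>. exp (2 * \<i> * pi * (\<xi> \<bullet> v))))"

text \<open>
  Sesquilinear extension of the formula
  \<open>\<mu>\<^sup>*\<^sup>q (l\<^sub>1 \<otimes> \<dots> \<otimes> l\<^sub>q, m\<^sub>1 \<otimes> \<dots> \<otimes> m\<^sub>q) = \<mu>(l\<^sub>1, m\<^sub>1) * \<dots> * \<mu>(l\<^sub>q, m\<^sub>q)\<close>, with tensors expanded
  in the dual basis as for \<open>tensor_inner\<close>.
\<close>

definition spectral_conv ::
    "('v::euclidean_space set \<Rightarrow> ('w::euclidean_space \<Rightarrow> complex) \<Rightarrow> ('w \<Rightarrow> complex) \<Rightarrow> complex) \<Rightarrow>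
     nat \<Rightarrow> 'v set \<Rightarrow> ((nat \<Rightarrow> 'w) \<Rightarrow> complex) \<Rightarrow> ((nat \<Rightarrow> 'w) \<Rightarrow> complex) \<Rightarrow> complex" where
  "spectral_conv \<mu> q E S T =
     (\<Sum>i\<in>multi_indices q. \<Sum>j\<in>multi_indices q.
        S i * cnj (T j) *
        complex_measure_convs q
          (\<lambda>k F. \<mu> F (\<lambda>x. complex_of_real (x \<bullet> i k)) (\<lambda>x. complex_of_real (x \<bullet> j k))) E)"

text \<open>
  The finite non-negative measure \<open>E \<mapsto> \<mu>\<^sup>*\<^sup>q(E)(g, g)\<close> for a real tensor \<open>g\<close>. Its values
  are real because \<open>\<mu>\<^sup>*\<^sup>q(E)\<close> is Hermitian.
\<close>

definition spectral_conv_at ::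
    "('v::euclidean_space set \<Rightarrow> ('w::euclidean_space \<Rightarrow> complex) \<Rightarrow> ('w \<Rightarrow> complex) \<Rightarrow> complex) \<Rightarrow>
     nat \<Rightarrow> ((nat \<Rightarrow> 'w) \<Rightarrow> real) \<Rightarrow> 'v measure" where
  "spectral_conv_at \<mu> q g =
     measure_of UNIV (sets borel)
       (\<lambda>E. ennreal (Re (spectral_conv \<mu> q E
          (\<lambda>w. complex_of_real (g w)) (\<lambda>w. complex_of_real (g w)))))"

definition upper_density_at_0 :: "'v::euclidean_space measure \<Rightarrow> ennreal" where
  "upper_density_at_0 \<nu> =
     Limsup (at_right 0) (\<lambda>R. emeasure \<nu> (ball 0 R) / emeasure lborel (ball (0::'v) R))"

definition lower_density_at_0 :: "'v::euclidean_space measure \<Rightarrow> ennreal" where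
  "lower_density_at_0 \<nu> =
     Liminf (at_right 0) (\<lambda>R. emeasure \<nu> (ball 0 R) / emeasure lborel (ball (0::'v) R))"

end

theory Submission
  imports Defs
begin

text \<open>
  Gaussian integration by parts makes the operator \<open>F \<mapsto> \<langle>x, a\<rangle> F - \<partial>\<^sub>a F\<close> adjoint to a directional
  derivative in the other variable of the pair \<open>(X u, X v)\<close>. The Hermite forms arise by iterating
  this operator on the constant \<open>1\<close>, so \<open>q\<close> integrations by parts give
  \<open>E[\<pi>\<^sub>q(f)(X u) \<pi>\<^sub>q(f)(X v)] = \<langle>\<Omega>(u - v)\<^sup>\<otimes>\<^sup>q f\<^sub>q, f\<^sub>q\<rangle> / q!\<close>.
  In terms of the spectral measure the right-hand side is the Fourier transform of
  \<open>\<nu> = \<mu>\<^sup>*\<^sup>q(f\<^sub>q)\<close>, which is non-negative because \<open>\<mu>\<close> has a positive semidefinite matrix density and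
  tensor products of positive semidefinite matrices are positive semidefinite. Hence, by Fubini,
  the variance is \<open>\<lambda>\<^sup>d / q! \<integral> \<gamma>(\<lambda>\<xi>) d\<nu>(\<xi>)\<close>. Finally \<open>\<gamma>\<^sup>- \<le> \<gamma> \<le> \<gamma>\<^sup>+\<close>, and the level sets of \<open>\<gamma>\<^sup>-\<close> and
  \<open>\<gamma>\<^sup>+\<close> are balls, on which \<open>\<nu>\<close> is compared with Lebesgue measure; the part of \<open>\<gamma>\<^sup>+\<close> far from the origin
  is negligible since \<open>R\<^sup>d \<gamma>\<^sup>+(R)\<close> tends to \<open>0\<close>.
\<close>

text \<open>The laws involved may be degenerate: \<open>(X u, X v)\<close> has a singular covariance
  when u = v, and \<open>gaussian_rv\<close> admits constants. Integration by parts therefore cannot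
  use a joint density. It is derived for polynomials only, from the one-dimensional moments of
  linear forms. The second obstacle is the spectral measure, given as a family of complex set
  functions whose convolutions are defined through Jordan decompositions. As soon as all entries
  have densities against one finite measure, with a matrix that is positive semidefinite at every
  single point, the convolution power evaluated at a tensor is the image of a weighted product
  measure under addition, and the Jordan parts disappear. In the final comparison the product of 0
  and infinity really occurs: \<gamma>+ may have integral 0 while the upper density at the origin is
  infinite. Then \<gamma> itself has to vanish, and only its continuity excludes a nonzero value at
  the origin.\<close>

lemmas lint_cong = Bochner_Integration.integral_cong[OF refl]
lemmas integrable_dominated = Bochner_Integration.integrable_bound

section \<open>Gaussian integration by parts\<close>

definition ddir :: "'e::real_normed_vector \<Rightarrow> ('e \<Rightarrow> real) \<Rightarrow> 'e \<Rightarrow> real" where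
  "ddir a P x = frechet_derivative P (at x) a"

text \<open>Polynomial functions, built by multiplying with one linear form at a time because
  integration by parts removes exactly one linear factor.\<close>

inductive polf :: "('e::euclidean_space \<Rightarrow> real) \<Rightarrow> bool" where
  polf_const: "polf (\<lambda>_. c)"
| polf_add: "polf P \<Longrightarrow> polf Q \<Longrightarrow> polf (\<lambda>x. P x + Q x)"
| polf_lmul: "polf P \<Longrightarrow> polf (\<lambda>x. (x \<bullet> a) * P x)"

lemma ddirI: "(P has_derivative D) (at x) \<Longrightarrow> ddir a P x = D a"
  by (simp add: ddir_def frechet_derivative_at[symmetric])

lemma ddir_works: "P differentiable at x \<Longrightarrow> (P has_derivative (\<lambda>a. ddir a P x)) (at x)"
  unfolding ddir_def using frechet_derivative_works[of P "at x"] by (simp add: eta_contract_eq)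

lemma polf_differentiable: "polf P \<Longrightarrow> P differentiable at x"
proof (induction rule: polf.induct)
  case (polf_lmul P a)
  then show ?case
    by (intro differentiable_mult bounded_linear_imp_differentiable[OF bounded_linear_inner_left])
qed (auto intro: differentiable_add)

lemma ddir_const [simp]: "ddir a (\<lambda>_. c) x = 0"
  by (rule trans[OF ddirI]) (auto intro: derivative_eq_intros)

lemma ddir_add:
  "P differentiable at x \<Longrightarrow> Q differentiable at x \<Longrightarrow>
   ddir a (\<lambda>x. P x + Q x) x = ddir a P x + ddir a Q x"
  by (rule trans[OF ddirI[OF has_derivative_add[OF ddir_works ddir_works]]]) auto

lemma ddir_mult:
  "P differentiable at x \<Longrightarrow> Q differentiable at x \<Longrightarrow>
   ddir a (\<lambda>x. P x * Q x) x = P x * ddir a Q x + ddir a P x * Q x"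
  by (rule trans[OF ddirI[OF has_derivative_mult[OF ddir_works ddir_works]]]) auto

lemma ddir_inner [simp]: "ddir a (\<lambda>x. x \<bullet> b) x = a \<bullet> b"
  by (rule trans[OF ddirI[OF bounded_linear_imp_has_derivative[OF bounded_linear_inner_left]]]) simp

lemma ddir_lmul:
  "P differentiable at x \<Longrightarrow>
   ddir b (\<lambda>x. (x \<bullet> a) * P x) x = (b \<bullet> a) * P x + (x \<bullet> a) * ddir b P x"
  by (simp add: ddir_mult bounded_linear_imp_differentiable bounded_linear_inner_left)

lemma ddir_cmul: "P differentiable at x \<Longrightarrow> ddir a (\<lambda>x. c * P x) x = c * ddir a P x"
  by (simp add: ddir_mult)

lemma ddir_linear:
  assumes "P differentiable at x" shows "linear (\<lambda>a. ddir a P x)"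
  using has_derivative_linear[OF ddir_works[OF assms]] .

lemma polf_cmul: "polf P \<Longrightarrow> polf (\<lambda>x. c * P x)"
proof (induction rule: polf.induct)
  case (polf_add P Q)
  then show ?case by (simp add: distrib_left polf.polf_add)
next
  case (polf_lmul P a)
  then show ?case using polf.polf_lmul[of "\<lambda>x. c * P x" a] by (simp add: mult.left_commute)
qed (rule polf.polf_const)

lemma polf_diff: "polf P \<Longrightarrow> polf Q \<Longrightarrow> polf (\<lambda>x. P x - Q x)"
  using polf_add[OF _ polf_cmul[of Q "-1"], of P] by simp

lemma polf_sum: "(\<And>i. i \<in> I \<Longrightarrow> polf (P i)) \<Longrightarrow> polf (\<lambda>x. \<Sum>i\<in>I. P i x)"
  by (induction I rule: infinite_finite_induct) (auto intro: polf.intros)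

lemma polf_mult: "polf P \<Longrightarrow> polf Q \<Longrightarrow> polf (\<lambda>x. P x * Q x)"
proof (induction rule: polf.induct)
  case (polf_const c)
  then show ?case by (rule polf_cmul)
next
  case (polf_add P R)
  then show ?case by (simp add: distrib_right polf.polf_add)
next
  case (polf_lmul P a)
  then show ?case using polf.polf_lmul[of "\<lambda>x. P x * Q x" a] by (simp add: mult.assoc)
qed

lemma polf_ddir: "polf P \<Longrightarrow> polf (ddir a P)"
proof (induction rule: polf.induct)
  case (polf_const c)
  have "ddir a (\<lambda>_. c) = (\<lambda>_. 0)" by auto
  then show ?case by (simp add: polf.polf_const)
next
  case (polf_add P Q)
  then have "ddir a (\<lambda>x. P x + Q x) = (\<lambda>x. ddir a P x + ddir a Q x)"
    by (auto simp: ddir_add polf_differentiable)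
  with polf_add show ?case by (simp add: polf.polf_add)
next
  case (polf_lmul P b)
  then have "ddir a (\<lambda>x. (x \<bullet> b) * P x) = (\<lambda>x. (a \<bullet> b) * P x + (x \<bullet> b) * ddir a P x)"
    by (auto simp: ddir_lmul polf_differentiable)
  with polf_lmul show ?case by (simp add: polf.intros polf_cmul)
qed

text \<open>For polynomials the symmetry of second derivatives is a structural induction. It is what
  makes creation operators commute.\<close>

lemma ddir_commute: "polf P \<Longrightarrow> ddir a (ddir b P) x = ddir b (ddir a P) x"
proof (induction arbitrary: x rule: polf.induct)
  case (polf_const c)
  have "ddir a (\<lambda>_. c) = (\<lambda>_. 0)" "ddir b (\<lambda>_. c) = (\<lambda>_. 0)" by auto
  then show ?case by simp
next
  case (polf_add P Q)
  have *: "ddir e (\<lambda>x. P x + Q x) = (\<lambda>x. ddir e P x + ddir e Q x)" for e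
    using polf_add by (auto simp: ddir_add polf_differentiable)
  show ?case using polf_add by (simp add: * ddir_add polf_differentiable polf_ddir)
next
  case (polf_lmul P c)
  have *: "ddir e (\<lambda>x. (x \<bullet> c) * P x) = (\<lambda>x. (e \<bullet> c) * P x + (x \<bullet> c) * ddir e P x)" for e
    using polf_lmul by (auto simp: ddir_lmul polf_differentiable)
  have d: "(\<lambda>x. (e \<bullet> c) * P x) differentiable at x" "(\<lambda>x. (x \<bullet> c) * ddir e P x) differentiable at x"
    for e x using polf_lmul by (auto intro!: polf_differentiable polf.intros polf_cmul polf_ddir)
  show ?case
    using polf_lmul by (simp add: * ddir_add d ddir_lmul ddir_cmul polf_differentiable polf_ddir)
qed

lemma continuous_on_polf: "polf P \<Longrightarrow> continuous_on UNIV P"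
  by (induction rule: polf.induct) (auto intro!: continuous_intros)

lemma borel_measurable_polf [measurable_dest]: "polf P \<Longrightarrow> P \<in> borel_measurable borel"
  by (intro borel_measurable_continuous_onI continuous_on_polf)

text \<open>The adjoint L' turns \<open>L x \<bullet> a\<close> into
  \<open>x \<bullet> L' a\<close>, which is again a form of the kind that \<open>polf\<close>
  multiplies by.\<close>

lemma polf_compose:
  assumes "polf P" and "\<And>x y. L x \<bullet> y = x \<bullet> L' y"
  shows "polf (\<lambda>x. P (L x))"
  using assms(1) by induction (auto intro: polf.intros simp: assms(2))

lemma ddir_compose:
  assumes "bounded_linear L" "P differentiable at (L x)"
  shows "ddir a (\<lambda>x. P (L x)) x = ddir (L a) P (L x)"
  by (rule trans[OF ddirI[OF has_derivative_compose[OF bounded_linear_imp_has_derivative[OF assms(1)]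
          ddir_works[OF assms(2)]]]]) auto

section \<open>Moments of Gaussian vectors and Stein's identity\<close>

lemma moment_gaussian_rv:
  assumes "prob_space M" "gaussian_rv M Z" "(LINT \<omega>|M. Z \<omega>) = 0"
  shows "integrable M (\<lambda>\<omega>. Z \<omega> ^ n)"
    and "(LINT \<omega>|M. Z \<omega> ^ n) =
      (if even n then fact n / (2 ^ (n div 2) * fact (n div 2)) * (LINT \<omega>|M. (Z \<omega>)\<^sup>2) ^ (n div 2) else 0)" (is "_ = ?m")
proof -
  interpret prob_space M by fact
  have [measurable]: "Z \<in> borel_measurable M" using assms by (simp add: gaussian_rv_def)
  have "integrable M (\<lambda>\<omega>. Z \<omega> ^ n) \<and> (LINT \<omega>|M. Z \<omega> ^ n) = ?m"
  proof -
    consider m s where "s > 0" "distributed M lborel Z (normal_density m s)"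
      | m where "AE \<omega> in M. Z \<omega> = m"
      using assms(2) by (auto simp: gaussian_rv_def)
    then show ?thesis
    proof cases
      case 1
      have "expectation Z = m" by (rule normal_distributed_expectation[OF 1])
      then have m: "m = 0" using assms by simp
      have var: "(LINT \<omega>|M. (Z \<omega>)\<^sup>2) = s\<^sup>2"
        using normal_distributed_variance[OF 1] assms(3) by simp
      have i: "integrable M (\<lambda>\<omega>. Z \<omega> ^ n) \<longleftrightarrow> integrable lborel (\<lambda>x. normal_density 0 s x * x ^ n)"
        using distributed_integrable[OF 1(2), of "\<lambda>x. x ^ n"] m 1(1) by simp
      have e: "(LINT \<omega>|M. Z \<omega> ^ n) = (LINT x|lborel. normal_density 0 s x * x ^ n)"
        using distributed_integral[OF 1(2), of "\<lambda>x. x ^ n"] m 1(1) by simp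
      show ?thesis
      proof (cases "even n")
        case True
        then obtain k where k: "n = 2 * k" by blast
        \<comment> \<open>This equals (2k - 1)!! times the k-th power of the variance, the double
          factorial being written as (2k)! / (2^k k!).\<close>
        have h: "has_bochner_integral lborel (\<lambda>x. normal_density 0 s x * x ^ (2 * k))
            (fact (2 * k) / ((2 / s\<^sup>2) ^ k * fact k))"
          using normal_moment_even[OF 1(1), of 0 k] by simp
        then show ?thesis using True 1(1) i e var
          by (simp add: k has_bochner_integral_iff power_divide field_simps)
      next
        case False
        then obtain k where k: "n = 2 * k + 1" using oddE by blast
        have "has_bochner_integral lborel (\<lambda>x. normal_density 0 s x * x ^ (2 * k + 1)) 0"
          using normal_moment_odd[OF 1(1), of 0 k] by simp
        then show ?thesis using False i e by (simp add: k has_bochner_integral_iff)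
      qed
    next
      case 2
      \<comment> \<open>A centered constant is 0; the moment formula survives because the variance
        is 0 and \<open>0 ^ 0 = 1\<close>.\<close>
      have "expectation Z = (LINT \<omega>|M. m)" by (rule integral_cong_AE) (use 2 in auto)
      then have "m = 0" using assms(3) by (simp add: prob_space)
      then have z: "AE \<omega> in M. Z \<omega> = 0" using 2 by simp
      have a: "integrable M (\<lambda>\<omega>. Z \<omega> ^ n)"
        by (rule integrable_cong_AE_imp[of M "\<lambda>_. 0 ^ n"]) (use z in auto)
      have b: "(LINT \<omega>|M. Z \<omega> ^ k) = 0 ^ k" for k
        by (subst integral_cong_AE[where g="\<lambda>_. 0 ^ k"]) (use z in \<open>auto simp: prob_space\<close>)
      show ?thesis using a by (auto simp: b power_0_left elim!: evenE)
    qed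
  qed
  then show "integrable M (\<lambda>\<omega>. Z \<omega> ^ n)" "(LINT \<omega>|M. Z \<omega> ^ n) = ?m"
    by auto
qed

lemma linear_eq_inner: "linear l \<Longrightarrow> l x = x \<bullet> (\<Sum>b\<in>Basis. l b *\<^sub>R b)" for l :: "'c::euclidean_space \<Rightarrow> real"
  by (subst (1) euclidean_representation[of x, symmetric])
     (simp add: linear_sum linear_scale inner_sum_right mult.commute)

text \<open>Only the linear forms of Y are required to be Gaussian, so a singular covariance is
  allowed.\<close>

locale gauss_vec = prob_space M for M :: "'a measure" +
  fixes Y :: "'a \<Rightarrow> 'e::euclidean_space"
  assumes Y_measurable [measurable]: "Y \<in> borel_measurable M"
    and Y_gaussian: "gaussian_rv M (\<lambda>s. Y s \<bullet> a)"
    and Y_centered: "expectation (\<lambda>s. Y s \<bullet> a) = 0"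
begin

definition cov :: "'e \<Rightarrow> 'e \<Rightarrow> real" where
  "cov a b = expectation (\<lambda>s. (Y s \<bullet> a) * (Y s \<bullet> b))"

definition cvec :: "'e \<Rightarrow> 'e" where "cvec a = (\<Sum>b\<in>Basis. cov a b *\<^sub>R b)"

lemma integrable_mult_powers:
  assumes "\<And>k. integrable M (\<lambda>s. f s ^ k)" "\<And>k. integrable M (\<lambda>s. g s ^ k)"
  shows "integrable M (\<lambda>s. f s ^ i * g s ^ j :: real)"
proof (rule integrable_dominated)
  show "integrable M (\<lambda>s. f s ^ (2 * i) + g s ^ (2 * j))"
    using assms by auto
  have [measurable]: "f \<in> borel_measurable M" "g \<in> borel_measurable M"
    using assms(1)[of 1] assms(2)[of 1] by auto
  show "(\<lambda>s. f s ^ i * g s ^ j) \<in> borel_measurable M" by measurable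
  show "AE x in M. norm (f x ^ i * g x ^ j) \<le> norm (f x ^ (2 * i) + g x ^ (2 * j))"
  proof (rule AE_I2)
    fix x
    have "2 * (\<bar>f x ^ i\<bar> * \<bar>g x ^ j\<bar>) \<le> \<bar>f x ^ i\<bar>\<^sup>2 + \<bar>g x ^ j\<bar>\<^sup>2"
      using zero_le_power2[of "\<bar>f x ^ i\<bar> - \<bar>g x ^ j\<bar>"] by (simp add: power2_diff)
    then have "\<bar>f x ^ i\<bar> * \<bar>g x ^ j\<bar> \<le> \<bar>f x ^ i\<bar>\<^sup>2 + \<bar>g x ^ j\<bar>\<^sup>2"
      using mult_nonneg_nonneg[of "\<bar>f x ^ i\<bar>" "\<bar>g x ^ j\<bar>"] by linarith
    also have "\<dots> = f x ^ (2 * i) + g x ^ (2 * j)"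
      by (simp only: power2_abs power_mult[symmetric] mult.commute)
    finally show "norm (f x ^ i * g x ^ j) \<le> norm (f x ^ (2 * i) + g x ^ (2 * j))"
      by (simp add: abs_mult)
  qed
qed

text \<open>All powers are treated at once: a product is bounded by the sum of higher powers of its
  factors, so plain integrability would not pass through the induction.\<close>

lemma polf_power_integrable: "polf P \<Longrightarrow> integrable M (\<lambda>s. P (Y s) ^ k)"
proof (induction arbitrary: k rule: polf.induct)
  case (polf_add P Q)
  have "integrable M (\<lambda>s. \<Sum>i\<le>k. of_nat (k choose i) * (P (Y s) ^ i * Q (Y s) ^ (k - i)))"
    using polf_add by (intro Bochner_Integration.integrable_sum integrable_mult_right integrable_mult_powers)
  then show ?case by (simp add: binomial_ring mult.assoc)
next
  case (polf_lmul P a)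
  then show ?case
    using integrable_mult_powers[OF moment_gaussian_rv(1)[OF prob_space_axioms Y_gaussian Y_centered, of a] polf_lmul.IH, of k k]
    by (simp add: power_mult_distrib)
qed auto

lemma polf_integrable: "polf P \<Longrightarrow> integrable M (\<lambda>s. P (Y s))"
  using polf_power_integrable[of P 1] by simp

lemma polf_linpow: "polf P \<Longrightarrow> polf (\<lambda>x. (x \<bullet> z) ^ n * P x)"
  by (induction n) (auto simp: mult.assoc intro: polf.intros)

lemma linear_cov: "linear (cov a)"
proof -
  have i: "integrable M (\<lambda>s. (Y s \<bullet> a) * (Y s \<bullet> b))" for b
    using polf_integrable[of "\<lambda>x. (x \<bullet> a) * ((x \<bullet> b) * 1)"] by (simp add: polf.intros del: mult_1_right) (simp add: polf.intros)
  show ?thesis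
    by (rule linearI) (simp_all add: cov_def inner_add_right distrib_left i mult.left_commute[of "Y _ \<bullet> a"])
qed

lemma cvec_inner: "cvec a \<bullet> b = cov a b"
  using linear_eq_inner[OF linear_cov, of a b] by (simp add: cvec_def inner_commute)

text \<open>By the binomial theorem the expectation is a polynomial in t, so no derivative has to be
  moved under the integral.\<close>

lemma deriv_shifted_power:
  assumes "polf P"
  shows "((\<lambda>t. expectation (\<lambda>s. (Y s \<bullet> (z + t *\<^sub>R l)) ^ n * P (Y s))) has_real_derivative
      of_nat n * expectation (\<lambda>s. (Y s \<bullet> z) ^ (n - 1) * ((Y s \<bullet> l) * P (Y s)))) (at 0)"
proof -
  define c where "c i = of_nat (n choose i) * expectation (\<lambda>s. (Y s \<bullet> l) ^ i * ((Y s \<bullet> z) ^ (n - i) * P (Y s)))" for i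
  have i: "integrable M (\<lambda>s. (Y s \<bullet> l) ^ i * ((Y s \<bullet> z) ^ j * P (Y s)))" for i j
    by (rule polf_integrable[OF polf_linpow[OF polf_linpow[OF assms]]])
  have "expectation (\<lambda>s. (Y s \<bullet> (z + t *\<^sub>R l)) ^ n * P (Y s)) = (\<Sum>i\<le>n. c i * t ^ i)" for t
  proof -
    have "(y \<bullet> (z + t *\<^sub>R l)) ^ n * P y =
       (\<Sum>i\<le>n. (of_nat (n choose i) * t ^ i) * ((y \<bullet> l) ^ i * ((y \<bullet> z) ^ (n - i) * P y)))" for y
    proof -
      have "(y \<bullet> (z + t *\<^sub>R l)) ^ n = (t * (y \<bullet> l) + y \<bullet> z) ^ n" by (simp add: inner_add_right add.commute)
      then show ?thesis
        by (simp add: binomial_ring sum_distrib_right power_mult_distrib mult.assoc mult.left_commute)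
    qed
    then show ?thesis
      by (simp add: c_def i) (simp add: mult_ac)
  qed
  moreover have "((\<lambda>t. \<Sum>i\<le>n. c i * t ^ i) has_real_derivative (\<Sum>i\<le>n. c i * (of_nat i * 0 ^ (i - 1)))) (at 0)"
    by (auto intro!: derivative_eq_intros sum.cong)
  moreover have "(\<Sum>i\<le>n. c i * (of_nat i * 0 ^ (i - 1))) =
    of_nat n * expectation (\<lambda>s. (Y s \<bullet> z) ^ (n - 1) * ((Y s \<bullet> l) * P (Y s)))"
  proof (cases n)
    case (Suc m)
    \<comment> \<open>At t = 0 only i = 1 survives: i = 0 is killed by the factor i, larger i by the
      power of 0.\<close>
    have "(\<Sum>i\<le>n. c i * (of_nat i * 0 ^ (i - 1))) = (\<Sum>i\<in>{1}. c i * (of_nat i * 0 ^ (i - 1)))"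
      by (rule sum.mono_neutral_right) (auto simp: Suc power_0_left)
    then show ?thesis by (simp add: c_def mult_ac)
  qed simp
  ultimately show ?thesis by simp
qed

text \<open>The moment of order n + 1 of \<open>Y \<bullet> (z + t a)\<close> is known in terms of
  its variance, a quadratic polynomial in t. Comparing derivatives at t = 0 gives the mixed moment;
  for even n the moment of odd order n + 1 vanishes identically in t.\<close>

lemma stein_power:
  "expectation (\<lambda>s. (Y s \<bullet> a) * (Y s \<bullet> z) ^ n) =
   of_nat n * cov a z * expectation (\<lambda>s. (Y s \<bullet> z) ^ (n - 1))"
proof -
  have sq: "expectation (\<lambda>s. (Y s \<bullet> x)\<^sup>2) = cov x x" for x
    by (simp add: cov_def power2_eq_square)
  have mom: "expectation (\<lambda>s. (Y s \<bullet> x) ^ m) =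
      (if even m then fact m / (2 ^ (m div 2) * fact (m div 2)) * cov x x ^ (m div 2) else 0)" for x m
    using moment_gaussian_rv(2)[OF prob_space_axioms Y_gaussian Y_centered, of x m] unfolding sq .
  have L: "((\<lambda>t. expectation (\<lambda>s. (Y s \<bullet> (z + t *\<^sub>R a)) ^ Suc n)) has_real_derivative
      of_nat (Suc n) * expectation (\<lambda>s. (Y s \<bullet> z) ^ n * (Y s \<bullet> a))) (at 0)"
    using deriv_shifted_power[OF polf_const[of 1], of z a "Suc n"] by simp
  show ?thesis
  proof (cases "even n")
    case True
    then have "((\<lambda>t::real. 0::real) has_real_derivative
      of_nat (Suc n) * expectation (\<lambda>s. (Y s \<bullet> z) ^ n * (Y s \<bullet> a))) (at 0)"
      using L by (simp only: mom) simp
    then have "of_nat (Suc n) * expectation (\<lambda>s. (Y s \<bullet> z) ^ n * (Y s \<bullet> a)) = 0"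
      using DERIV_unique[OF DERIV_const] by metis
    moreover have "of_nat n * expectation (\<lambda>s. (Y s \<bullet> z) ^ (n - 1)) = 0"
      using True by (cases "n = 0") (simp_all only: mom, simp_all)
    ultimately show ?thesis by (auto simp: mult.commute)
  next
    case False
    then obtain k where k: "n = 2 * k + 1" using oddE by blast
    define C where "C j = (fact (2 * j) / (2 ^ j * fact j) :: real)" for j
    \<comment> \<open>The recursion (2k + 1)!! = (2k + 1) (2k - 1)!!, which produces the factor
      n.\<close>
    have C: "C (Suc k) = of_nat n * C k"
      unfolding C_def k by (simp add: divide_simps)
    have lc: "cov x (y + t *\<^sub>R w) = cov x y + t * cov x w" for x y w t
      using linear_cov[of x] by (simp add: linear_add linear_scale)
    have sy: "cov x y = cov y x" for x y by (simp add: cov_def mult.commute)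
    have e: "expectation (\<lambda>s. (Y s \<bullet> (z + t *\<^sub>R a)) ^ Suc n) =
       C (Suc k) * (cov z z + 2 * t * cov a z + t\<^sup>2 * cov a a) ^ Suc k" for t
      using False
      by (simp only: mom lc sy[of "z + t *\<^sub>R a" a] sy[of "z + t *\<^sub>R a" z]) (simp add: k C_def sy[of z a] algebra_simps power2_eq_square)
    have "((\<lambda>t. C (Suc k) * (cov z z + 2 * t * cov a z + t\<^sup>2 * cov a a) ^ Suc k) has_real_derivative
        C (Suc k) * (of_nat (Suc k) * cov z z ^ k * (2 * cov a z))) (at 0)"
      by (auto intro!: derivative_eq_intros simp del: power_Suc)
    then have "of_nat (Suc n) * expectation (\<lambda>s. (Y s \<bullet> z) ^ n * (Y s \<bullet> a)) =
       C (Suc k) * (of_nat (Suc k) * cov z z ^ k * (2 * cov a z))"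
      using L unfolding e by (rule DERIV_unique[rotated])
    also have "\<dots> = of_nat (Suc n) * (of_nat n * cov a z * (C k * cov z z ^ k))"
      unfolding C by (simp add: k algebra_simps)
    also have "C k * cov z z ^ k = expectation (\<lambda>s. (Y s \<bullet> z) ^ (n - 1))"
      by (simp only: mom) (simp add: k C_def)
    finally show ?thesis
      by (subst (asm) mult_cancel_left) (simp add: mult.commute del: of_nat_Suc)
  qed
qed

text \<open>
  The factor \<open>(Y \<bullet> z) ^ n\<close> makes the induction work: replacing \<open>z\<close> by \<open>z + t l\<close> and comparing the
  coefficients of \<open>t\<close> yields the formula for \<open>(Y \<bullet> l) * P\<close>.
\<close>

lemma stein_polf_power:
  assumes "polf P"
  shows "expectation (\<lambda>s. (Y s \<bullet> z) ^ n * ((Y s \<bullet> a) * P (Y s))) =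
    of_nat n * cov a z * expectation (\<lambda>s. (Y s \<bullet> z) ^ (n - 1) * P (Y s)) +
    expectation (\<lambda>s. (Y s \<bullet> z) ^ n * ddir (cvec a) P (Y s))"
  using assms
proof (induction arbitrary: z n rule: polf.induct)
  case (polf_const c)
  have *: "(\<lambda>s. (Y s \<bullet> z) ^ n * ((Y s \<bullet> a) * c)) = (\<lambda>s. ((Y s \<bullet> a) * (Y s \<bullet> z) ^ n) * c)"
    by (auto simp: mult_ac)
  show ?case by (simp add: * stein_power)
next
  case (polf_add P Q)
  have i: "integrable M (\<lambda>s. (Y s \<bullet> w) ^ m * R (Y s))" if "polf R" for w m R
    by (rule polf_integrable[OF polf_linpow[OF that]])
  have i': "integrable M (\<lambda>s. (Y s \<bullet> w) ^ m * ((Y s \<bullet> u) * R (Y s)))" if "polf R" for w m u R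
    by (rule i[OF polf_lmul[OF that]])
  show ?case
    using polf_add
    by (simp add: ddir_add polf_differentiable distrib_left i i' polf_ddir)
next
  case (polf_lmul P l)
  have i: "integrable M (\<lambda>s. (Y s \<bullet> w) ^ m * R (Y s))" if "polf R" for w m R
    by (rule polf_integrable[OF polf_linpow[OF that]])
  let ?E = expectation
  \<comment> \<open>The induction hypothesis enters at exponent n + 1, since differentiation lowers
    the exponent by one; the common factor n + 1 is cancelled at the end.\<close>
  have 1: "((\<lambda>t. ?E (\<lambda>s. (Y s \<bullet> (z + t *\<^sub>R l)) ^ Suc n * ((Y s \<bullet> a) * P (Y s)))) has_real_derivative
     of_nat (Suc n) * ?E (\<lambda>s. (Y s \<bullet> z) ^ n * ((Y s \<bullet> l) * ((Y s \<bullet> a) * P (Y s))))) (at 0)"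
    using deriv_shifted_power[OF polf.polf_lmul[OF polf_lmul.hyps], of z l "Suc n" a] by simp
  have 2: "((\<lambda>t. ?E (\<lambda>s. (Y s \<bullet> (z + t *\<^sub>R l)) ^ n * P (Y s))) has_real_derivative
     of_nat n * ?E (\<lambda>s. (Y s \<bullet> z) ^ (n - 1) * ((Y s \<bullet> l) * P (Y s)))) (at 0)"
    using deriv_shifted_power[OF polf_lmul.hyps, of z l n] by simp
  have 3: "((\<lambda>t. ?E (\<lambda>s. (Y s \<bullet> (z + t *\<^sub>R l)) ^ Suc n * ddir (cvec a) P (Y s))) has_real_derivative
     of_nat (Suc n) * ?E (\<lambda>s. (Y s \<bullet> z) ^ n * ((Y s \<bullet> l) * ddir (cvec a) P (Y s)))) (at 0)"
    using deriv_shifted_power[OF polf_ddir[OF polf_lmul.hyps], of z l "Suc n"] by simp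
  have lc: "cov a (z + t *\<^sub>R l) = cov a z + t * cov a l" for t
    using linear_cov[of a] by (simp add: linear_add linear_scale)
  have "((\<lambda>t. of_nat (Suc n) * (cov a z + t * cov a l) * ?E (\<lambda>s. (Y s \<bullet> (z + t *\<^sub>R l)) ^ n * P (Y s)) +
      ?E (\<lambda>s. (Y s \<bullet> (z + t *\<^sub>R l)) ^ Suc n * ddir (cvec a) P (Y s))) has_real_derivative
      of_nat (Suc n) * (cov a l * ?E (\<lambda>s. (Y s \<bullet> z) ^ n * P (Y s)) +
        cov a z * (of_nat n * ?E (\<lambda>s. (Y s \<bullet> z) ^ (n - 1) * ((Y s \<bullet> l) * P (Y s)))) +
        ?E (\<lambda>s. (Y s \<bullet> z) ^ n * ((Y s \<bullet> l) * ddir (cvec a) P (Y s))))) (at 0)"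
    by (rule derivative_eq_intros 2 3 refl)+ (simp add: algebra_simps)
  then have "of_nat (Suc n) * ?E (\<lambda>s. (Y s \<bullet> z) ^ n * ((Y s \<bullet> l) * ((Y s \<bullet> a) * P (Y s)))) =
     of_nat (Suc n) * (cov a l * ?E (\<lambda>s. (Y s \<bullet> z) ^ n * P (Y s)) +
        cov a z * (of_nat n * ?E (\<lambda>s. (Y s \<bullet> z) ^ (n - 1) * ((Y s \<bullet> l) * P (Y s)))) +
        ?E (\<lambda>s. (Y s \<bullet> z) ^ n * ((Y s \<bullet> l) * ddir (cvec a) P (Y s))))"
    using 1 unfolding polf_lmul.IH lc by (intro DERIV_unique[rotated]) simp_all
  then have "?E (\<lambda>s. (Y s \<bullet> z) ^ n * ((Y s \<bullet> l) * ((Y s \<bullet> a) * P (Y s)))) =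
     cov a l * ?E (\<lambda>s. (Y s \<bullet> z) ^ n * P (Y s)) +
        cov a z * (of_nat n * ?E (\<lambda>s. (Y s \<bullet> z) ^ (n - 1) * ((Y s \<bullet> l) * P (Y s)))) +
        ?E (\<lambda>s. (Y s \<bullet> z) ^ n * ((Y s \<bullet> l) * ddir (cvec a) P (Y s)))"
    by (subst (asm) mult_cancel_left) (simp del: of_nat_Suc)
  moreover have "?E (\<lambda>s. (Y s \<bullet> z) ^ n * ddir (cvec a) (\<lambda>x. (x \<bullet> l) * P x) (Y s)) =
     cov a l * ?E (\<lambda>s. (Y s \<bullet> z) ^ n * P (Y s)) +
     ?E (\<lambda>s. (Y s \<bullet> z) ^ n * ((Y s \<bullet> l) * ddir (cvec a) P (Y s)))"
    using polf_lmul.hyps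
    by (simp add: ddir_lmul polf_differentiable distrib_left cvec_inner mult.left_commute[of _ "cov a l"]
        i[OF polf.polf_lmul[OF polf_ddir]] i)
  ultimately show ?case by (simp add: mult_ac)
qed

lemma stein:
  assumes "polf P"
  shows "expectation (\<lambda>s. (Y s \<bullet> a) * P (Y s)) = expectation (\<lambda>s. ddir (cvec a) P (Y s))"
  using stein_polf_power[OF assms, of 0 0 a] by simp

end

section \<open>Wick products and Hermite forms\<close>

text \<open>The creation operator of the Gaussian vector with covariance matrix \<open>T\<close>.\<close>

definition creation :: "('e::euclidean_space \<Rightarrow> 'e) \<Rightarrow> 'e \<Rightarrow> ('e \<Rightarrow> real) \<Rightarrow> 'e \<Rightarrow> real" where
  "creation T a F x = (x \<bullet> a) * F x - ddir (T a) F x"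

text \<open>Wick product of the linear forms \<open>x \<bullet> a k\<close>, a multivariate Hermite
  polynomial. In one dimension with \<open>T\<close> the identity and all \<open>a k = 1\<close> it
  is the recursion H' = x H - dH/dx from degree q to q + 1.\<close>

primrec wick :: "('e::euclidean_space \<Rightarrow> 'e) \<Rightarrow> nat \<Rightarrow> (nat \<Rightarrow> 'e) \<Rightarrow> 'e \<Rightarrow> real" where
  "wick T 0 a = (\<lambda>_. 1)"
| "wick T (Suc q) a = creation T (a q) (wick T q a)"

lemma creation_eq: "creation T a F = (\<lambda>x. (x \<bullet> a) * F x - ddir (T a) F x)"
  by (auto simp: creation_def)

lemma polf_creation: "polf F \<Longrightarrow> polf (creation T a F)"
  unfolding creation_eq by (intro polf_diff polf_lmul polf_ddir)

lemma polf_wick: "polf (wick T q a)"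
  by (induction q) (auto intro: polf_creation polf_const)

lemma ddir_diff:
  assumes "polf P" "polf Q" shows "ddir a (\<lambda>x. P x - Q x) x = ddir a P x - ddir a Q x"
  using ddir_add[of P x "\<lambda>x. (-1) * Q x" a] ddir_cmul[of Q x a "-1"]
    polf_differentiable[OF assms(1)] polf_differentiable[OF polf_cmul[OF assms(2), of "-1"]]
    polf_differentiable[OF assms(2)] by simp

lemma ddir_sum:
  "(\<And>i. i \<in> I \<Longrightarrow> polf (P i)) \<Longrightarrow> ddir a (\<lambda>x. \<Sum>i\<in>I. c i * P i x) x = (\<Sum>i\<in>I. c i * ddir a (P i) x)"
  by (induction I rule: infinite_finite_induct)
     (simp_all add: ddir_add ddir_cmul polf_differentiable polf_sum polf_cmul)

text \<open>The canonical commutation relation: derivative and creation operator commute up to the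
  scalar \<open>c \<bullet> a\<close>.\<close>

lemma ddir_creation:
  assumes "polf F" shows "ddir c (creation T a F) x = (c \<bullet> a) * F x + creation T a (ddir c F) x"
  using assms unfolding creation_eq
  by (simp add: ddir_diff polf_lmul polf_ddir ddir_lmul polf_differentiable ddir_commute[of F c])

text \<open>Applying the commutation relation on both sides leaves the scalar terms
  \<open>T a \<bullet> b\<close> and \<open>T b \<bullet> a\<close>, which agree when T is
  symmetric.\<close>

lemma creation_commute:
  assumes "polf F" "T a \<bullet> b = T b \<bullet> a"
  shows "creation T a (creation T b F) = creation T b (creation T a F)"
proof
  fix x
  have "creation T a (creation T b F) x = (x \<bullet> a) * creation T b F x - ((T a \<bullet> b) * F x + creation T b (ddir (T a) F) x)"
    by (subst creation_def) (simp add: ddir_creation assms)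
  moreover have "creation T b (creation T a F) x = (x \<bullet> b) * creation T a F x - ((T b \<bullet> a) * F x + creation T a (ddir (T b) F) x)"
    by (subst creation_def) (simp add: ddir_creation assms)
  ultimately show "creation T a (creation T b F) x = creation T b (creation T a F) x"
    by (simp add: assms(2) creation_def algebra_simps ddir_commute[OF assms(1), of "T a"])
qed

lemma creation_sum:
  assumes "\<And>i. i \<in> I \<Longrightarrow> polf (P i)"
  shows "creation T a (\<lambda>x. \<Sum>i\<in>I. c i * P i x) x = (\<Sum>i\<in>I. c i * creation T a (P i) x)"
  by (simp add: creation_def ddir_sum[OF assms] sum_distrib_left sum_subtractf algebra_simps)

lemma creation_sum_left:
  assumes "linear T" "polf F"
  shows "creation T (\<Sum>i\<in>I. c i *\<^sub>R a i) F x = (\<Sum>i\<in>I. c i * creation T (a i) F x)"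
  using linear_sum[OF ddir_linear[OF polf_differentiable[OF assms(2)]], where g="\<lambda>i. c i *\<^sub>R T (a i)" and S=I and x1=x]
    linear_scale[OF ddir_linear[OF polf_differentiable[OF assms(2)]], where x1=x]
  by (simp add: creation_def linear_sum[OF assms(1)] linear_scale[OF assms(1)] inner_sum_right
      sum_subtractf sum_distrib_right right_diff_distrib mult.assoc)

lemma wick_cong: "(\<And>k. k < q \<Longrightarrow> a k = b k) \<Longrightarrow> wick T q a = wick T q b"
  by (induction q) auto

section \<open>Symmetric tensors and their contraction with Wick products\<close>

definition swap_adj :: "nat \<Rightarrow> (nat \<Rightarrow> 'e) \<Rightarrow> nat \<Rightarrow> 'e" where
  "swap_adj k i = i(k := i (Suc k), Suc k := i k)"

text \<open>Adjacent transpositions generate all permutations, and each of them touches only two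
  consecutive levels of the recursion for \<open>wick\<close>.\<close>

definition symmetric_tensor :: "nat \<Rightarrow> ((nat \<Rightarrow> 'e) \<Rightarrow> real) \<Rightarrow> bool" where
  "symmetric_tensor q g \<longleftrightarrow> (\<forall>k i. Suc k < q \<longrightarrow> g (swap_adj k i) = g i)"

text \<open>Either the swap lies below the last slot and the induction hypothesis applies, or it
  exchanges the two outermost creation operators, which commute.\<close>

lemma wick_swap:
  assumes "\<And>a b. T a \<bullet> b = T b \<bullet> a" "Suc k < q"
  shows "wick T q (swap_adj k i) = wick T q i"
  using assms(2)
proof (induction q)
  case (Suc q)
  show ?case
  proof (cases "Suc k < q")
    case True
    then show ?thesis using Suc.IH by (simp add: swap_adj_def)
  next
    case False
    then have q: "q = Suc k" using Suc.prems by simp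
    have "wick T k (swap_adj k i) = wick T k i" by (rule wick_cong) (simp add: swap_adj_def)
    then show ?thesis
      using creation_commute[where F="wick T k i" and T=T and a="i k" and b="i (Suc k)", OF polf_wick assms(1)]
      by (simp add: q) (simp add: swap_adj_def)
  qed
qed simp

lemma symmetric_tensor_last: "symmetric_tensor (Suc q) g \<Longrightarrow> symmetric_tensor q (\<lambda>i. g (i(q := b)))"
  unfolding symmetric_tensor_def
proof (intro allI impI)
  fix k i assume *: "\<forall>k i. Suc k < Suc q \<longrightarrow> g (swap_adj k i) = g i" "Suc k < q"
  have "(swap_adj k i)(q := b) = swap_adj k (i(q := b))" using *(2) by (auto simp: swap_adj_def)
  then show "g ((swap_adj k i)(q := b)) = g (i(q := b))" using * by simp
qed

lemma finite_multi_indices [simp]: "finite (multi_indices q)"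
  by (simp add: multi_indices_def finite_PiE)

lemma sum_multi_Suc:
  fixes F :: "(nat \<Rightarrow> 'w::euclidean_space) \<Rightarrow> 'b::comm_monoid_add"
  shows "(\<Sum>I\<in>multi_indices (Suc q). F I) = (\<Sum>I\<in>multi_indices q. \<Sum>b\<in>Basis. F (I(q := b)))"
proof -
  have inj: "inj_on (\<lambda>(b, I). I(q := b)) (Basis \<times> (multi_indices q :: (nat \<Rightarrow> 'w) set))"
    unfolding multi_indices_def by (rule inj_combinator) simp
  have "(multi_indices (Suc q) :: (nat \<Rightarrow> 'w) set) = (\<lambda>(b, I). I(q := b)) ` (Basis \<times> multi_indices q)"
    by (simp add: multi_indices_def lessThan_Suc PiE_insert_eq)
  then have "(\<Sum>I\<in>multi_indices (Suc q). F I) = (\<Sum>(b, I)\<in>Basis \<times> multi_indices q. F (I(q := b)))"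
    using sum.reindex[OF inj, of F] by (simp add: case_prod_unfold comp_def)
  also have "\<dots> = (\<Sum>b\<in>Basis. \<Sum>I\<in>multi_indices q. F (I(q := b)))"
    by (simp add: sum.cartesian_product)
  finally show ?thesis by (simp add: sum.swap[of _ _ Basis])
qed

lemma sum_swap4:
  "(\<Sum>b\<in>A. \<Sum>c\<in>B. \<Sum>i\<in>C. \<Sum>j\<in>D. f b c i j) = (\<Sum>i\<in>C. \<Sum>b\<in>A. \<Sum>j\<in>D. \<Sum>c\<in>B. f b c i j)"
proof -
  have "(\<Sum>c\<in>B. \<Sum>i\<in>C. \<Sum>j\<in>D. f b c i j) = (\<Sum>i\<in>C. \<Sum>j\<in>D. \<Sum>c\<in>B. f b c i j)" for b
    by (subst sum.swap) (intro sum.cong refl sum.swap)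
  then have "(\<Sum>b\<in>A. \<Sum>c\<in>B. \<Sum>i\<in>C. \<Sum>j\<in>D. f b c i j) = (\<Sum>b\<in>A. \<Sum>i\<in>C. \<Sum>j\<in>D. \<Sum>c\<in>B. f b c i j)"
    by simp
  then show ?thesis by (subst (asm) sum.swap)
qed

lemma multi_indices_0: "multi_indices 0 = {\<lambda>_. undefined}"
  by (simp add: multi_indices_def)

text \<open>The contraction of g with all Wick products, in recursive form so that the outermost
  creation operator can be moved across an expectation. In degree 0 the argument
  \<open>\<lambda>_. undefined\<close> is the only element of
  \<open>multi_indices 0\<close>.\<close>

primrec wick_sum :: "('e::euclidean_space \<Rightarrow> 'e) \<Rightarrow> nat \<Rightarrow> ((nat \<Rightarrow> 'e) \<Rightarrow> real) \<Rightarrow> 'e \<Rightarrow> real" where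
  "wick_sum T 0 g = (\<lambda>_. g (\<lambda>_. undefined))"
| "wick_sum T (Suc q) g = (\<lambda>x. \<Sum>b\<in>Basis. creation T b (wick_sum T q (\<lambda>i. g (i(q := b)))) x)"

lemma polf_wick_sum: "polf (wick_sum T q g)"
  by (induction q arbitrary: g) (auto intro!: polf_sum polf_creation polf_const)

lemma wick_sum_eq: "wick_sum T q g x = (\<Sum>I\<in>multi_indices q. g I * wick T q I x)"
proof (induction q arbitrary: g x)
  case 0
  then show ?case by (simp add: multi_indices_0)
next
  case (Suc q)
  have c: "wick T q (I(q := b)) = wick T q I" for I b by (rule wick_cong) simp
  have IH: "wick_sum T q h = (\<lambda>x. \<Sum>I\<in>multi_indices q. h I * wick T q I x)" for h
    using Suc by auto
  have "wick_sum T (Suc q) g x = (\<Sum>b\<in>Basis. \<Sum>I\<in>multi_indices q. g (I(q := b)) * creation T b (wick T q I) x)"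
    by (simp add: IH creation_sum polf_wick)
  then show ?case by (simp add: sum_multi_Suc c sum.swap[of _ Basis])
qed

text \<open>The analogue of (x^n)' = n x^(n-1): a derivative contracts one slot of g. The
  commutation relation contracts the last slot directly, the induction hypothesis contracts the one
  before it, and symmetry of g identifies the two.\<close>

lemma ddir_wick_sum:
  assumes "symmetric_tensor (Suc q) g"
  shows "ddir c (wick_sum T (Suc q) g) x =
    real (Suc q) * (\<Sum>b\<in>Basis. (c \<bullet> b) * wick_sum T q (\<lambda>i. g (i(q := b))) x)"
  using assms
proof (induction q arbitrary: g x)
  case (0 g x)
  have d0: "ddir c (\<lambda>x. r) = (\<lambda>_. 0)" for r by auto
  have "ddir c (wick_sum T (Suc 0) g) x = (\<Sum>b\<in>Basis. 1 * ddir c (creation T b (wick_sum T 0 (\<lambda>i. g (i(0 := b))))) x)"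
    using ddir_sum[where c="\<lambda>_. 1" and I=Basis and x=x and a=c and P="\<lambda>b. creation T b (wick_sum T 0 (\<lambda>i. g (i(0 := b))))"]
    by (simp add: polf_creation polf_const)
  then show ?case
    by (simp add: ddir_creation polf_const d0 del: fun_upd_apply) (simp add: creation_def)
next
  case (Suc q g x)
  let ?g = "\<lambda>b i. g (i(Suc q := b))"
  have IH: "ddir c (wick_sum T (Suc q) (?g b)) =
      (\<lambda>x. \<Sum>b'\<in>Basis. real (Suc q) * (c \<bullet> b') * wick_sum T q (\<lambda>i. ?g b (i(q := b'))) x)" for b
    by (rule ext) (simp add: Suc.IH[OF symmetric_tensor_last[OF Suc.prems]] sum_distrib_left mult.assoc del: wick_sum.simps fun_upd_apply)
  have sym: "?g b (i(q := b')) = ?g b' (i(q := b))" for b b' i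
  proof -
    have "(i(q := b, Suc q := b')) = swap_adj q (i(q := b', Suc q := b))" by (auto simp: swap_adj_def)
    then show ?thesis using Suc.prems by (simp add: symmetric_tensor_def)
  qed
  have "ddir c (wick_sum T (Suc (Suc q)) g) x = (\<Sum>b\<in>Basis. 1 * ddir c (creation T b (wick_sum T (Suc q) (?g b))) x)"
    by (subst ddir_sum[symmetric]) (simp_all add: polf_creation polf_wick_sum del: wick_sum.simps(2), simp)
  also have "\<dots> = (\<Sum>b\<in>Basis. (c \<bullet> b) * wick_sum T (Suc q) (?g b) x) +
     (\<Sum>b\<in>Basis. \<Sum>b'\<in>Basis. real (Suc q) * (c \<bullet> b') * creation T b (wick_sum T q (\<lambda>i. ?g b (i(q := b')))) x)"
    by (simp add: ddir_creation polf_wick_sum IH creation_sum sum.distrib del: wick_sum.simps(2) of_nat_Suc)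
  \<comment> \<open>After exchanging the last two slots this part is q + 1 copies of the first sum,
    so q + 2 copies arise in total.\<close>
  also have "(\<Sum>b\<in>Basis. \<Sum>b'\<in>Basis. real (Suc q) * (c \<bullet> b') * creation T b (wick_sum T q (\<lambda>i. ?g b (i(q := b')))) x) =
     (\<Sum>b'\<in>Basis. \<Sum>b\<in>Basis. real (Suc q) * (c \<bullet> b') * creation T b (wick_sum T q (\<lambda>i. ?g b' (i(q := b)))) x)"
    by (subst sum.swap, intro sum.cong refl, subst sym) simp
  also have "\<dots> = real (Suc q) * (\<Sum>b\<in>Basis. (c \<bullet> b) * wick_sum T (Suc q) (?g b) x)"
    by (simp add: sum_distrib_left mult.assoc del: of_nat_Suc)
  finally show ?case by (simp add: algebra_simps del: wick_sum.simps fun_upd_apply)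
qed

section \<open>Adjointness and covariances for a pair of Gaussian vectors\<close>

locale gauss_pair = gauss_vec M Y for M :: "'a measure" and Y :: "'a \<Rightarrow> 'w::euclidean_space \<times> 'w" +
  fixes T :: "'w \<Rightarrow> 'w"
  assumes cov_fst: "cov (a, 0) (b, 0) = T a \<bullet> b"
begin

lemma polf_fst: "polf F \<Longrightarrow> polf (\<lambda>z. F (fst z))" for F :: "'w \<Rightarrow> real"
  by (rule polf_compose[where L'="\<lambda>y. (y, 0)"]) (auto simp: inner_prod_def)

lemma polf_snd: "polf F \<Longrightarrow> polf (\<lambda>z. F (snd z))" for F :: "'w \<Rightarrow> real"
  by (rule polf_compose[where L'="\<lambda>y. (0, y)"]) (auto simp: inner_prod_def)

lemma integrable_pair: "polf F \<Longrightarrow> polf P \<Longrightarrow> integrable M (\<lambda>s. F (fst (Y s)) * P (snd (Y s)))"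
  using polf_integrable[OF polf_mult[OF polf_fst polf_snd]] .

text \<open>Stein's identity in the direction \<open>(a, 0)\<close> differentiates in both
  variables. The derivative of F in the first variable is along \<open>T a\<close>, because T is the
  covariance of the first component, and is exactly the term that \<open>creation\<close> subtracts.
  What remains is the derivative of P along the cross-covariance.\<close>

lemma creation_adjoint:
  assumes F: "polf F" and P: "polf P"
  shows "expectation (\<lambda>s. creation T a F (fst (Y s)) * P (snd (Y s))) =
         expectation (\<lambda>s. F (fst (Y s)) * ddir (snd (cvec (a, 0))) P (snd (Y s)))"
proof -
  have c1: "fst (cvec (a, 0)) = T a"
  proof (rule euclidean_eqI)
    fix b :: 'w
    show "fst (cvec (a, 0)) \<bullet> b = T a \<bullet> b"
      using cvec_inner[of "(a, 0)" "(b, 0)"] by (simp add: cov_fst inner_prod_def)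
  qed
  have d: "ddir e (\<lambda>z. F (fst z) * P (snd z)) z =
     F (fst z) * ddir (snd e) P (snd z) + ddir (fst e) F (fst z) * P (snd z)" for e z
    using F P by (simp add: ddir_mult polf_differentiable polf_fst polf_snd ddir_compose bounded_linear_fst bounded_linear_snd)
  have i1: "integrable M (\<lambda>s. (Y s \<bullet> (a, 0)) * (F (fst (Y s)) * P (snd (Y s))))"
    by (rule polf_integrable[OF polf_lmul[OF polf_mult[OF polf_fst polf_snd]]]) fact+
  have "expectation (\<lambda>s. creation T a F (fst (Y s)) * P (snd (Y s))) =
    expectation (\<lambda>s. (Y s \<bullet> (a, 0)) * (F (fst (Y s)) * P (snd (Y s)))) -
    expectation (\<lambda>s. ddir (T a) F (fst (Y s)) * P (snd (Y s)))"
    by (subst Bochner_Integration.integral_diff[symmetric])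
       (use i1 integrable_pair[OF polf_ddir[OF F] P] in \<open>auto simp: creation_def inner_prod_def algebra_simps\<close>)
  also have "expectation (\<lambda>s. (Y s \<bullet> (a, 0)) * (F (fst (Y s)) * P (snd (Y s)))) =
    expectation (\<lambda>s. F (fst (Y s)) * ddir (snd (cvec (a, 0))) P (snd (Y s)) + ddir (T a) F (fst (Y s)) * P (snd (Y s)))"
    by (subst stein) (auto intro!: polf_mult polf_fst polf_snd F P simp: d c1)
  finally show ?thesis
    by (simp add: integrable_pair polf_ddir F P)
qed

text \<open>Each step moves one creation operator off the first factor and onto the second, where it
  becomes a derivative and contracts a slot of g'. The factors from \<open>ddir_wick_sum\<close>
  accumulate to q!. Symmetry concerns g' because only the second factor is differentiated.\<close>

lemma wick_sum_covariance:
  assumes "symmetric_tensor q g'"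
  shows "expectation (\<lambda>s. wick_sum T q g (fst (Y s)) * wick_sum T q g' (snd (Y s))) =
    fact q * (\<Sum>I\<in>multi_indices q. \<Sum>J\<in>multi_indices q. g I * g' J * (\<Prod>k<q. cov (I k, 0) (0, J k)))"
  using assms
proof (induction q arbitrary: g g')
  case 0
  then show ?case by (simp add: multi_indices_0 prob_space)
next
  case (Suc q)
  note [simp del] = wick_sum.simps of_nat_Suc fact_Suc
  let ?g = "\<lambda>b i. g (i(q := b))" and ?g' = "\<lambda>b i. g' (i(q := b))"
  have c: "snd (cvec (b, 0)) \<bullet> b' = cov (b, 0) (0, b')" for b b'
    using cvec_inner[of "(b, 0)" "(0, b')"] by (simp add: inner_prod_def)
  have dd: "ddir (snd (cvec (b, 0))) (wick_sum T (Suc q) g') =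
     (\<lambda>x. real (Suc q) * (\<Sum>b'\<in>Basis. cov (b, 0) (0, b') * wick_sum T q (?g' b') x))" for b
    by (rule ext) (simp add: ddir_wick_sum[OF Suc.prems] c del: fun_upd_apply)
  have "expectation (\<lambda>s. wick_sum T (Suc q) g (fst (Y s)) * wick_sum T (Suc q) g' (snd (Y s))) =
     (\<Sum>b\<in>Basis. expectation (\<lambda>s. creation T b (wick_sum T q (?g b)) (fst (Y s)) * wick_sum T (Suc q) g' (snd (Y s))))"
    by (subst wick_sum.simps(2))
       (simp add: sum_distrib_right Bochner_Integration.integral_sum integrable_pair polf_creation polf_wick_sum)
  also have "\<dots> = (\<Sum>b\<in>Basis. expectation (\<lambda>s. real (Suc q) * (\<Sum>b'\<in>Basis. cov (b, 0) (0, b') *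
      (wick_sum T q (?g b) (fst (Y s)) * wick_sum T q (?g' b') (snd (Y s))))))"
    by (intro sum.cong refl, subst creation_adjoint)
       (auto intro!: polf_wick_sum simp: dd sum_distrib_left mult_ac)
  also have "\<dots> = (\<Sum>b\<in>Basis. real (Suc q) * (\<Sum>b'\<in>Basis. cov (b, 0) (0, b') *
      expectation (\<lambda>s. wick_sum T q (?g b) (fst (Y s)) * wick_sum T q (?g' b') (snd (Y s)))))"
    by (simp add: Bochner_Integration.integral_sum integrable_pair polf_wick_sum)
  also have "\<dots> = fact (Suc q) * (\<Sum>b\<in>Basis. \<Sum>b'\<in>Basis. \<Sum>I\<in>multi_indices q. \<Sum>J\<in>multi_indices q.
      ?g b I * ?g' b' J * ((\<Prod>k<q. cov (I k, 0) (0, J k)) * cov (b, 0) (0, b')))"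
    by (simp add: Suc.IH[OF symmetric_tensor_last[OF Suc.prems]] del: fun_upd_apply)
       (simp add: sum_distrib_left fact_Suc mult_ac del: fun_upd_apply)
  also have "(\<Sum>b\<in>Basis. \<Sum>b'\<in>Basis. \<Sum>I\<in>multi_indices q. \<Sum>J\<in>multi_indices q.
      ?g b I * ?g' b' J * ((\<Prod>k<q. cov (I k, 0) (0, J k)) * cov (b, 0) (0, b'))) =
      (\<Sum>I\<in>multi_indices (Suc q). \<Sum>J\<in>multi_indices (Suc q). g I * g' J * (\<Prod>k<Suc q. cov (I k, 0) (0, J k)))"
    unfolding sum_multi_Suc by (subst sum_swap4) (simp add: mult.assoc)
  finally show ?case .
qed

lemma wick_sum_expectation:
  assumes "q > 0" shows "expectation (\<lambda>s. wick_sum T q g (fst (Y s))) = 0"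
proof -
  obtain r where q: "q = Suc r" using assms by (cases q) auto
  have "expectation (\<lambda>s. creation T b F (fst (Y s))) = 0" if "polf F" for b F
    using creation_adjoint[OF that polf_const[of 1]] by simp
  moreover have "integrable M (\<lambda>s. creation T b F (fst (Y s)))" if "polf F" for b F
    using polf_integrable[OF polf_fst[OF polf_creation[OF that]]] .
  ultimately show ?thesis by (simp add: q polf_wick_sum)
qed

end

section \<open>Hermite forms as Wick products\<close>

lemma inner_form_ex:
  fixes l :: "'e::euclidean_space \<Rightarrow> real"
  assumes "linear l" obtains a where "l = (\<lambda>x. x \<bullet> a)"
  using linear_eq_inner[OF assms] that by blast

lemma linear_inner_form: "linear (\<lambda>x. x \<bullet> a)"
  by (rule linearI) (auto simp: inner_add_left)

text \<open>Coordinates for the two dual scalar products: T is the matrix of B on linear forms, and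
  its inverse S is the matrix of the transported scalar product on \<open>'w\<close>.\<close>

locale dual_form =
  fixes B :: "('w::euclidean_space \<Rightarrow> real) \<Rightarrow> ('w \<Rightarrow> real) \<Rightarrow> real" and T S :: "'w \<Rightarrow> 'w"
  assumes linT: "linear T" and linS: "linear S"
    and TS: "T (S x) = x" and ST: "S (T x) = x"
    and T_inner: "T a \<bullet> b = B (\<lambda>x. x \<bullet> a) (\<lambda>x. x \<bullet> b)"
    and T_sym: "T a \<bullet> b = T b \<bullet> a"
begin

lemma riesz_form_eq: "riesz_form B x = (\<lambda>y. y \<bullet> S x)"
  unfolding riesz_form_def
proof (rule the_equality)
  have "B (\<lambda>y. y \<bullet> S x) m = m x" if m: "linear m" for m
  proof -
    from inner_form_ex[OF m] obtain a where "m = (\<lambda>x. x \<bullet> a)" .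
    then show ?thesis using T_inner[of "S x" a] by (simp add: TS)
  qed
  then show "linear (\<lambda>y. y \<bullet> S x) \<and> (\<forall>m. linear m \<longrightarrow> B (\<lambda>y. y \<bullet> S x) m = m x)"
    by (auto simp: linear_inner_form)
next
  fix l assume l: "linear l \<and> (\<forall>m. linear m \<longrightarrow> B l m = m x)"
  then obtain a where a: "l = (\<lambda>x. x \<bullet> a)" using inner_form_ex by blast
  have "T a = x"
  proof (rule euclidean_eqI)
    fix b show "T a \<bullet> b = x \<bullet> b"
      using l T_inner[of a b] linear_inner_form[of b] by (simp add: a)
  qed
  then show "l = (\<lambda>y. y \<bullet> S x)" using ST[of a] by (auto simp: a)
qed

lemma norm_sq_eq: "norm_sq B x = x \<bullet> S x"
  using T_inner[of "S x" "S x"] by (simp add: norm_sq_def riesz_form_eq TS)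

lemma S_sym: "S x \<bullet> y = S y \<bullet> x"
  using T_sym[of "S x" "S y"] by (simp add: TS inner_commute)

text \<open>Differentiating exp(- x \<bullet> S x / 2) h along w gives minus the exponential times
  \<open>(x \<bullet> S w) h - ddir w h\<close>. Since \<open>T (S w) = w\<close>, the bracket is
  the creation operator at \<open>S w\<close>.\<close>

lemma iterated_deriv_gauss:
  "iterated_deriv q (\<lambda>y. exp (- norm_sq B y / 2)) x w =
    (-1) ^ q * (exp (- (x \<bullet> S x) / 2) * wick T q (\<lambda>k. S (w k)) x)"
proof (induction q arbitrary: x)
  case 0
  then show ?case by (simp add: norm_sq_eq)
next
  case (Suc q)
  let ?e = "\<lambda>y. exp (- (y \<bullet> S y) / 2)" and ?h = "wick T q (\<lambda>k. S (w k))"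
  have bS: "bounded_linear S" using linS linear_conv_bounded_linear by blast
  have e: "(?e has_derivative (\<lambda>a. - (x \<bullet> S a) * ?e x)) (at x)"
  proof -
    have 1: "((\<lambda>y. y \<bullet> S y) has_derivative (\<lambda>a. x \<bullet> S a + a \<bullet> S x)) (at x)"
      by (rule has_derivative_inner[OF has_derivative_ident bounded_linear_imp_has_derivative[OF bS]])
    have 2: "a \<bullet> S x = x \<bullet> S a" for a
      using S_sym[of x a] inner_commute[of a "S x"] inner_commute[of x "S a"] by argo
    show ?thesis
      using has_derivative_exp[OF has_derivative_mult_right[OF 1[unfolded 2], of "- 1 / 2"]]
      by (simp add: field_simps)
  qed
  have ed: "?e differentiable at x" using e by (auto simp: differentiable_def)
  have hd: "?h differentiable at x" by (rule polf_differentiable[OF polf_wick])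
  have "iterated_deriv (Suc q) (\<lambda>y. exp (- norm_sq B y / 2)) x w =
    ddir (w q) (\<lambda>y. (-1) ^ q * (?e y * ?h y)) x"
    by (simp only: iterated_deriv.simps Suc.IH ddir_def)
  also have "\<dots> = (-1) ^ q * (?e x * ddir (w q) ?h x - (x \<bullet> S (w q)) * ?e x * ?h x)"
    by (simp only: ddir_cmul[OF differentiable_mult[OF ed hd]] ddir_mult[OF ed hd] ddirI[OF e])
       (simp add: algebra_simps)
  also have "\<dots> = (-1) ^ Suc q * (?e x * wick T (Suc q) (\<lambda>k. S (w k)) x)"
    by (simp add: creation_def TS algebra_simps)
  finally show ?case .
qed

lemma hermite_form_eq: "hermite_form B q x w = wick T q (\<lambda>k. S (w k)) x"
proof -
  have "(-1) ^ q * exp (x \<bullet> S x / 2) * ((-1) ^ q * (exp (- (x \<bullet> S x) / 2) * h)) = h" for h :: real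
  proof -
    have "(-1) ^ q * exp (x \<bullet> S x / 2) * ((-1) ^ q * (exp (- (x \<bullet> S x) / 2) * h)) =
      ((-1) ^ q * (-1) ^ q) * (exp (x \<bullet> S x / 2) * exp (- (x \<bullet> S x) / 2)) * h" by (simp only: mult_ac)
    then show ?thesis by (simp add: power_mult_distrib[symmetric] exp_add[symmetric])
  qed
  then show ?thesis
    unfolding hermite_form_def iterated_deriv_gauss unfolding norm_sq_eq .
qed

text \<open>The tensor scalar product contributes T in every slot and the Hermite form contributes
  S. They cancel by expanding \<open>T (I q)\<close> in the basis and applying S, so the contraction
  is the plain \<open>wick_sum\<close>.\<close>

lemma wick_expand:
  "(\<Sum>J\<in>multi_indices q. (\<Prod>k<q. T (I k) \<bullet> J k) * wick T q (\<lambda>k. S (J k)) x) = wick T q I x"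
proof (induction q arbitrary: x)
  case 0
  then show ?case by (simp add: multi_indices_0)
next
  case (Suc q)
  have IH: "wick T q I = (\<lambda>x. \<Sum>J\<in>multi_indices q. (\<Prod>k<q. T (I k) \<bullet> J k) * wick T q (\<lambda>k. S (J k)) x)"
    using Suc by auto
  have c: "wick T q (\<lambda>k. S ((J(q := b)) k)) = wick T q (\<lambda>k. S (J k))" for J b
    by (rule wick_cong) simp
  have "I q = (\<Sum>b\<in>Basis. (T (I q) \<bullet> b) *\<^sub>R S b)"
    using arg_cong[OF euclidean_representation[of "T (I q)"], of S]
    by (simp add: linear_sum[OF linS] linear_scale[OF linS] ST)
  then have "wick T (Suc q) I x = (\<Sum>b\<in>Basis. (T (I q) \<bullet> b) * creation T (S b) (wick T q I) x)"
    using creation_sum_left[OF linT polf_wick, where c="\<lambda>b. T (I q) \<bullet> b" and a=S and I=Basis and q1=q and a1=I and x=x] by simp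
  also have "\<dots> = (\<Sum>b\<in>Basis. \<Sum>J\<in>multi_indices q. (T (I q) \<bullet> b) * ((\<Prod>k<q. T (I k) \<bullet> J k) * creation T (S b) (wick T q (\<lambda>k. S (J k))) x))"
    by (subst IH) (simp add: creation_sum polf_wick sum_distrib_left)
  finally show ?case
    by (simp add: sum_multi_Suc c sum.swap[of _ Basis] mult_ac del: fun_upd_apply) (simp add: mult_ac)
qed

lemma tensor_inner_hermite: "tensor_inner B q g (hermite_form B q x) = wick_sum T q g x"
proof -
  have "tensor_inner B q g (hermite_form B q x) =
    (\<Sum>I\<in>multi_indices q. g I * (\<Sum>J\<in>multi_indices q. (\<Prod>k<q. T (I k) \<bullet> J k) * wick T q (\<lambda>k. S (J k)) x))"
    by (simp add: tensor_inner_def hermite_form_eq T_inner sum_distrib_left mult_ac)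
  then show ?thesis by (simp add: wick_expand wick_sum_eq)
qed

lemma chaos_proj_eq: "chaos_proj B \<eta> f q x = wick_sum T q (chaos_coeff B \<eta> f q) x / fact q"
  by (simp add: chaos_proj_def tensor_inner_hermite)

lemma symmetric_tensor_chaos_coeff: "symmetric_tensor q (chaos_coeff B \<eta> f q)"
  unfolding symmetric_tensor_def
proof (intro allI impI)
  fix k and i :: "nat \<Rightarrow> 'w" assume "Suc k < q"
  have "(\<lambda>j. S (swap_adj k i j)) = swap_adj k (\<lambda>j. S (i j))" by (auto simp: swap_adj_def)
  then show "chaos_coeff B \<eta> f q (swap_adj k i) = chaos_coeff B \<eta> f q i"
    using wick_swap[OF T_sym \<open>Suc k < q\<close>] by (simp add: chaos_coeff_def hermite_form_eq)
qed

end

section \<open>Covariance of a chaotic component\<close>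

lemma measurable_field_at:
  assumes "measurable_field M X" shows "X v \<in> borel_measurable M"
  using measurable_compose[OF measurable_Pair1'[of v borel M] assms[unfolded measurable_field_def]] by simp

lemma gauss_vec_linear:
  fixes X :: "'v::euclidean_space \<Rightarrow> 'a \<Rightarrow> 'w::euclidean_space"
  assumes "prob_space M" "measurable_field M X" "gaussian_field M X" "centered_field M X"
  shows "gaussian_rv M (\<lambda>\<omega>. X u \<omega> \<bullet> a + X v \<omega> \<bullet> b)"
    and "(LINT \<omega>|M. X u \<omega> \<bullet> a + X v \<omega> \<bullet> b) = 0"
proof -
  interpret prob_space M by fact
  have gr: "gaussian_rv M (\<lambda>\<omega>. X u \<omega> \<bullet> a + X v \<omega> \<bullet> b)" for u v a b
  \<comment> \<open>\<open>gaussian_field\<close> sums over a set of points, so for u = v the two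
    forms have to be merged into one.\<close>
  proof (cases "u = v")
    case True
    have "gaussian_rv M (\<lambda>\<omega>. \<Sum>w\<in>{u}. (\<lambda>w x. x \<bullet> (a + b)) w (X w \<omega>))"
      by (rule assms(3)[unfolded gaussian_field_def, rule_format]) (auto simp: linear_inner_form)
    then show ?thesis using True by (simp add: inner_add_right)
  next
    case False
    have "gaussian_rv M (\<lambda>\<omega>. \<Sum>w\<in>{u, v}. (\<lambda>w x. x \<bullet> (if w = u then a else b)) w (X w \<omega>))"
      by (rule assms(3)[unfolded gaussian_field_def, rule_format]) (auto simp: linear_inner_form)
    then show ?thesis using False by simp
  qed
  have "integrable M (\<lambda>\<omega>. X v \<omega> \<bullet> b)" for v b
  proof -
    have "gaussian_rv M (\<lambda>\<omega>. X v \<omega> \<bullet> b)" using gr[of v b v 0] by simp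
    then consider m s where "s > 0" "distributed M lborel (\<lambda>\<omega>. X v \<omega> \<bullet> b) (normal_density m s)"
      | m where "AE \<omega> in M. X v \<omega> \<bullet> b = m"
      by (auto simp: gaussian_rv_def)
    then show ?thesis
    proof cases
      case 1
      have "integrable lborel (\<lambda>x. normal_density m s x * x)"
        using integrable_normal_moment_nz_1[OF 1(1), of m] by simp
      then show ?thesis using distributed_integrable[OF 1(2), of "\<lambda>x. x"] 1(1) by simp
    next
      case 2
      note measurable_field_at[OF assms(2), measurable]
      show ?thesis by (rule integrable_cong_AE_imp[of M "\<lambda>_. m"]) (use 2 in auto)
    qed
  qed note i = this
  have "(LINT \<omega>|M. X v \<omega> \<bullet> b) = 0" for v b
  proof -
    \<comment> \<open>\<open>centered_field\<close> is about the vector-valued integral; the inner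
      product can be taken outside only once \<open>X v\<close> is known to be integrable.\<close>
    have ii: "integrable M (\<lambda>\<omega>. \<Sum>b\<in>Basis. (X v \<omega> \<bullet> b) *\<^sub>R b)"
      by (intro Bochner_Integration.integrable_sum integrable_scaleR_left i)
    then have "integrable M (X v)" by (simp add: euclidean_representation)
    then have "(LINT \<omega>|M. X v \<omega> \<bullet> b) = (LINT \<omega>|M. X v \<omega>) \<bullet> b"
      by simp
    then show ?thesis using assms(4) by (simp add: centered_field_def)
  qed
  then show "(LINT \<omega>|M. X u \<omega> \<bullet> a + X v \<omega> \<bullet> b) = 0" by (simp add: i)
  show "gaussian_rv M (\<lambda>\<omega>. X u \<omega> \<bullet> a + X v \<omega> \<bullet> b)" by (rule gr)
qed

text \<open>The points u - v and 0, shifted by v, become u and v. Indexing by a set covers u = v as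
  well.\<close>

lemma stationary_covariance:
  fixes X :: "'v::euclidean_space \<Rightarrow> 'a \<Rightarrow> 'w::euclidean_space"
  assumes "measurable_field M X" "stationary_field M X"
  shows "(LINT \<omega>|M. (X u \<omega> \<bullet> a) * (X v \<omega> \<bullet> b)) = field_cov M X (u - v) (\<lambda>x. x \<bullet> a) (\<lambda>x. x \<bullet> b)"
proof -
  let ?J = "{u - v, 0}"
  let ?P = "Pi\<^sub>M ?J (\<lambda>_. borel :: 'w measure)"
  let ?F = "\<lambda>g :: 'v \<Rightarrow> 'w. (g (u - v) \<bullet> a) * (g 0 \<bullet> b)"
  note [measurable] = measurable_field_at[OF assms(1)]
  have F [measurable]: "?F \<in> borel_measurable ?P"
    by (intro borel_measurable_times borel_measurable_inner measurable_component_singleton) auto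
  have "(LINT g|distr M ?P (\<lambda>\<omega>. \<lambda>w\<in>?J. X (w + v) \<omega>). ?F g) = (LINT g|distr M ?P (\<lambda>\<omega>. \<lambda>w\<in>?J. X w \<omega>). ?F g)"
    using assms(2)[unfolded stationary_field_def, rule_format, of ?J v] by simp
  then show ?thesis
    by (subst (asm) (1 2) integral_distr) (auto simp: field_cov_def)
qed

text \<open>Positive definiteness makes the covariance matrix T of \<open>X 0\<close> invertible,
  which yields S; stationarity lets this one T serve as covariance of the first component of every
  pair \<open>(X u, X v)\<close>.\<close>

lemma chaos_proj_field:
  fixes X :: "'v::euclidean_space \<Rightarrow> 'a \<Rightarrow> 'w::euclidean_space" and f :: "'w \<Rightarrow> real" and q :: nat
  assumes M: "prob_space M"
    and meas: "measurable_field M X"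
    and gauss: "gaussian_field M X"
    and centered: "centered_field M X"
    and stat: "stationary_field M X"
    and pos: "pos_def_form (field_cov M X 0)"
  defines "g \<equiv> chaos_coeff (field_cov M X 0) (field_law M X) f q"
    and "A \<equiv> chaos_proj (field_cov M X 0) (field_law M X) f q"
  shows "A \<in> borel_measurable borel"
    and "integrable M (\<lambda>\<omega>. A (X v \<omega>))"
    and "integrable M (\<lambda>\<omega>. A (X u \<omega>) * A (X v \<omega>))"
    and "q \<ge> 1 \<Longrightarrow> (LINT \<omega>|M. A (X v \<omega>)) = 0"
    and "(LINT \<omega>|M. A (X u \<omega>) * A (X v \<omega>)) =
       (\<Sum>I\<in>multi_indices q. \<Sum>J\<in>multi_indices q. g I * g J *
          (\<Prod>k<q. field_cov M X (u - v) (\<lambda>x. x \<bullet> I k) (\<lambda>x. x \<bullet> J k))) / fact q"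
proof -
  interpret prob_space M by fact
  note [measurable] = measurable_field_at[OF meas]
  note lin = gauss_vec_linear[OF M meas gauss centered]
  interpret X0: gauss_vec M "X 0"
    by unfold_locales (use lin[of 0 _ 0 0] in auto)
  have cov0: "X0.cov a b = field_cov M X 0 (\<lambda>x. x \<bullet> a) (\<lambda>x. x \<bullet> b)" for a b
    by (simp add: X0.cov_def field_cov_def)
  have sym: "X0.cov a b = X0.cov b a" for a b by (simp add: X0.cov_def mult.commute)
  define T where "T = X0.cvec"
  have Tin: "T a \<bullet> b = X0.cov a b" for a b by (simp add: T_def X0.cvec_inner)
  have Tsym: "T a \<bullet> b = T b \<bullet> a" for a b by (simp add: Tin sym[of a])
  have linT: "linear T"
  proof (rule linearI)
    fix x y :: 'w and c :: real
    show "T (x + y) = T x + T y"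
    proof (rule euclidean_eqI)
      fix b show "T (x + y) \<bullet> b = (T x + T y) \<bullet> b"
        using Tsym[of "x + y" b] Tsym[of x b] Tsym[of y b] by (simp only: inner_add_left inner_add_right)
    qed
    show "T (c *\<^sub>R x) = c *\<^sub>R T x"
    proof (rule euclidean_eqI)
      fix b show "T (c *\<^sub>R x) \<bullet> b = c *\<^sub>R T x \<bullet> b"
        using Tsym[of "c *\<^sub>R x" b] Tsym[of x b] by (simp only: inner_scaleR_left inner_scaleR_right)
    qed
  qed
  have "inj T"
    unfolding linear_injective_0[OF linT]
  proof (intro allI impI)
    fix a assume "T a = 0"
    then have "X0.cov a a = 0" using Tin[of a a] by simp
    then have "\<not> X0.cov a a > 0" by simp
    then have "(\<lambda>x. x \<bullet> a) = (\<lambda>_. 0)"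
      using pos linear_inner_form[of a] unfolding pos_def_form_def cov0 by blast
    then have "a \<bullet> a = 0" by meson
    then show "a = 0" by simp
  qed
  then obtain S where S: "linear S" "\<And>x. S (T x) = x" "\<And>x. T (S x) = x"
    using linear_injective_isomorphism[OF linT] by blast
  interpret dual_form "field_cov M X 0" T S
    by (rule dual_form.intro) (fact linT S Tsym, fact linT S Tsym, fact S, fact S, simp add: Tin cov0, fact Tsym)
  have Aeq: "A = (\<lambda>x. wick_sum T q g x / fact q)"
    by (auto simp: A_def g_def chaos_proj_eq)
  show "A \<in> borel_measurable borel"
    using borel_measurable_polf[OF polf_wick_sum, of T q g] by (simp add: Aeq)
  have gp: "gauss_pair M (\<lambda>\<omega>. (X u \<omega>, X v \<omega>)) T" for u v
  proof -
    interpret P: gauss_vec M "\<lambda>\<omega>. (X u \<omega>, X v \<omega>)"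
      by unfold_locales (use lin[of u _ v _] in \<open>auto simp: inner_prod_def\<close>)
    show ?thesis
    proof unfold_locales
      show "P.cov (a, 0) (b, 0) = T a \<bullet> b" for a b
        using stationary_covariance[OF meas stat, of u a u b]
        by (simp add: P.cov_def Tin cov0)
    qed
  qed
  { fix u v
    interpret P: gauss_pair M "\<lambda>\<omega>. (X u \<omega>, X v \<omega>)" T by (rule gp)
    show "integrable M (\<lambda>\<omega>. A (X v \<omega>))"
      using P.polf_integrable[OF P.polf_snd[OF polf_wick_sum]] by (simp add: Aeq)
    show "integrable M (\<lambda>\<omega>. A (X u \<omega>) * A (X v \<omega>))"
      using P.integrable_pair[OF polf_wick_sum polf_wick_sum, of T q g T q g] by (simp add: Aeq)
    have "P.cov (a, 0) (0, b) = field_cov M X (u - v) (\<lambda>x. x \<bullet> a) (\<lambda>x. x \<bullet> b)" for a b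
      using stationary_covariance[OF meas stat, of u a v b] by (simp add: P.cov_def)
    then show "(LINT \<omega>|M. A (X u \<omega>) * A (X v \<omega>)) =
       (\<Sum>I\<in>multi_indices q. \<Sum>J\<in>multi_indices q. g I * g J *
          (\<Prod>k<q. field_cov M X (u - v) (\<lambda>x. x \<bullet> I k) (\<lambda>x. x \<bullet> J k))) / fact q"
      using P.wick_sum_covariance[of q g g] symmetric_tensor_chaos_coeff[of q "field_law M X" f]
      by (simp add: Aeq g_def) }
  { assume "q \<ge> 1"
    interpret P: gauss_pair M "\<lambda>\<omega>. (X v \<omega>, X v \<omega>)" T by (rule gp)
    show "(LINT \<omega>|M. A (X v \<omega>)) = 0"
      using P.wick_sum_expectation[of q g] \<open>q \<ge> 1\<close> by (simp add: Aeq) }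
qed

section \<open>Densities of set functions\<close>

text \<open>The condition of \<open>complex_measure\<close>, also for real values, so that real
  parts of diagonal entries can be handled as finite measures.\<close>

definition add_set_fun :: "('v::topological_space set \<Rightarrow> 'b::real_normed_vector) \<Rightarrow> bool" where
  "add_set_fun r \<longleftrightarrow> (\<forall>A :: nat \<Rightarrow> 'v set. range A \<subseteq> sets borel \<longrightarrow> disjoint_family A \<longrightarrow>
     (\<lambda>n. r (A n)) sums r (\<Union>n. A n))"

definition set_fun_measure :: "('v::topological_space set \<Rightarrow> real) \<Rightarrow> 'v measure" where
  "set_fun_measure r = measure_of UNIV (sets borel) (\<lambda>E. ennreal (r E))"

lemma sets_set_fun_measure [simp, measurable_cong]: "sets (set_fun_measure r) = sets borel"
  using sets.sigma_algebra_axioms[of borel] by (simp add: set_fun_measure_def sets.sigma_sets_eq[of borel, simplified])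

lemma space_set_fun_measure [simp]: "space (set_fun_measure r) = UNIV"
  by (simp add: set_fun_measure_def space_measure_of_conv)

lemma add_set_fun_empty: "add_set_fun r \<Longrightarrow> r {} = 0"
proof -
  assume "add_set_fun r"
  then have "(\<lambda>n::nat. r {}) sums r (\<Union>n::nat. {})"
    unfolding add_set_fun_def by (elim allE[of _ "\<lambda>_. {}"]) (auto simp: disjoint_family_on_def)
  then have "(\<lambda>n::nat. r {}) \<longlonglongrightarrow> 0" by (auto intro: summable_LIMSEQ_zero simp: sums_iff)
  then show ?thesis by (simp add: LIMSEQ_const_iff)
qed

lemma emeasure_set_fun_measure:
  fixes r :: "'v::topological_space set \<Rightarrow> real"
  assumes "add_set_fun r" "\<And>E. E \<in> sets borel \<Longrightarrow> r E \<ge> 0" "E \<in> sets borel"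
  shows "emeasure (set_fun_measure r) E = ennreal (r E)"
  unfolding set_fun_measure_def
proof (rule emeasure_measure_of_sigma)
  show "sigma_algebra UNIV (sets (borel :: 'v measure))"
    using sets.sigma_algebra_axioms[of "borel :: 'v measure"] by simp
  show "positive (sets borel) (\<lambda>E. ennreal (r E))"
    using add_set_fun_empty[OF assms(1)] by (simp add: positive_def)
  show "countably_additive (sets borel) (\<lambda>E. ennreal (r E))"
  proof (rule countably_additiveI)
    fix A :: "nat \<Rightarrow> 'v set" assume A: "range A \<subseteq> sets borel" "disjoint_family A"
    then have s: "(\<lambda>n. r (A n)) sums r (\<Union>n. A n)" using assms(1) by (simp add: add_set_fun_def)
    have "(\<Sum>n. ennreal (r (A n))) = ennreal (\<Sum>n. r (A n))"
      using A(1) by (intro suminf_ennreal2 assms(2) sums_summable[OF s]) auto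
    then show "(\<Sum>n. ennreal (r (A n))) = ennreal (r (\<Union>n. A n))" using sums_unique[OF s] by simp
  qed
qed fact

lemma finite_set_fun_measure:
  fixes r :: "'v::topological_space set \<Rightarrow> real"
  assumes "add_set_fun r" "\<And>E. E \<in> sets borel \<Longrightarrow> r E \<ge> 0"
  shows "finite_measure (set_fun_measure r)"
  by (rule finite_measureI) (simp add: emeasure_set_fun_measure assms)

lemma add_set_fun_sum:
  "(\<And>i. i \<in> I \<Longrightarrow> add_set_fun (r i)) \<Longrightarrow> add_set_fun (\<lambda>E. \<Sum>i\<in>I. r i E)"
  unfolding add_set_fun_def by (intro allI impI sums_sum) auto

lemma add_set_fun_add: "add_set_fun r \<Longrightarrow> add_set_fun s \<Longrightarrow> add_set_fun (\<lambda>E. r E + s E)"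
  unfolding add_set_fun_def by (intro allI impI sums_add) auto

text \<open>Radon-Nikodym: domination by s gives absolute continuity, and finiteness of r gives an
  integrable real density.\<close>

lemma density_of_dominated_set_fun:
  fixes r s :: "'v::topological_space set \<Rightarrow> real"
  assumes r: "add_set_fun r" "\<And>E. E \<in> sets borel \<Longrightarrow> r E \<ge> 0"
    and s: "add_set_fun s" "\<And>E. E \<in> sets borel \<Longrightarrow> r E \<le> s E"
  obtains D :: "'v \<Rightarrow> real" where "integrable (set_fun_measure s) D"
    and "\<And>E. E \<in> sets borel \<Longrightarrow> r E = (LINT x|set_fun_measure s. indicator E x * D x)"
proof -
  have s0: "s E \<ge> 0" if "E \<in> sets borel" for E using r(2)[OF that] s(2)[OF that] by simp
  let ?N = "set_fun_measure s" and ?R = "set_fun_measure r"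
  interpret N: finite_measure ?N by (rule finite_set_fun_measure[OF s(1) s0])
  have fR: "finite_measure ?R" by (rule finite_set_fun_measure[OF r])
  have ac: "absolutely_continuous ?N ?R"
    unfolding absolutely_continuous_def
  proof
    fix E assume E: "E \<in> null_sets ?N"
    then have [simp]: "E \<in> sets borel" by (auto simp: null_sets_def)
    have "s E \<le> 0" using E by (simp add: null_sets_def emeasure_set_fun_measure[OF s(1) s0] ennreal_eq_0_iff)
    then have "r E \<le> 0" using s(2)[of E] by simp
    then show "E \<in> null_sets ?R" by (simp add: null_sets_def emeasure_set_fun_measure[OF r] ennreal_neg)
  qed
  obtain D where D: "D \<in> borel_measurable ?N" "AE x in ?N. RN_deriv ?N ?R x = ennreal (D x)" "\<And>x. 0 \<le> D x"
    using N.real_RN_deriv[OF fR ac] by auto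
  have e: "ennreal (r E) = (\<integral>\<^sup>+x. ennreal (indicator E x * D x) \<partial>?N)" if E: "E \<in> sets borel" for E
  proof -
    have "ennreal (r E) = emeasure (density ?N (RN_deriv ?N ?R)) E"
      using N.density_RN_deriv[OF ac] by (simp add: emeasure_set_fun_measure[OF r E])
    also have "\<dots> = (\<integral>\<^sup>+x. RN_deriv ?N ?R x * indicator E x \<partial>?N)"
      by (rule emeasure_density) (use E in auto)
    also have "\<dots> = (\<integral>\<^sup>+x. ennreal (indicator E x * D x) \<partial>?N)"
      by (rule nn_integral_cong_AE) (use D(2) in eventually_elim, auto split: split_indicator)
    finally show ?thesis .
  qed
  show ?thesis
  proof
    show int: "integrable ?N D"
    proof (rule integrableI_nonneg)
      have "(\<integral>\<^sup>+x. ennreal (D x) \<partial>?N) = ennreal (r UNIV)" using e[of UNIV] by simp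
      then show "(\<integral>\<^sup>+x. ennreal (D x) \<partial>?N) < \<infinity>" by simp
    qed (use D in auto)
    fix E :: "'v set" assume E: "E \<in> sets borel"
    have "integrable ?N (\<lambda>x. indicator E x * D x)"
      using integrable_mult_indicator[of E ?N D] E int by simp
    then have "(\<integral>\<^sup>+x. ennreal (indicator E x * D x) \<partial>?N) = ennreal (LINT x|?N. indicator E x * D x)"
      by (rule nn_integral_eq_integral) (use D(3) in auto)
    then have "ennreal (r E) = ennreal (LINT x|?N. indicator E x * D x)" using e[OF E] by simp
    moreover have "0 \<le> (LINT x|?N. indicator E x * D x)" using D(3) by (intro integral_nonneg_AE) auto
    ultimately show "r E = (LINT x|?N. indicator E x * D x)"
      using r(2)[OF E] by (simp add: ennreal_inj)
  qed
qed

text \<open>The supremum over subsets F of E is attained at the part of E where f is positive. The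
  truncation in \<open>ennreal (f x)\<close> discards the negative part.\<close>

lemma jordan_pos_density:
  fixes T :: "'v::topological_space measure"
  assumes sets: "sets T = sets borel" and f: "integrable T f"
    and r: "\<And>E. E \<in> sets borel \<Longrightarrow> r E = (LINT x|T. indicator E x * f x)"
  shows "jordan_pos r = density T (\<lambda>x. ennreal (f x))"
proof -
  note [measurable_cong] = sets
  have sp: "space T = UNIV" using sets_eq_imp_space_eq[OF sets] by simp
  have [measurable]: "f \<in> borel_measurable T" using f by auto
  let ?D = "density T (\<lambda>x. ennreal (f x))"
  have i: "integrable T (\<lambda>x. indicator F x * f x)" if "F \<in> sets borel" for F
    using integrable_mult_indicator[of F T f] that f sets by simp
  have "(SUP F\<in>{F \<in> sets borel. F \<subseteq> E}. ennreal (r F)) = emeasure ?D E" if E: "E \<in> sets borel" for E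
  proof (rule antisym)
    show "(SUP F\<in>{F \<in> sets borel. F \<subseteq> E}. ennreal (r F)) \<le> emeasure ?D E"
    proof (rule SUP_least)
      fix F assume F: "F \<in> {F \<in> sets borel. F \<subseteq> E}"
      then have F': "F \<in> sets borel" by simp
      have im: "integrable T (\<lambda>x. max 0 (indicator F x * f x))" by (intro integrable_max i F') simp
      have "ennreal (r F) \<le> ennreal (LINT x|T. max 0 (indicator F x * f x))"
        unfolding r[OF F'] by (intro ennreal_leI integral_mono i F' im) simp
      also have "\<dots> = (\<integral>\<^sup>+x. ennreal (max 0 (indicator F x * f x)) \<partial>T)"
        by (rule nn_integral_eq_integral[symmetric, OF im]) simp
      also have "\<dots> \<le> (\<integral>\<^sup>+x. ennreal (f x) * indicator E x \<partial>T)"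
        using F by (intro nn_integral_mono) (auto split: split_indicator simp: max_def ennreal_neg)
      also have "\<dots> = emeasure ?D E" using E sets by (subst emeasure_density) auto
      finally show "ennreal (r F) \<le> emeasure ?D E" .
    qed
    let ?F = "E \<inter> {x. f x > 0}"
    have F: "?F \<in> sets borel"
    proof -
      have "{x \<in> space T. f x > 0} \<in> sets T" by measurable
      then show ?thesis using E sp sets by auto
    qed
    have "emeasure ?D E = (\<integral>\<^sup>+x. ennreal (f x) * indicator E x \<partial>T)" using E sets by (subst emeasure_density) auto
    also have "\<dots> = (\<integral>\<^sup>+x. ennreal (indicator ?F x * f x) \<partial>T)"
      by (intro nn_integral_cong) (auto split: split_indicator simp: ennreal_neg not_less)
    also have "\<dots> = ennreal (r ?F)"
      unfolding r[OF F] by (rule nn_integral_eq_integral[OF i[OF F]]) (auto split: split_indicator)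
    also have "\<dots> \<le> (SUP F\<in>{F \<in> sets borel. F \<subseteq> E}. ennreal (r F))"
      using F by (intro SUP_upper) auto
    finally show "emeasure ?D E \<le> (SUP F\<in>{F \<in> sets borel. F \<subseteq> E}. ennreal (r F))" .
  qed
  moreover have ss: "sigma_sets UNIV (sets borel) = sets (borel :: 'v measure)"
    using sets.sigma_sets_eq[of "borel :: 'v measure"] by simp
  ultimately have "jordan_pos r = measure_of UNIV (sets borel) (emeasure ?D)"
    unfolding jordan_pos_def by (intro measure_of_eq) auto
  also have "\<dots> = ?D"
    using measure_of_of_measure[of ?D] sp sets by simp
  finally show ?thesis .
qed

text \<open>The four Jordan parts have as densities the positive and negative parts of Re m and Im
  m, and these recombine to m. From here on a complex measure is handled through a density against a
  positive measure.\<close>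

lemma complex_measure_integral_density:
  fixes T :: "'v::topological_space measure" and g m :: "'v \<Rightarrow> complex"
  assumes sets: "sets T = sets borel" and m: "integrable T m"
    and \<nu>: "\<And>E. E \<in> sets borel \<Longrightarrow> \<nu> E = (LINT x|T. indicator E x * m x)"
    and g: "g \<in> borel_measurable T" "\<And>x. cmod (g x) \<le> C"
  shows "integrable T (\<lambda>x. g x * m x)"
    and "complex_measure_integral \<nu> g = (LINT x|T. g x * m x)"
proof -
  have [measurable]: "g \<in> borel_measurable T" "m \<in> borel_measurable T" using g m by auto
  have C0: "C \<ge> 0" using g(2) norm_ge_zero order_trans by blast
  have gb: "integrable T (\<lambda>x. h x *\<^sub>R g x)" if h: "integrable T h" for h :: "'v \<Rightarrow> real"
  proof (rule integrable_dominated)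
    show "integrable T (\<lambda>x. C * h x)" using h by simp
    show "AE x in T. norm (h x *\<^sub>R g x) \<le> norm (C * h x)"
    proof (rule AE_I2)
      fix x show "norm (h x *\<^sub>R g x) \<le> norm (C * h x)"
        using mult_left_mono[OF g(2)[of x], of "\<bar>h x\<bar>"] C0 by (simp add: abs_mult mult.commute)
    qed
  qed (use h in measurable)
  show "integrable T (\<lambda>x. g x * m x)"
  proof (rule integrable_dominated)
    show "integrable T (\<lambda>x. C * cmod (m x))" using m by simp
    show "AE x in T. norm (g x * m x) \<le> norm (C * cmod (m x))"
      using g(2) C0 by (intro AE_I2) (simp add: norm_mult mult_right_mono)
  qed measurable
  have i: "integrable T (\<lambda>x. indicator E x * m x)" if "E \<in> sets borel" for E
  proof -
    have "(\<lambda>x. indicator E x * m x) = (\<lambda>x. indicator E x *\<^sub>R m x)" by (auto split: split_indicator)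
    then show ?thesis using integrable_mult_indicator[of E T m] that m sets by simp
  qed
  have jp: "(LINT x|jordan_pos r. g x) = (LINT x|T. max 0 (f x) *\<^sub>R g x)"
    if f: "integrable T f" and r: "\<And>E. E \<in> sets borel \<Longrightarrow> r E = (LINT x|T. indicator E x * f x)" for r f
  proof -
    have [measurable]: "f \<in> borel_measurable T" using f by auto
    have "jordan_pos r = density T (\<lambda>x. ennreal (f x))"
      using sets f r by (rule jordan_pos_density)
    also have "\<dots> = density T (\<lambda>x. ennreal (max 0 (f x)))" by (simp add: ennreal_max_0)
    finally have "jordan_pos r = density T (\<lambda>x. ennreal (max 0 (f x)))" .
    then have "(LINT x|jordan_pos r. g x) = (LINT x|density T (\<lambda>x. ennreal (max 0 (f x))). g x)" by simp
    also have "\<dots> = (LINT x|T. max 0 (f x) *\<^sub>R g x)" by (rule integral_density) auto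
    finally show ?thesis .
  qed
  have Re: "Re (\<nu> E) = (LINT x|T. indicator E x * Re (m x))" if "E \<in> sets borel" for E
    unfolding \<nu>[OF that] integral_Re[OF i[OF that], symmetric]
    by (rule lint_cong) (simp split: split_indicator)
  have Im: "Im (\<nu> E) = (LINT x|T. indicator E x * Im (m x))" if "E \<in> sets borel" for E
    unfolding \<nu>[OF that] integral_Im[OF i[OF that], symmetric]
    by (rule lint_cong) (simp split: split_indicator)
  have mR: "integrable T (\<lambda>x. Re (m x))" "integrable T (\<lambda>x. Im (m x))" using m by auto
  have mx: "integrable T (\<lambda>x. max 0 (Re (m x)) *\<^sub>R g x)" "integrable T (\<lambda>x. max 0 (- Re (m x)) *\<^sub>R g x)"
    "integrable T (\<lambda>x. max 0 (Im (m x)) *\<^sub>R g x)" "integrable T (\<lambda>x. max 0 (- Im (m x)) *\<^sub>R g x)"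
    by (intro gb integrable_max mR integrable_minus integrable_zero)+
  have "complex_measure_integral \<nu> g =
    ((LINT x|T. max 0 (Re (m x)) *\<^sub>R g x) - (LINT x|T. max 0 (- Re (m x)) *\<^sub>R g x)) +
    \<i> * ((LINT x|T. max 0 (Im (m x)) *\<^sub>R g x) - (LINT x|T. max 0 (- Im (m x)) *\<^sub>R g x))"
    unfolding complex_measure_integral_def
    using jp[OF mR(1), of "\<lambda>E. Re (\<nu> E)"] jp[OF integrable_minus[OF mR(1)], of "\<lambda>E. - Re (\<nu> E)"]
      jp[OF mR(2), of "\<lambda>E. Im (\<nu> E)"] jp[OF integrable_minus[OF mR(2)], of "\<lambda>E. - Im (\<nu> E)"]
    by (simp add: Re Im)
  also have "\<dots> = (LINT x|T. (max 0 (Re (m x)) *\<^sub>R g x - max 0 (- Re (m x)) *\<^sub>R g x) +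
      \<i> * (max 0 (Im (m x)) *\<^sub>R g x - max 0 (- Im (m x)) *\<^sub>R g x))"
    by (simp add: mx)
  also have "\<dots> = (LINT x|T. g x * m x)"
  proof (rule lint_cong)
    fix x
    have *: "max 0 a *\<^sub>R z - max 0 (- a) *\<^sub>R z = a *\<^sub>R z" for a :: real and z :: complex
      by (simp add: max_def)
    show "(max 0 (Re (m x)) *\<^sub>R g x - max 0 (- Re (m x)) *\<^sub>R g x) +
      \<i> * (max 0 (Im (m x)) *\<^sub>R g x - max 0 (- Im (m x)) *\<^sub>R g x) = g x * m x"
      unfolding * by (simp add: complex_eq_iff)
  qed
  finally show "complex_measure_integral \<nu> g = (LINT x|T. g x * m x)" .
qed

section \<open>Positive semidefinite kernels\<close>

definition quad_form :: "'i set \<Rightarrow> ('i \<Rightarrow> 'i \<Rightarrow> complex) \<Rightarrow> ('i \<Rightarrow> complex) \<Rightarrow> complex" where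
  "quad_form S K c = (\<Sum>i\<in>S. \<Sum>j\<in>S. c i * cnj (c j) * K i j)"

definition psd_kernel :: "'i set \<Rightarrow> ('i \<Rightarrow> 'i \<Rightarrow> complex) \<Rightarrow> bool" where
  "psd_kernel S K \<longleftrightarrow> (\<forall>i\<in>S. \<forall>j\<in>S. K j i = cnj (K i j)) \<and> (\<forall>c. 0 \<le> Re (quad_form S K c))"

lemma quad_form_insert:
  assumes "finite S" "s \<notin> S"
  shows "quad_form (insert s S) K c = c s * cnj (c s) * K s s + (\<Sum>j\<in>S. c s * cnj (c j) * K s j) +
     (\<Sum>i\<in>S. c i * cnj (c s) * K i s) + quad_form S K c"
  using assms by (simp add: quad_form_def sum.distrib)

text \<open>Gaussian elimination: subtract the rank one form carried by one index and continue.\<close>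

lemma psd_kernel_rank_one_sum:
  assumes "finite S" "psd_kernel S K"
  shows "\<exists>n a. \<forall>i\<in>S. \<forall>j\<in>S. K i j = (\<Sum>p<(n::nat). a p i * cnj (a p j))"
  using assms
proof (induction S arbitrary: K rule: finite_induct)
  case (insert s S)
  note psd = insert.prems[unfolded psd_kernel_def]
  have herm: "K j i = cnj (K i j)" if "i \<in> insert s S" "j \<in> insert s S" for i j using psd that by blast
  have herm_s: "K s j = cnj (K j s)" if "j \<in> S" for j by (rule herm) (use that in auto)
  have nn: "0 \<le> Re (quad_form (insert s S) K c)" for c using psd by blast
  define k where "k = Re (K s s)"
  have Kss: "K s s = complex_of_real k"
    using herm[of s s] by (simp add: k_def complex_eq_iff)
  have notin: "i \<noteq> s" if "i \<in> S" for i using insert.hyps that by auto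
  have k0: "k \<ge> 0"
  proof -
    have "quad_form (insert s S) K (\<lambda>i. if i = s then 1 else 0) = K s s"
      using insert.hyps notin by (simp add: quad_form_insert) (simp add: quad_form_def)
    then show ?thesis using nn[of "\<lambda>i. if i = s then 1 else 0"] by (simp add: k_def)
  qed
  have zero: "K i s = 0" if k: "k = 0" and i: "i \<in> S" for i
  proof (rule ccontr)
    assume nz: "K i s \<noteq> 0"
    \<comment> \<open>A zero pivot forces its column to vanish: this t makes the quadratic form at c
      equal to Re (K i i) - (Re (K i i) + 1) = -1.\<close>
    let ?t = "(Re (K i i) + 1) / (2 * (cmod (K i s))\<^sup>2)"
    define z where "z = - complex_of_real ?t * K i s"
    define c where "c = (\<lambda>j. if j = s then z else if j = i then 1 else 0)"
    have si: "s \<noteq> i" using notin[OF i] by simp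
    have S: "(\<Sum>j\<in>S. f j * h (c j)) = f i" if "h 0 = 0" "h 1 = 1" for f h :: "_ \<Rightarrow> complex"
    proof -
      have "(\<Sum>j\<in>S. f j * h (c j)) = (\<Sum>j\<in>S. if j = i then f j else 0)"
        using notin that by (intro sum.cong refl) (auto simp: c_def)
      then show ?thesis using insert.hyps i by simp
    qed
    have "quad_form S K c = (\<Sum>l\<in>S. (\<Sum>j\<in>S. K l j * cnj (c j)) * c l)"
      by (simp add: quad_form_def sum_distrib_right sum_distrib_left mult_ac)
    then have q: "quad_form S K c = K i i" by (simp add: S[of cnj] S[of "\<lambda>x. x"])
    have cs: "c s = z" by (simp add: c_def)
    have m1: "(\<Sum>j\<in>S. c s * cnj (c j) * K s j) = z * K s i"
      using S[of cnj "\<lambda>j. z * K s j"] by (simp add: cs mult_ac)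
    have m2: "(\<Sum>j\<in>S. c j * cnj (c s) * K j s) = cnj z * K i s"
      using S[of "\<lambda>x. x" "\<lambda>j. cnj z * K j s"] by (simp add: cs mult_ac)
    have "quad_form (insert s S) K c = z * K s i + cnj z * K i s + K i i"
      unfolding quad_form_insert[OF insert.hyps] q m1 m2 by (simp add: Kss k)
    also have "K s i = cnj (K i s)" by (rule herm) (use i in auto)
    finally have "Re (quad_form (insert s S) K c) = 2 * Re (z * cnj (K i s)) + Re (K i i)"
      by simp
    also have "z * cnj (K i s) = complex_of_real (- ?t * (cmod (K i s))\<^sup>2)"
      by (simp add: z_def mult.assoc complex_norm_square[symmetric])
    also have "- ?t * (cmod (K i s))\<^sup>2 = - (Re (K i i) + 1) / 2" using nz by (simp add: field_simps)
    finally have "Re (quad_form (insert s S) K c) = - 1" by (simp add: field_simps)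
    then show False using nn[of c] by simp
  qed
  \<comment> \<open>For k = 0 division by zero makes b vanish, so nothing is subtracted, which is
    right because the column is zero.\<close>
  define b where "b i = K i s / complex_of_real (sqrt k)" for i
  define K' where "K' i j = K i j - b i * cnj (b j)" for i j
  have bb: "b i * cnj (b j) = K i s * cnj (K j s) / complex_of_real k" for i j
    using k0 by (simp add: b_def complex_of_real_def[symmetric] of_real_mult[symmetric] del: of_real_mult)
  have "psd_kernel S K'"
    unfolding psd_kernel_def
  proof (intro conjI ballI allI)
    fix i j assume "i \<in> S" "j \<in> S"
    then show "K' j i = cnj (K' i j)" using herm[of i j] by (simp add: K'_def)
  next
    fix c
    define L where "L = (\<Sum>i\<in>S. c i * K i s)"
    have q': "quad_form S K' c = quad_form S K c - L * cnj L / complex_of_real k"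
    proof -
      have "L * cnj L / complex_of_real k = (\<Sum>i\<in>S. \<Sum>j\<in>S. c i * cnj (c j) * (b i * cnj (b j)))"
        unfolding bb L_def by (simp add: sum_product sum_divide_distrib mult_ac)
      then show ?thesis by (simp add: quad_form_def K'_def right_diff_distrib sum_subtractf)
    qed
    show "0 \<le> Re (quad_form S K' c)"
    proof (cases "k = 0")
      case True
      have "L = 0" unfolding L_def by (intro sum.neutral ballI) (simp add: zero[OF True])
      moreover have "quad_form (insert s S) K (c(s := 0)) = quad_form S K c"
      proof -
        have "quad_form S K (c(s := 0)) = quad_form S K c"
          unfolding quad_form_def by (intro sum.cong refl) (auto dest: notin)
        then show ?thesis using insert.hyps by (simp add: quad_form_insert)
      qed
      ultimately show ?thesis using nn[of "c(s := 0)"] q' by simp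
    next
      case False
      \<comment> \<open>The minimiser in the coordinate s: completing the square, the minimal value
        is the quadratic form of the Schur complement K'.\<close>
      define z where "z = - L / complex_of_real k"
      let ?c = "c(s := z)"
      have "quad_form S K ?c = quad_form S K c"
        unfolding quad_form_def by (intro sum.cong refl) (auto dest: notin)
      moreover have "(\<Sum>j\<in>S. ?c s * cnj (?c j) * K s j) = z * cnj L"
        unfolding L_def cnj_sum sum_distrib_left
        by (intro sum.cong refl) (use notin in \<open>auto simp: herm_s mult_ac\<close>)
      moreover have "(\<Sum>i\<in>S. ?c i * cnj (?c s) * K i s) = cnj z * L"
        unfolding L_def sum_distrib_left
        by (intro sum.cong refl) (use notin in \<open>auto simp: mult_ac\<close>)
      ultimately have "quad_form (insert s S) K ?c = z * cnj z * complex_of_real k + z * cnj L + cnj z * L + quad_form S K c"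
        using insert.hyps by (simp add: quad_form_insert Kss)
      also have "\<dots> = quad_form S K' c"
        unfolding q' using False by (simp add: z_def field_simps)
      finally show ?thesis using nn[of ?c] by simp
    qed
  qed
  then obtain n a where a: "\<forall>i\<in>S. \<forall>j\<in>S. K' i j = (\<Sum>p<(n::nat). a p i * cnj (a p j))"
    using insert.IH by blast
  \<comment> \<open>Index n carries the rank one form just split off; the forms of K' are extended
    by 0 to s, where K' vanishes.\<close>
  define a' where "a' p i = (if p = n then b i else if i = s then 0 else a p i)" for p i
  have K'0: "K' i j = 0" if ij: "i \<in> insert s S" "j \<in> insert s S" "i = s \<or> j = s" for i j
  proof (cases "k = 0")
    case True
    have "K i s = 0" if "i \<in> insert s S" for i using zero[OF True] Kss True that by auto
    moreover have "K s i = 0" if "i \<in> insert s S" for i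
      using calculation[OF that] herm[of i s] that by simp
    ultimately show ?thesis using ij by (auto simp: K'_def bb)
  next
    case False
    have c: "cnj (K j s) = K s j" using herm[of j s] ij by simp
    show ?thesis using ij(3) False Kss herm[of s s]
      by (auto simp: K'_def bb c) (metis c complex_cnj_cnj)?
  qed
  have "K i j = (\<Sum>p<Suc n. a' p i * cnj (a' p j))" if ij: "i \<in> insert s S" "j \<in> insert s S" for i j
  proof -
    have "(\<Sum>p<n. a' p i * cnj (a' p j)) = K' i j"
    proof (cases "i = s \<or> j = s")
      case True
      then have "(\<Sum>p<n. a' p i * cnj (a' p j)) = 0" by (intro sum.neutral) (auto simp: a'_def)
      then show ?thesis using K'0[OF ij True] by simp
    next
      case False
      then have "(\<Sum>p<n. a' p i * cnj (a' p j)) = (\<Sum>p<n. a p i * cnj (a p j))"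
        by (intro sum.cong refl) (auto simp: a'_def)
      then show ?thesis using a ij False by auto
    qed
    then show ?thesis by (simp add: K'_def a'_def)
  qed
  then show ?case by blast
qed simp

lemma sum_swap3: "(\<Sum>i\<in>A. \<Sum>j\<in>B. \<Sum>p\<in>C. f i j p) = (\<Sum>p\<in>C. \<Sum>i\<in>A. \<Sum>j\<in>B. f i j p)"
proof -
  have "(\<Sum>i\<in>A. \<Sum>j\<in>B. \<Sum>p\<in>C. f i j p) = (\<Sum>i\<in>A. \<Sum>p\<in>C. \<Sum>j\<in>B. f i j p)"
    by (intro sum.cong refl sum.swap)
  then show ?thesis by (subst (asm) sum.swap)
qed

text \<open>Splitting the last kernel into rank one pieces turns Q g into a sum over p of the same
  expression in one degree less, for g with its last slot contracted against
  \<open>a p\<close>.\<close>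

lemma tensor_psd_kernel:
  fixes K :: "nat \<Rightarrow> 'w::euclidean_space \<Rightarrow> 'w \<Rightarrow> complex"
  assumes "\<And>k. k < q \<Longrightarrow> psd_kernel Basis (K k)"
  defines "Q \<equiv> \<lambda>g. \<Sum>I\<in>multi_indices q. \<Sum>J\<in>multi_indices q. g I * cnj (g J) * (\<Prod>k<q. K k (I k) (J k))"
  shows "Im (Q g) = 0" "0 \<le> Re (Q g)"
proof -
  have "Im (Q g) = 0 \<and> 0 \<le> Re (Q g)"
    using assms(1) unfolding Q_def
  proof (induction q arbitrary: g)
    case 0
    then show ?case by (simp add: multi_indices_0)
  next
    case (Suc q)
    obtain n a where a: "\<forall>i\<in>Basis. \<forall>j\<in>Basis. K q i j = (\<Sum>p<(n::nat). a p i * cnj (a p j))"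
      using psd_kernel_rank_one_sum[OF finite_Basis Suc.prems[of q]] by blast
    let ?h = "\<lambda>p I. \<Sum>b\<in>Basis. g (I(q := b)) * a p b"
    let ?P = "\<lambda>I J. \<Prod>k<q. K k (I k) (J k)"
    have inner: "(\<Sum>b\<in>Basis. \<Sum>c\<in>Basis. g (I(q := b)) * cnj (g (J(q := c))) * (\<Prod>k<Suc q. K k ((I(q := b)) k) ((J(q := c)) k))) =
        (\<Sum>p<n. ?h p I * cnj (?h p J) * ?P I J)" (is "?L = _") for I J
    proof -
      have "?L =
        (\<Sum>b\<in>Basis. \<Sum>c\<in>Basis. \<Sum>p<n. (g (I(q := b)) * a p b) * cnj (g (J(q := c)) * a p c) * ?P I J)"
        by (intro sum.cong refl) (use a in \<open>simp add: sum_distrib_left mult_ac\<close>)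
      also have "\<dots> = (\<Sum>p<n. \<Sum>b\<in>Basis. \<Sum>c\<in>Basis. (g (I(q := b)) * a p b) * cnj (g (J(q := c)) * a p c) * ?P I J)"
        by (rule sum_swap3)
      also have "\<dots> = (\<Sum>p<n. ?h p I * cnj (?h p J) * ?P I J)"
        by (simp only: cnj_sum sum_product) (simp only: sum_distrib_right)
      finally show ?thesis .
    qed
    have "(\<Sum>I\<in>multi_indices (Suc q). \<Sum>J\<in>multi_indices (Suc q). g I * cnj (g J) * (\<Prod>k<Suc q. K k (I k) (J k))) =
       (\<Sum>I\<in>multi_indices q. \<Sum>J\<in>multi_indices q. \<Sum>b\<in>Basis. \<Sum>c\<in>Basis.
         g (I(q := b)) * cnj (g (J(q := c))) * (\<Prod>k<Suc q. K k ((I(q := b)) k) ((J(q := c)) k)))"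
      unfolding sum_multi_Suc by (intro sum.cong refl, subst sum.swap) (rule refl)
    also have "\<dots> = (\<Sum>I\<in>multi_indices q. \<Sum>J\<in>multi_indices q. \<Sum>p<n. ?h p I * cnj (?h p J) * ?P I J)"
      by (simp only: inner)
    also have "\<dots> = (\<Sum>p<n. \<Sum>I\<in>multi_indices q. \<Sum>J\<in>multi_indices q. ?h p I * cnj (?h p J) * ?P I J)"
      by (rule sum_swap3)
    finally show ?case
      using Suc.IH[of "?h _"] Suc.prems by (simp add: sum_nonneg del: fun_upd_apply)
  qed
  then show "Im (Q g) = 0" "0 \<le> Re (Q g)" by auto
qed

section \<open>Matrix density of the spectral measure\<close>

lemma psd_formD:
  assumes "psd_hermitian_form B" "linear l" "linear m"
  shows "linear l' \<Longrightarrow> B (\<lambda>x. c * l x + l' x) m = c * B l m + B l' m"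
    and "B m l = cnj (B l m)" and "0 \<le> Re (B l l)"
  using assms unfolding psd_hermitian_form_def by blast+

lemma linear_complex_comb:
  fixes l l' :: "'w::real_vector \<Rightarrow> complex"
  assumes "linear l" "linear l'" shows "linear (\<lambda>x. c * l x + l' x)"
  by (rule linearI) (simp_all add: assms linear_add linear_scale algebra_simps)

lemma psd_form_expand:
  assumes B: "psd_hermitian_form B" and l: "linear l" "linear l'"
  shows "B (\<lambda>x. c * l x + l' x) (\<lambda>x. c * l x + l' x) =
    c * cnj c * B l l + c * B l l' + cnj c * B l' l + B l' l'"
proof -
  have lc: "linear (\<lambda>x. c * l x + l' x)" by (rule linear_complex_comb) fact+
  have r: "B m (\<lambda>x. c * l x + l' x) = cnj c * B m l + B m l'" if m: "linear m" for m
    using psd_formD(2)[OF B lc m] psd_formD(1)[OF B l(1) m l(2), of c]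
      psd_formD(2)[OF B l(1) m] psd_formD(2)[OF B l(2) m] by simp
  show ?thesis
    unfolding psd_formD(1)[OF B l(1) lc l(2)] r[OF l(1)] r[OF l(2)] by (simp add: algebra_simps)
qed

lemma psd_form_sum:
  assumes B: "psd_hermitian_form B" and l: "\<And>i. linear (l i)" and S: "finite S"
  shows "linear (\<lambda>x. \<Sum>i\<in>S. c i * l i x)"
    and "B (\<lambda>x. \<Sum>i\<in>S. c i * l i x) (\<lambda>x. \<Sum>i\<in>S. c i * l i x) = (\<Sum>i\<in>S. \<Sum>j\<in>S. c i * cnj (c j) * B (l i) (l j))"
proof -
  have lin: "linear (\<lambda>x. \<Sum>i\<in>S. c i * l i x)" for S c
    by (induction S rule: infinite_finite_induct) (auto intro: linear_complex_comb l linear_zero)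
  have left: "B (\<lambda>x. \<Sum>i\<in>S. c i * l i x) m = (\<Sum>i\<in>S. c i * B (l i) m)" if m: "linear m" for m
    using S
  proof (induction S rule: finite_induct)
    case empty
    \<comment> \<open>Writing the zero form as - m + m shows that B vanishes on it.\<close>
    have "B (\<lambda>x. (- 1) * m x + m x) m = (- 1) * B m m + B m m"
      by (rule psd_formD(1)[OF B m m m])
    then show ?case by simp
  next
    case (insert i S)
    then show ?case using psd_formD(1)[OF B l m lin] by simp
  qed
  show "linear (\<lambda>x. \<Sum>i\<in>S. c i * l i x)" by (rule lin)
  have right: "B (l i) (\<lambda>x. \<Sum>i\<in>S. c i * l i x) = (\<Sum>j\<in>S. cnj (c j) * B (l i) (l j))" for i
  proof -
    have "B (l i) (\<lambda>x. \<Sum>i\<in>S. c i * l i x) = cnj (\<Sum>j\<in>S. c j * B (l j) (l i))"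
      unfolding left[OF l, symmetric] by (rule psd_formD(2)[OF B lin l])
    also have "\<dots> = (\<Sum>j\<in>S. cnj (c j) * B (l i) (l j))"
      by (simp add: psd_formD(2)[OF B l l, symmetric])
    finally show ?thesis .
  qed
  show "B (\<lambda>x. \<Sum>i\<in>S. c i * l i x) (\<lambda>x. \<Sum>i\<in>S. c i * l i x) = (\<Sum>i\<in>S. \<Sum>j\<in>S. c i * cnj (c j) * B (l i) (l j))"
    by (simp add: left[OF lin] right sum_distrib_left mult.assoc)
qed

text \<open>Positivity of the density matrix is known almost everywhere for each fixed vector c.
  Continuity in c lets countably many c suffice, so one null set serves all vectors.\<close>

lemma Re_quad_form_nonneg_dense:
  fixes D :: "complex set"
  assumes S: "finite S" and D: "\<And>X. open X \<Longrightarrow> X \<noteq> {} \<Longrightarrow> \<exists>d\<in>D. d \<in> X"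
    and nn: "\<And>c. c \<in> S \<rightarrow>\<^sub>E D \<Longrightarrow> 0 \<le> Re (quad_form S K c)"
  shows "0 \<le> Re (quad_form S K c)"
proof -
  have "\<exists>d\<in>D. dist z d < 1 / real (Suc n)" for z and n :: nat
    using D[of "ball z (1 / real (Suc n))"] by auto
  then obtain d where d: "\<And>z n. d z n \<in> D" "\<And>z n. dist z (d z n) < 1 / real (Suc n)" by metis
  have lim: "(\<lambda>n. d z n) \<longlonglongrightarrow> z" for z
  proof (rule metric_LIMSEQ_I)
    fix e :: real assume "e > 0"
    then obtain N :: nat where N: "1 / real (Suc N) < e" using nat_approx_posE by blast
    show "\<exists>no. \<forall>n\<ge>no. dist (d z n) z < e"
    proof (intro exI allI impI)
      fix n assume "n \<ge> N"
      then have "1 / real (Suc n) \<le> 1 / real (Suc N)" by (intro divide_left_mono) auto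
      then show "dist (d z n) z < e" using d(2)[of z n] N by (simp add: dist_commute)
    qed
  qed
  have "(\<lambda>n. Re (quad_form S K (\<lambda>i. d (c i) n))) \<longlonglongrightarrow> Re (quad_form S K c)"
    unfolding quad_form_def by (intro tendsto_intros lim)
  moreover have "0 \<le> Re (quad_form S K (\<lambda>i. d (c i) n))" for n
  proof -
    have "quad_form S K (\<lambda>i. d (c i) n) = quad_form S K (\<lambda>i\<in>S. d (c i) n)"
      by (simp add: quad_form_def)
    then show ?thesis using nn[of "\<lambda>i\<in>S. d (c i) n"] d(1) by auto
  qed
  ultimately show ?thesis by (intro LIMSEQ_le_const) auto
qed

abbreviation basis_form :: "'w::euclidean_space \<Rightarrow> 'w \<Rightarrow> complex" where
  "basis_form i \<equiv> (\<lambda>x. complex_of_real (x \<bullet> i))"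

lemma linear_basis_form: "linear (basis_form i)"
  by (rule linearI) (simp_all add: inner_add_left scaleR_conv_of_real)

text \<open>Off-diagonal entries have no sign, so Radon-Nikodym is applied to diagonal values at
  polarisation vectors, all dominated by their sum s. This s gives the reference measure T, and
  polarisation recovers the entries.\<close>

lemma spectral_density:
  fixes \<mu> :: "'v::euclidean_space set \<Rightarrow> ('w::euclidean_space \<Rightarrow> complex) \<Rightarrow> ('w \<Rightarrow> complex) \<Rightarrow> complex"
  assumes psd: "\<And>E. E \<in> sets borel \<Longrightarrow> psd_hermitian_form (\<mu> E)"
    and cm: "\<And>l m. linear l \<Longrightarrow> linear m \<Longrightarrow> complex_measure (\<lambda>E. \<mu> E l m)"
  obtains T :: "'v measure" and m :: "'w \<Rightarrow> 'w \<Rightarrow> 'v \<Rightarrow> complex"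
  where "finite_measure T" "sets T = sets borel"
    and "\<And>i j. i \<in> Basis \<Longrightarrow> j \<in> Basis \<Longrightarrow> integrable T (m i j)"
    and "\<And>i j E. i \<in> Basis \<Longrightarrow> j \<in> Basis \<Longrightarrow> E \<in> sets borel \<Longrightarrow>
      \<mu> E (basis_form i) (basis_form j) = (LINT x|T. indicator E x * m i j x)"
    and "\<And>x. psd_kernel Basis (\<lambda>i j. m i j x)"
proof -
  let ?M = "\<lambda>i j E. \<mu> E (basis_form i) (basis_form j)"
  \<comment> \<open>Polarisation vectors: the diagonal at \<open>P1 i j\<close> contains twice the
    real part of the entry (i, j), the one at \<open>P2 i j\<close> twice its imaginary
    part.\<close>
  define P1 P2 :: "'w \<Rightarrow> 'w \<Rightarrow> 'w \<Rightarrow> complex"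
    where "P1 i j = (\<lambda>x. 1 * basis_form i x + basis_form j x)"
      and "P2 i j = (\<lambda>x. \<i> * basis_form j x + basis_form i x)" for i j
  have lP: "linear (P1 i j)" "linear (P2 i j)" for i j
    unfolding P1_def P2_def by (intro linear_complex_comb linear_basis_form)+
  define r1 r2 where "r1 i j E = Re (\<mu> E (P1 i j) (P1 i j))" and "r2 i j E = Re (\<mu> E (P2 i j) (P2 i j))" for i j E
  have add: "add_set_fun (\<lambda>E. Re (\<mu> E l l))" if "linear l" for l
    unfolding add_set_fun_def
    by (intro allI impI sums_Re cm[OF that that, unfolded complex_measure_def, rule_format])
  have addr: "add_set_fun (r1 i j)" "add_set_fun (r2 i j)" for i j
    unfolding r1_def[abs_def] r2_def[abs_def] by (intro add lP)+
  have r0: "0 \<le> r1 i j E" "0 \<le> r2 i j E" if "E \<in> sets borel" for i j E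
    unfolding r1_def r2_def by (intro psd_formD(3)[OF psd[OF that] lP(1) lP(1)] psd_formD(3)[OF psd[OF that] lP(2) lP(2)])+
  have herm: "?M j i E = cnj (?M i j E)" if "E \<in> sets borel" for i j E
    by (rule psd_formD(2)[OF psd[OF that] linear_basis_form linear_basis_form])
  have r1: "r1 i j E = Re (?M i i E) + Re (?M j j E) + 2 * Re (?M i j E)" if E: "E \<in> sets borel" for i j E
    unfolding r1_def P1_def psd_form_expand[OF psd[OF E] linear_basis_form linear_basis_form]
    using herm[OF E, of i j] by simp
  have r2: "r2 i j E = Re (?M i i E) + Re (?M j j E) + 2 * Im (?M i j E)" if E: "E \<in> sets borel" for i j E
    unfolding r2_def P2_def psd_form_expand[OF psd[OF E] linear_basis_form linear_basis_form]
    using herm[OF E, of i j] by simp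
  define s where "s E = (\<Sum>i\<in>Basis. \<Sum>j\<in>Basis. r1 i j E + r2 i j E)" for E
  have adds: "add_set_fun s" unfolding s_def[abs_def] by (intro add_set_fun_sum add_set_fun_add addr)
  have le: "r1 i j E \<le> s E \<and> r2 i j E \<le> s E" if "i \<in> Basis" "j \<in> Basis" "E \<in> sets borel" for i j E
  proof -
    have nn: "0 \<le> r1 i j E + r2 i j E" for i j using r0[OF that(3), of i j] by simp
    have "r1 i j E + r2 i j E \<le> (\<Sum>j\<in>Basis. r1 i j E + r2 i j E)"
      by (rule member_le_sum[OF that(2)]) (auto simp: nn)
    also have "\<dots> \<le> s E" unfolding s_def
      by (rule member_le_sum[OF that(1)]) (auto simp: nn intro!: sum_nonneg)
    finally show ?thesis using r0[OF that(3), of i j] by simp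
  qed
  have s0: "0 \<le> s E" if "E \<in> sets borel" for E
    unfolding s_def by (intro sum_nonneg add_nonneg_nonneg r0 that)
  define T where "T = set_fun_measure s"
  interpret FT: finite_measure T unfolding T_def by (rule finite_set_fun_measure[OF adds s0])
  have sets [measurable_cong]: "sets T = sets borel" by (simp add: T_def)
  have dens: "\<exists>D. integrable T D \<and> (\<forall>E\<in>sets borel. r E = (LINT x|T. indicator E x * D x))"
    if r: "add_set_fun r" "\<And>E. E \<in> sets borel \<Longrightarrow> 0 \<le> r E" "\<And>E. E \<in> sets borel \<Longrightarrow> r E \<le> s E" for r
  proof -
    obtain D where "integrable (set_fun_measure s) D"
      "\<And>E. E \<in> sets borel \<Longrightarrow> r E = (LINT x|set_fun_measure s. indicator E x * D x)"
      using density_of_dominated_set_fun[OF r(1,2) adds r(3)] by metis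
    then show ?thesis unfolding T_def by (intro exI[of _ D]) auto
  qed
  obtain D1 where D1: "\<And>i j. i \<in> Basis \<Longrightarrow> j \<in> Basis \<Longrightarrow> integrable T (D1 i j)"
    "\<And>i j E. i \<in> Basis \<Longrightarrow> j \<in> Basis \<Longrightarrow> E \<in> sets borel \<Longrightarrow> r1 i j E = (LINT x|T. indicator E x * D1 i j x)"
    using dens[OF addr(1) r0(1)] le by metis
  obtain D2 where D2: "\<And>i j. i \<in> Basis \<Longrightarrow> j \<in> Basis \<Longrightarrow> integrable T (D2 i j)"
    "\<And>i j E. i \<in> Basis \<Longrightarrow> j \<in> Basis \<Longrightarrow> E \<in> sets borel \<Longrightarrow> r2 i j E = (LINT x|T. indicator E x * D2 i j x)"
    using dens[OF addr(2) r0(2)] le by metis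
  have iE: "integrable T (\<lambda>x. indicator E x * f x)" if "E \<in> sets borel" "integrable T f" for E and f :: "'v \<Rightarrow> real"
    using integrable_mult_indicator[of E T f] that sets by simp
  have iEc: "integrable T (\<lambda>x. indicator E x * f x)" if "E \<in> sets borel" "integrable T f" for E and f :: "'v \<Rightarrow> complex"
  proof -
    have "(\<lambda>x. indicator E x * f x) = (\<lambda>x. indicator E x *\<^sub>R f x)" by (auto split: split_indicator)
    then show ?thesis using integrable_mult_indicator[of E T f] that sets by simp
  qed
  \<comment> \<open>\<open>P1 i i\<close> is twice the i-th form, so \<open>D1 i i\<close> is the
    density of four times the diagonal entry; hence the quarters.\<close>
  define a b where "a i j x = (D1 i j x - D1 i i x / 4 - D1 j j x / 4) / 2"
    and "b i j x = (D2 i j x - D1 i i x / 4 - D1 j j x / 4) / 2" for i j x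
  have iab: "integrable T (a i j)" "integrable T (b i j)" if "i \<in> Basis" "j \<in> Basis" for i j
    unfolding a_def[abs_def] b_def[abs_def] using D1(1) D2(1) that by auto
  have Iab: "(LINT x|T. indicator E x * a i j x) = Re (?M i j E)" "(LINT x|T. indicator E x * b i j x) = Im (?M i j E)"
    if ij: "i \<in> Basis" "j \<in> Basis" and E: "E \<in> sets borel" for i j E
  proof -
    have "(LINT x|T. indicator E x * a i j x) =
      (LINT x|T. (indicator E x * D1 i j x - indicator E x * D1 i i x / 4 - indicator E x * D1 j j x / 4) / 2)"
      by (rule lint_cong) (simp add: a_def algebra_simps)
    also have "\<dots> = (r1 i j E - r1 i i E / 4 - r1 j j E / 4) / 2"
      by (simp add: iE[OF E] D1 ij E)
    finally show "(LINT x|T. indicator E x * a i j x) = Re (?M i j E)" by (simp add: r1[OF E])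
    have "(LINT x|T. indicator E x * b i j x) =
      (LINT x|T. (indicator E x * D2 i j x - indicator E x * D1 i i x / 4 - indicator E x * D1 j j x / 4) / 2)"
      by (rule lint_cong) (simp add: b_def algebra_simps)
    also have "\<dots> = (r2 i j E - r1 i i E / 4 - r1 j j E / 4) / 2"
      by (simp add: iE[OF E] D1 D2 ij E)
    finally show "(LINT x|T. indicator E x * b i j x) = Im (?M i j E)" by (simp add: r1[OF E] r2[OF E])
  qed
  \<comment> \<open>The symmetrisation makes the matrix Hermitian at every point; integrals over
    sets are unchanged because \<mu> is Hermitian on each of them.\<close>
  define m1 where "m1 i j x = Complex ((a i j x + a j i x) / 2) ((b i j x - b j i x) / 2)" for i j x
  have m1_alt: "m1 i j = (\<lambda>x. complex_of_real ((a i j x + a j i x) / 2) + \<i> * complex_of_real ((b i j x - b j i x) / 2))" for i j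
    by (auto simp: m1_def complex_eq_iff)
  have im1: "integrable T (m1 i j)" if "i \<in> Basis" "j \<in> Basis" for i j
    unfolding m1_alt using iab that by (intro Bochner_Integration.integrable_add integrable_mult_right integrable_of_real) auto
  have Im1: "(LINT x|T. indicator E x * m1 i j x) = ?M i j E" if ij: "i \<in> Basis" "j \<in> Basis" and E: "E \<in> sets borel" for i j E
  proof (rule complex_eqI)
    have "Re (LINT x|T. indicator E x * m1 i j x) = (LINT x|T. (indicator E x * a i j x + indicator E x * a j i x) / 2)"
      unfolding integral_Re[OF iEc[OF E im1[OF ij]], symmetric]
      by (rule lint_cong) (simp add: m1_def split: split_indicator)
    also have "\<dots> = Re (?M i j E)" using herm[OF E, of i j] by (simp add: iE[OF E] iab ij Iab E)
    finally show "Re (LINT x|T. indicator E x * m1 i j x) = Re (?M i j E)" .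
    have "Im (LINT x|T. indicator E x * m1 i j x) = (LINT x|T. (indicator E x * b i j x - indicator E x * b j i x) / 2)"
      unfolding integral_Im[OF iEc[OF E im1[OF ij]], symmetric]
      by (rule lint_cong) (simp add: m1_def split: split_indicator)
    also have "\<dots> = Im (?M i j E)" using herm[OF E, of i j] by (simp add: iE[OF E] iab ij Iab E)
    finally show "Im (LINT x|T. indicator E x * m1 i j x) = Im (?M i j E)" .
  qed
  obtain D :: "complex set" where D: "countable D" "\<And>X. open X \<Longrightarrow> X \<noteq> {} \<Longrightarrow> \<exists>d\<in>D. d \<in> X"
    using countable_dense_setE by blast
  let ?Q = "\<lambda>c x. quad_form Basis (\<lambda>i j. m1 i j x) c"
  have iQ: "integrable T (?Q c)" for c
    unfolding quad_form_def by (intro Bochner_Integration.integrable_sum integrable_mult_right im1) auto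
  have "AE x in T. 0 \<le> Re (?Q c x)" for c
  proof (rule FT.density_nonneg)
    show "integrable T (\<lambda>x. Re (?Q c x))" using iQ by auto
    fix E assume "E \<in> sets T"
    then have E: "E \<in> sets borel" by (simp add: sets)
    have "(LINT x:E|T. Re (?Q c x)) = (LINT x|T. Re (indicator E x * ?Q c x))"
      unfolding set_lebesgue_integral_def
      by (rule lint_cong) (simp split: split_indicator)
    also have "\<dots> = Re (LINT x|T. indicator E x * ?Q c x)"
      by (rule integral_Re[OF iEc[OF E iQ]])
    also have "(LINT x|T. indicator E x * ?Q c x) = (LINT x|T. (\<Sum>i\<in>Basis. \<Sum>j\<in>Basis. c i * cnj (c j) * (indicator E x * m1 i j x)))"
      by (rule lint_cong) (simp add: quad_form_def sum_distrib_left mult_ac)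
    also have "\<dots> = (\<Sum>i\<in>Basis. \<Sum>j\<in>Basis. c i * cnj (c j) * ?M i j E)"
      by (simp add: Bochner_Integration.integral_sum iEc[OF E] im1 Im1 E)
    also have "\<dots> = \<mu> E (\<lambda>x. \<Sum>i\<in>Basis. c i * basis_form i x) (\<lambda>x. \<Sum>i\<in>Basis. c i * basis_form i x)"
      by (rule psd_form_sum(2)[OF psd[OF E] linear_basis_form finite_Basis, symmetric])
    also have "0 \<le> Re \<dots>"
      by (rule psd_formD(3)[OF psd[OF E]]; rule psd_form_sum(1)[OF psd[OF E] linear_basis_form finite_Basis])
    finally show "0 \<le> (LINT x:E|T. Re (?Q c x))" .
  qed
  moreover have "countable ((Basis :: 'w set) \<rightarrow>\<^sub>E D)" by (rule countable_PiE) (auto intro: D)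
  ultimately have "AE x in T. \<forall>c\<in>(Basis :: 'w set) \<rightarrow>\<^sub>E D. 0 \<le> Re (?Q c x)"
    by (subst AE_ball_countable) auto
  then obtain N where N: "{x \<in> space T. \<not> (\<forall>c\<in>(Basis :: 'w set) \<rightarrow>\<^sub>E D. 0 \<le> Re (?Q c x))} \<subseteq> N"
    "emeasure T N = 0" "N \<in> sets T"
    by (rule AE_E)
  have N0: "AE x in T. x \<notin> N" using N(2,3) by (intro AE_not_in) (simp add: null_sets_def)
  \<comment> \<open>\<open>m1\<close> is positive semidefinite almost everywhere only\<close>
  define m where "m i j x = (if x \<in> N then 0 else m1 i j x)" for i j x
  have mm1: "AE x in T. m i j x = m1 i j x" for i j
    using N0 by eventually_elim (simp add: m_def)
  have m_meas: "m i j \<in> borel_measurable T" if "i \<in> Basis" "j \<in> Basis" for i j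
    unfolding m_def[abs_def] using N(3) im1[OF that] by (intro measurable_If_set) auto
  show ?thesis
  proof (rule that[of T m])
    show "finite_measure T" by (rule FT.finite_measure_axioms)
    show "sets T = sets borel" by (rule sets)
    show "integrable T (m i j)" if "i \<in> Basis" "j \<in> Basis" for i j
      using integrable_cong_AE[OF m_meas[OF that] _ mm1] im1[OF that] by auto
    show "?M i j E = (LINT x|T. indicator E x * m i j x)" if ij: "i \<in> Basis" "j \<in> Basis" "E \<in> sets borel" for i j E
      unfolding Im1[OF ij, symmetric]
    proof (rule integral_cong_AE)
      show "AE x in T. indicator E x * m1 i j x = indicator E x * m i j x"
        using mm1[of i j] by eventually_elim simp
      show "(\<lambda>x. indicator E x * m i j x) \<in> borel_measurable T"
        using m_meas[OF ij(1,2)] ij(3) sets by auto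
    qed (use iEc[OF ij(3) im1[OF ij(1,2)]] in auto)
    show "psd_kernel Basis (\<lambda>i j. m i j x)" for x
      unfolding psd_kernel_def
    proof (intro conjI ballI allI)
      show "m j i x = cnj (m i j x)" for i j
        by (simp add: m_def m1_def complex_eq_iff add.commute minus_divide_left)
      fix c :: "'w \<Rightarrow> complex"
      show "0 \<le> Re (quad_form Basis (\<lambda>i j. m i j x) c)"
      proof (cases "x \<in> N")
        case True
        then show ?thesis by (simp add: m_def quad_form_def)
      next
        case False
        have "0 \<le> Re (?Q c x)"
          by (rule Re_quad_form_nonneg_dense[OF finite_Basis D(2)])
             (use False N(1) sets_eq_imp_space_eq[OF sets] in auto)
        then show ?thesis using False by (simp add: m_def)
      qed
    qed
  qed
qed

section \<open>Variance of a smeared field\<close>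

lemma integrable_product:
  fixes f :: "'a \<Rightarrow> real" and g :: "'b \<Rightarrow> real"
  assumes "sigma_finite_measure M" "sigma_finite_measure N" and f: "integrable M f" and g: "integrable N g"
  shows "integrable (M \<Otimes>\<^sub>M N) (\<lambda>(x, y). f x * g y)"
    and "(LINT p|(M \<Otimes>\<^sub>M N). f (fst p) * g (snd p)) = integral\<^sup>L M f * integral\<^sup>L N g"
proof -
  interpret pair_sigma_finite M N by (rule pair_sigma_finite.intro) fact+
  have [measurable]: "f \<in> borel_measurable M" "g \<in> borel_measurable N" using f g by auto
  have i: "integrable (M \<Otimes>\<^sub>M N) (\<lambda>p. f (fst p) * g (snd p))"
  proof (rule Fubini_integrable)
    show "integrable M (\<lambda>x. LINT y|N. norm (f (fst (x, y)) * g (snd (x, y))))"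
      using f by (simp add: abs_mult)
    show "AE x in M. integrable N (\<lambda>y. f (fst (x, y)) * g (snd (x, y)))" using g by simp
  qed measurable
  then show "integrable (M \<Otimes>\<^sub>M N) (\<lambda>(x, y). f x * g y)" by (simp add: case_prod_unfold)
  show "(LINT p|(M \<Otimes>\<^sub>M N). f (fst p) * g (snd p)) = integral\<^sup>L M f * integral\<^sup>L N g"
    using integral_fst'[OF i] by simp
qed

text \<open>Every application of Fubini rests on bounds uniform in the points: all A v share the
  second moment \<rho>(0), which controls the absolute first moment and absolute products.\<close>

lemma (in prob_space) second_moment_smeared_field:
  fixes A :: "'v::euclidean_space \<Rightarrow> 'a \<Rightarrow> real" and f :: "'v \<Rightarrow> real"
  assumes A [measurable]: "(\<lambda>(v, s). A v s) \<in> borel_measurable (borel \<Otimes>\<^sub>M M)"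
    and A2: "\<And>u v. integrable M (\<lambda>s. A u s * A v s)"
    and mean: "\<And>v. expectation (A v) = 0"
    and cov: "\<And>u v. expectation (\<lambda>s. A u s * A v s) = \<rho> (u - v)"
    and f: "integrable lborel f"
  shows "expectation (\<lambda>s. LINT v|lborel. f v * A v s) = 0"
    and "expectation (\<lambda>s. (LINT v|lborel. f v * A v s)\<^sup>2) =
      (LINT p|(lborel \<Otimes>\<^sub>M lborel). f (fst p) * f (snd p) * \<rho> (fst p - snd p))"
proof -
  have [measurable]: "f \<in> borel_measurable borel" using f by auto
  have Am: "(\<lambda>(v, s). A v s) \<in> borel_measurable (lborel \<Otimes>\<^sub>M M)" by measurable
  have Av [measurable]: "A v \<in> borel_measurable M" for v
    using measurable_compose[OF measurable_Pair1'[of v borel M] A] by simp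
  have A2': "integrable M (\<lambda>s. (A v s)\<^sup>2)" for v using A2[of v v] by (simp add: power2_eq_square)
  define K where "K = \<rho> 0"
  have K: "expectation (\<lambda>s. (A v s)\<^sup>2) = K" for v using cov[of v v] by (simp add: K_def power2_eq_square)
  have K0: "K \<ge> 0" unfolding K[of 0, symmetric] by simp
  have absle: "expectation (\<lambda>s. \<bar>A u s * A v s\<bar>) \<le> K" for u v
  proof -
    have "expectation (\<lambda>s. \<bar>A u s * A v s\<bar>) \<le> expectation (\<lambda>s. ((A u s)\<^sup>2 + (A v s)\<^sup>2) / 2)"
    proof (rule integral_mono)
      show "\<bar>A u s * A v s\<bar> \<le> ((A u s)\<^sup>2 + (A v s)\<^sup>2) / 2" for s
        using zero_le_power2[of "\<bar>A u s\<bar> - \<bar>A v s\<bar>"] by (simp add: power2_diff abs_mult)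
    qed (use A2 A2' in auto)
    then show ?thesis by (simp add: A2' K)
  qed
  have A1: "integrable M (A v)" for v
    using square_integrable_imp_integrable[OF Av A2'] .
  have absle1: "expectation (\<lambda>s. \<bar>A v s\<bar>) \<le> 1 + K" for v
  proof -
    have "expectation (\<lambda>s. \<bar>A v s\<bar>) \<le> expectation (\<lambda>s. 1 + (A v s)\<^sup>2)"
    proof (rule integral_mono)
      show "\<bar>A v s\<bar> \<le> 1 + (A v s)\<^sup>2" for s
        using zero_le_power2[of "\<bar>A v s\<bar> - 1"] by (simp add: power2_diff)
    qed (use A1 A2' in auto)
    then show ?thesis by (simp add: A2' K prob_space)
  qed
  interpret L: pair_sigma_finite "lborel :: 'v measure" M
    by (rule pair_sigma_finite.intro) (auto intro: sigma_finite_lborel sigma_finite_measure_axioms)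
  have i1: "integrable (lborel \<Otimes>\<^sub>M M) (\<lambda>(v, s). f v * A v s)"
  proof (rule L.Fubini_integrable)
    show "integrable lborel (\<lambda>v. LINT s|M. norm (case (v, s) of (v, s) \<Rightarrow> f v * A v s))"
    proof (rule integrable_dominated)
      show "integrable lborel (\<lambda>v. f v * (1 + K))" using f by simp
      show "AE v in lborel. norm (LINT s|M. norm (case (v, s) of (v, s) \<Rightarrow> f v * A v s)) \<le> norm (f v * (1 + K))"
        using absle1 K0 by (auto simp: abs_mult intro!: mult_left_mono)
    qed measurable
    show "AE v in lborel. integrable M (\<lambda>s. case (v, s) of (v, s) \<Rightarrow> f v * A v s)"
      using A1 by simp
  qed measurable
  show "expectation (\<lambda>s. LINT v|lborel. f v * A v s) = 0"
    using L.Fubini_integral[OF i1] by (simp add: mean)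
  define LL where "LL = (lborel \<Otimes>\<^sub>M lborel :: ('v \<times> 'v) measure)"
  have sLL [measurable_cong]: "sets LL = sets (borel \<Otimes>\<^sub>M borel)" by (auto simp: LL_def intro: sets_pair_measure_cong)
  have sfLL: "sigma_finite_measure LL"
    unfolding LL_def using sigma_finite_lborel lborel_pair.sigma_finite_measure_axioms by metis
  interpret P: pair_sigma_finite LL M
    by (rule pair_sigma_finite.intro) (auto intro: sfLL sigma_finite_measure_axioms)
  have ff: "integrable LL (\<lambda>(u, v). f u * f v)"
    unfolding LL_def by (rule integrable_product) (auto intro: sigma_finite_lborel f)
  let ?G = "\<lambda>p s. (f (fst p) * A (fst p) s) * (f (snd p) * A (snd p) s)"
  have Ap: "(\<lambda>z. A (h (fst z)) (snd z)) \<in> borel_measurable (LL \<Otimes>\<^sub>M M)" if "h \<in> LL \<rightarrow>\<^sub>M borel" for h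
    using measurable_compose[OF measurable_Pair[OF measurable_compose[OF measurable_fst that] measurable_snd] A] by simp
  have [measurable]: "(\<lambda>(p, s). A (fst p) s) \<in> borel_measurable (LL \<Otimes>\<^sub>M M)"
    "(\<lambda>(p, s). A (snd p) s) \<in> borel_measurable (LL \<Otimes>\<^sub>M M)"
    using Ap[of fst] Ap[of snd] by (simp_all add: case_prod_unfold)
  have Gm [measurable]: "(\<lambda>(p, s). ?G p s) \<in> borel_measurable (LL \<Otimes>\<^sub>M M)" by measurable
  have iG: "integrable (LL \<Otimes>\<^sub>M M) (\<lambda>(p, s). ?G p s)"
  proof (rule P.Fubini_integrable)
    show "integrable LL (\<lambda>p. LINT s|M. norm (case (p, s) of (p, s) \<Rightarrow> ?G p s))" (is "integrable _ ?n")
    proof (rule integrable_dominated)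
      show "integrable LL (\<lambda>p. (case p of (u, v) \<Rightarrow> f u * f v) * K)" using ff by simp
      show "AE p in LL. norm (?n p) \<le> norm ((case p of (u, v) \<Rightarrow> f u * f v) * K)"
      proof (rule AE_I2)
        fix p
        have e: "norm (case (p, s) of (p, s) \<Rightarrow> ?G p s) = \<bar>f (fst p) * f (snd p)\<bar> * \<bar>A (fst p) s * A (snd p) s\<bar>" for s
          by (simp add: abs_mult)
        show "norm (?n p) \<le> norm ((case p of (u, v) \<Rightarrow> f u * f v) * K)"
          unfolding e using absle[of "fst p" "snd p"] K0
          by (simp add: case_prod_beta abs_mult mult_left_mono)
      qed
    qed measurable
    show "AE p in LL. integrable M (\<lambda>s. case (p, s) of (p, s) \<Rightarrow> ?G p s)"
    proof (rule AE_I2)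
      fix p
      have "(\<lambda>s. ?G p s) = (\<lambda>s. (f (fst p) * f (snd p)) * (A (fst p) s * A (snd p) s))" by (auto simp: mult_ac)
      then show "integrable M (\<lambda>s. case (p, s) of (p, s) \<Rightarrow> ?G p s)"
        using A2[of "fst p" "snd p"] by simp
    qed
  qed measurable
  have "expectation (\<lambda>s. (LINT v|lborel. f v * A v s)\<^sup>2) = expectation (\<lambda>s. LINT p|LL. ?G p s)"
  proof (rule integral_cong_AE)
    \<comment> \<open>For almost every s the path is integrable against f, and then the square of
      its integral is a double integral over pairs of points.\<close>
    show "AE s in M. (LINT v|lborel. f v * A v s)\<^sup>2 = (LINT p|LL. ?G p s)"
      using L.AE_integrable_snd[OF i1]
    proof eventually_elim
      case (elim s)
      have "(LINT p|LL. (\<lambda>v. f v * A v s) (fst p) * (\<lambda>v. f v * A v s) (snd p)) =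
         (LINT v|lborel. f v * A v s) * (LINT v|lborel. f v * A v s)"
        unfolding LL_def by (rule integrable_product) (use elim in \<open>auto intro: sigma_finite_lborel\<close>)
      then show ?case by (simp add: power2_eq_square)
    qed
    have s: "(\<lambda>(s, v). A v s) \<in> borel_measurable (M \<Otimes>\<^sub>M lborel)"
      using measurable_pair_swap[OF Am] by (simp add: case_prod_beta)
    show "(\<lambda>s. (LINT v|lborel. f v * A v s)\<^sup>2) \<in> borel_measurable M"
      using s by measurable
    have "(\<lambda>(s, p). ?G p s) \<in> borel_measurable (M \<Otimes>\<^sub>M LL)"
      using measurable_pair_swap[OF Gm] by (simp add: case_prod_beta)
    then show "(\<lambda>s. LINT p|LL. ?G p s) \<in> borel_measurable M"
      using sfLL by (intro sigma_finite_measure.borel_measurable_lebesgue_integral) auto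
  qed
  also have "\<dots> = (LINT p|LL. expectation (\<lambda>s. ?G p s))"
    by (rule P.Fubini_integral[OF iG])
  also have "\<dots> = (LINT p|LL. f (fst p) * f (snd p) * \<rho> (fst p - snd p))"
  proof (rule lint_cong)
    fix p
    have "(\<lambda>s. ?G p s) = (\<lambda>s. (f (fst p) * f (snd p)) * (A (fst p) s * A (snd p) s))" by (auto simp: mult_ac)
    then show "expectation (\<lambda>s. ?G p s) = f (fst p) * f (snd p) * \<rho> (fst p - snd p)"
      by (simp add: cov)
  qed
  finally show "expectation (\<lambda>s. (LINT v|lborel. f v * A v s)\<^sup>2) =
      (LINT p|(lborel \<Otimes>\<^sub>M lborel). f (fst p) * f (snd p) * \<rho> (fst p - snd p))"
    by (simp add: LL_def)
qed

section \<open>Power spectra of integrable functions\<close>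

lemma fourier_integrable:
  fixes f :: "'v::euclidean_space \<Rightarrow> real"
  assumes "integrable lborel f"
  shows "integrable lborel (\<lambda>v. complex_of_real (f v) * exp (- 2 * \<i> * pi * (\<xi> \<bullet> v)))"
proof (rule integrable_dominated)
  show "integrable lborel f" by fact
  have [measurable]: "f \<in> borel_measurable borel" using assms by auto
  show "(\<lambda>v. complex_of_real (f v) * exp (- 2 * \<i> * pi * (\<xi> \<bullet> v))) \<in> borel_measurable lborel"
    by measurable
qed (simp add: norm_mult)

lemma power_spectrum_eq:
  fixes f :: "'v::euclidean_space \<Rightarrow> real"
  assumes "integrable lborel f"
  shows "power_spectrum f \<xi> = (LINT v|lborel. f v * cos (2 * pi * (\<xi> \<bullet> v)))\<^sup>2 + (LINT v|lborel. f v * sin (2 * pi * (\<xi> \<bullet> v)))\<^sup>2"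
proof -
  have e: "exp (- 2 * \<i> * pi * (\<xi> \<bullet> v)) = Complex (cos (2 * pi * (\<xi> \<bullet> v))) (- sin (2 * pi * (\<xi> \<bullet> v)))" for v
    using exp_Euler[of "- (2 * pi * (\<xi> \<bullet> v))"] by (simp add: complex_eq_iff Re_exp Im_exp)
  have "Re (fourier f \<xi>) = (LINT v|lborel. f v * cos (2 * pi * (\<xi> \<bullet> v)))"
    using integral_Re[OF fourier_integrable[OF assms], of \<xi>] unfolding fourier_def[of f \<xi>] e by simp
  moreover have "Im (fourier f \<xi>) = - (LINT v|lborel. f v * sin (2 * pi * (\<xi> \<bullet> v)))"
    using integral_Im[OF fourier_integrable[OF assms], of \<xi>] unfolding fourier_def[of f \<xi>] e by simp
  ultimately show ?thesis by (simp add: power_spectrum_def cmod_power2)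
qed

text \<open>After exchanging integrals, the addition formula for the cosine of a difference splits
  the double integral over (u, v) into the squares of a cosine and a sine integral, whose sum is the
  power spectrum.\<close>

lemma double_integral_power_spectrum:
  fixes f :: "'v::euclidean_space \<Rightarrow> real" and \<nu> :: "'v measure"
  assumes f: "integrable lborel f" and \<nu>: "finite_measure \<nu>" "sets \<nu> = sets borel"
  shows "(LINT p|(lborel \<Otimes>\<^sub>M lborel). f (fst p) * f (snd p) * (LINT \<xi>|\<nu>. cos (2 * pi * (\<xi> \<bullet> (fst p - snd p))))) =
    (LINT \<xi>|\<nu>. power_spectrum f \<xi>)"
proof -
  interpret N: finite_measure \<nu> by fact
  note [measurable_cong] = \<nu>(2)
  have [measurable]: "f \<in> borel_measurable borel" using f by auto
  define LL where "LL = (lborel \<Otimes>\<^sub>M lborel :: ('v \<times> 'v) measure)"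
  have sLL [measurable_cong]: "sets LL = sets (borel \<Otimes>\<^sub>M borel)" by (auto simp: LL_def intro: sets_pair_measure_cong)
  have sfLL: "sigma_finite_measure LL"
    unfolding LL_def using sigma_finite_lborel lborel_pair.sigma_finite_measure_axioms by metis
  interpret P: pair_sigma_finite LL \<nu>
    by (rule pair_sigma_finite.intro) (auto intro: sfLL N.sigma_finite_measure_axioms)
  have ff: "integrable LL (\<lambda>(u, v). f u * f v)"
    unfolding LL_def by (rule integrable_product) (auto intro: sigma_finite_lborel f)
  let ?H = "\<lambda>p \<xi>. f (fst p) * f (snd p) * cos (2 * pi * (\<xi> \<bullet> (fst p - snd p)))"
  have iH: "integrable (LL \<Otimes>\<^sub>M \<nu>) (\<lambda>(p, \<xi>). ?H p \<xi>)"
  proof (rule integrable_dominated)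
    show "integrable (LL \<Otimes>\<^sub>M \<nu>) (\<lambda>(p, \<xi>). (case p of (u, v) \<Rightarrow> f u * f v) * 1)"
      by (rule integrable_product[OF sfLL N.sigma_finite_measure_axioms ff]) simp
    show "AE x in LL \<Otimes>\<^sub>M \<nu>. norm (case x of (p, \<xi>) \<Rightarrow> ?H p \<xi>) \<le> norm (case x of (p, \<xi>) \<Rightarrow> (case p of (u, v) \<Rightarrow> f u * f v) * 1)"
      by (intro AE_I2) (auto simp: abs_mult intro!: mult_left_le)
  qed measurable
  have c: "integrable lborel (\<lambda>v. f v * cos (2 * pi * (\<xi> \<bullet> v)))" for \<xi>
    by (rule integrable_dominated[OF f]) (auto simp: abs_mult intro!: mult_left_le)
  have s: "integrable lborel (\<lambda>v. f v * sin (2 * pi * (\<xi> \<bullet> v)))" for \<xi>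
    by (rule integrable_dominated[OF f]) (auto simp: abs_mult intro!: mult_left_le)
  have "(LINT p|LL. f (fst p) * f (snd p) * (LINT \<xi>|\<nu>. cos (2 * pi * (\<xi> \<bullet> (fst p - snd p))))) =
    (LINT p|LL. LINT \<xi>|\<nu>. ?H p \<xi>)" by simp
  also have "\<dots> = (LINT \<xi>|\<nu>. LINT p|LL. ?H p \<xi>)"
    by (rule P.Fubini_integral[OF iH, symmetric])
  also have "\<dots> = (LINT \<xi>|\<nu>. power_spectrum f \<xi>)"
  proof (rule lint_cong)
    fix \<xi>
    let ?c = "\<lambda>v. f v * cos (2 * pi * (\<xi> \<bullet> v))" and ?s = "\<lambda>v. f v * sin (2 * pi * (\<xi> \<bullet> v))"
    have "?H p \<xi> = ?c (fst p) * ?c (snd p) + ?s (fst p) * ?s (snd p)" for p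
      by (simp add: inner_diff_right right_diff_distrib cos_diff) (simp add: algebra_simps)
    then have "(LINT p|LL. ?H p \<xi>) = (LINT p|LL. ?c (fst p) * ?c (snd p) + ?s (fst p) * ?s (snd p))" by simp
    also have "\<dots> = (LINT p|LL. ?c (fst p) * ?c (snd p)) + (LINT p|LL. ?s (fst p) * ?s (snd p))"
      using integrable_product(1)[OF sigma_finite_lborel sigma_finite_lborel c c, of \<xi> \<xi>]
        integrable_product(1)[OF sigma_finite_lborel sigma_finite_lborel s s, of \<xi> \<xi>]
      by (intro Bochner_Integration.integral_add) (simp_all add: LL_def case_prod_unfold)
    also have "\<dots> = power_spectrum f \<xi>"
      unfolding power_spectrum_eq[OF f] LL_def power2_eq_square
      by (intro arg_cong2[of _ _ _ _ "(+)"] integrable_product sigma_finite_lborel c s)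
    finally show "(LINT p|LL. ?H p \<xi>) = power_spectrum f \<xi>" .
  qed
  finally show ?thesis by (simp add: LL_def)
qed

lemma integral_lborel_scale:
  fixes F :: "'v::euclidean_space \<Rightarrow> 'b::{banach, second_countable_topology}"
  assumes "r > 0" "F \<in> borel_measurable borel"
  shows "(LINT v|lborel. F v) = r ^ DIM('v) *\<^sub>R (LINT v|lborel. F (r *\<^sub>R v))"
proof -
  have "(LINT v|lborel. F v) = (LINT v|density (distr lborel borel (\<lambda>x. 0 + r *\<^sub>R x)) (\<lambda>_. ennreal (\<bar>r\<bar> ^ DIM('v))). F v)"
    using lborel_affine[of r "0::'v"] assms(1) by simp
  also have "\<dots> = (LINT v|distr lborel borel (\<lambda>x. 0 + r *\<^sub>R x). (\<bar>r\<bar> ^ DIM('v)) *\<^sub>R F v)"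
    using assms by (intro integral_density) auto
  also have "\<dots> = (LINT v|lborel. (\<bar>r\<bar> ^ DIM('v)) *\<^sub>R F (0 + r *\<^sub>R v))"
    using assms(2) by (intro integral_distr) auto
  finally show ?thesis using assms(1) by simp
qed

lemma integrable_lborel_scale:
  fixes \<phi> :: "'v::euclidean_space \<Rightarrow> real"
  assumes "r > 0" "integrable lborel \<phi>"
  shows "integrable lborel (\<lambda>v. \<phi> (v /\<^sub>R r))"
proof -
  have [measurable]: "\<phi> \<in> borel_measurable borel" using assms by auto
  have "integrable (density (distr lborel borel (\<lambda>x. 0 + r *\<^sub>R x)) (\<lambda>_. ennreal (\<bar>r\<bar> ^ DIM('v)))) (\<lambda>v. \<phi> (v /\<^sub>R r))"
    using assms by (subst integrable_density) (auto simp: integrable_distr_eq)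
  then show ?thesis using lborel_affine[of r "0::'v"] assms(1) by simp
qed

lemma power_spectrum_scale:
  fixes \<phi> :: "'v::euclidean_space \<Rightarrow> real"
  assumes "r > 0" "integrable lborel \<phi>"
  shows "power_spectrum (\<lambda>v. \<phi> (v /\<^sub>R r)) \<xi> = (r ^ DIM('v))\<^sup>2 * power_spectrum \<phi> (r *\<^sub>R \<xi>)"
proof -
  have [measurable]: "\<phi> \<in> borel_measurable borel" using assms by auto
  have "fourier (\<lambda>v. \<phi> (v /\<^sub>R r)) \<xi> = r ^ DIM('v) *\<^sub>R fourier \<phi> (r *\<^sub>R \<xi>)"
    unfolding fourier_def
    by (subst integral_lborel_scale[OF assms(1)], measurable) (use assms(1) in simp)
  then show ?thesis using assms(1) by (simp add: power_spectrum_def power_mult_distrib)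
qed

text \<open>Dominated convergence with majorant |\<phi>|. Besides measurability this supplies the
  continuity at the origin on which the degenerate case of the upper bound depends.\<close>

lemma isCont_power_spectrum:
  fixes \<phi> :: "'v::euclidean_space \<Rightarrow> real"
  assumes "integrable lborel \<phi>"
  shows "isCont (power_spectrum \<phi>) x"
proof -
  have [measurable]: "\<phi> \<in> borel_measurable borel" using assms by auto
  have "isCont (fourier \<phi>) x"
    unfolding isCont_def tendsto_at_iff_sequentially comp_def
  proof (intro allI impI)
    fix X :: "nat \<Rightarrow> 'v" assume X: "\<forall>i. X i \<in> UNIV - {x}" "X \<longlonglongrightarrow> x"
    show "(\<lambda>n. fourier \<phi> (X n)) \<longlonglongrightarrow> fourier \<phi> x"
      unfolding fourier_def
    proof (rule integral_dominated_convergence[where w="\<lambda>v. \<bar>\<phi> v\<bar>"])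
      show "AE v in lborel. (\<lambda>n. complex_of_real (\<phi> v) * exp (- 2 * \<i> * pi * (X n \<bullet> v))) \<longlonglongrightarrow>
          complex_of_real (\<phi> v) * exp (- 2 * \<i> * pi * (x \<bullet> v))"
        by (intro AE_I2 tendsto_intros X)
    qed (use assms in \<open>auto simp: norm_mult\<close>)
  qed
  then show ?thesis unfolding power_spectrum_def[abs_def] by (intro continuous_intros)
qed

lemma power_spectrum_le:
  fixes \<phi> :: "'v::euclidean_space \<Rightarrow> real"
  assumes "integrable lborel \<phi>"
  shows "power_spectrum \<phi> x \<le> (LINT v|lborel. \<bar>\<phi> v\<bar>)\<^sup>2"
proof -
  have "cmod (fourier \<phi> x) \<le> (LINT v|lborel. cmod (complex_of_real (\<phi> v) * exp (- 2 * \<i> * pi * (x \<bullet> v))))"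
    unfolding fourier_def by (rule integral_norm_bound)
  also have "\<dots> = (LINT v|lborel. \<bar>\<phi> v\<bar>)" by (simp add: norm_mult)
  finally show ?thesis unfolding power_spectrum_def by (intro power_mono) auto
qed

lemma variance_smeared_field:
  fixes A :: "'v::euclidean_space \<Rightarrow> 'a \<Rightarrow> real" and \<phi> :: "'v \<Rightarrow> real"
  assumes M: "prob_space M" and A: "(\<lambda>(v, s). A v s) \<in> borel_measurable (borel \<Otimes>\<^sub>M M)"
    and A2: "\<And>u v. integrable M (\<lambda>s. A u s * A v s)"
    and mean: "\<And>v. (LINT s|M. A v s) = 0"
    and cov: "\<And>u v. (LINT s|M. A u s * A v s) = c * (LINT \<xi>|\<nu>. cos (2 * pi * (\<xi> \<bullet> (u - v))))"
    and \<nu>: "finite_measure \<nu>" "sets \<nu> = sets borel"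
    and \<phi>: "integrable lborel \<phi>" and r: "r > 0"
  shows "prob_space.variance M (\<lambda>s. r powr (- real DIM('v) / 2) * (LINT v|lborel. \<phi> (v /\<^sub>R r) * A v s)) =
    c * (LINT \<xi>|\<nu>. r ^ DIM('v) * power_spectrum \<phi> (r *\<^sub>R \<xi>))"
proof -
  interpret prob_space M by fact
  let ?f = "\<lambda>v. \<phi> (v /\<^sub>R r)" and ?k = "r powr (- real DIM('v) / 2)"
  have f: "integrable lborel ?f" by (rule integrable_lborel_scale[OF r \<phi>])
  note sm = second_moment_smeared_field[OF A A2 mean cov f]
  have "variance (\<lambda>s. ?k * (LINT v|lborel. ?f v * A v s)) = ?k\<^sup>2 * expectation (\<lambda>s. (LINT v|lborel. ?f v * A v s)\<^sup>2)"
    by (simp add: sm(1) power_mult_distrib)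
  also have "expectation (\<lambda>s. (LINT v|lborel. ?f v * A v s)\<^sup>2) = c * (LINT \<xi>|\<nu>. power_spectrum ?f \<xi>)"
    unfolding sm(2) double_integral_power_spectrum[OF f \<nu>, symmetric] by (simp add: mult.left_commute)
  also have "\<dots> = c * ((r ^ DIM('v))\<^sup>2 * (LINT \<xi>|\<nu>. power_spectrum \<phi> (r *\<^sub>R \<xi>)))"
    by (simp add: power_spectrum_scale[OF r \<phi>])
  \<comment> \<open>The squared normalisation is \<open>r^-d\<close> and the dilation of \<phi>
    contributes \<open>r^(2d)\<close>, which leaves the factor \<open>r^d\<close>.\<close>
  also have "?k\<^sup>2 = 1 / r ^ DIM('v)"
  proof -
    have "?k\<^sup>2 = r powr (- real DIM('v))"
      using r by (simp add: power2_eq_square powr_add[symmetric])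
    then show ?thesis using r by (simp add: powr_minus powr_realpow inverse_eq_divide)
  qed
  finally show ?thesis using r by (simp add: power2_eq_square)
qed

section \<open>Convolution powers of the spectral measure\<close>

text \<open>With all factors given by densities against the same T, the convolution is the image
  under addition of the product density on n copies of T. Each further factor adds one coordinate,
  and Fubini reorders the integrals.\<close>

lemma complex_measure_convs_density:
  fixes T :: "'v::euclidean_space measure" and \<nu> :: "nat \<Rightarrow> 'v set \<Rightarrow> complex"
  assumes T: "finite_measure T" "sets T = sets borel"
    and m: "\<And>k. k < n \<Longrightarrow> integrable T (m k)"
    and \<nu>: "\<And>k E. k < n \<Longrightarrow> E \<in> sets borel \<Longrightarrow> \<nu> k E = (LINT x|T. indicator E x * m k x)"
    and E: "E \<in> sets borel"
  shows "complex_measure_convs n \<nu> E =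
    (LINT x|Pi\<^sub>M {..<n} (\<lambda>_. T). indicator E (\<Sum>k<n. x k) * (\<Prod>k<n. m k (x k)))"
  using m \<nu> E
proof (induction n arbitrary: E)
  case 0
  then show ?case by (simp add: PiM_empty lebesgue_integral_count_space_finite)
next
  case (Suc n)
  interpret finite_measure T by fact
  interpret F: product_sigma_finite "\<lambda>_::nat. T" by unfold_locales
  let ?P = "Pi\<^sub>M {..<n} (\<lambda>_. T)"
  interpret FP: finite_product_sigma_finite "\<lambda>_::nat. T" "{..<n}" by unfold_locales simp
  note [measurable_cong] = T(2)
  have E [measurable]: "E \<in> sets borel" by fact
  define F where "F x = (\<Prod>k<n. m k (x k))" for x
  have iF: "integrable ?P F" unfolding F_def by (rule F.product_integrable_prod) (use Suc.prems(1) in auto)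
  have mn: "integrable T (m n)" by (rule Suc.prems(1)) simp
  have [measurable]: "F \<in> borel_measurable ?P" "m n \<in> borel_measurable T" using iF mn by auto
  have cS: "(\<lambda>x. x k) \<in> ?P \<rightarrow>\<^sub>M borel" if "k < n" for k
    using measurable_component_singleton[of k "{..<n}" "\<lambda>_. T"] that T(2) by (simp cong: measurable_cong_sets)
  have S [measurable]: "(\<lambda>x. \<Sum>k<n. x k) \<in> ?P \<rightarrow>\<^sub>M borel"
    by (rule borel_measurable_sum) (use cS in auto)
  have IH: "complex_measure_convs n \<nu> G = (LINT x|?P. indicator G (\<Sum>k<n. x k) * F x)" if "G \<in> sets borel" for G
    unfolding F_def by (rule Suc.IH) (use Suc.prems that in auto)
  let ?H = "\<lambda>x y. indicator E ((\<Sum>k<n. x k) + y) * (F x * m n y)"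
  interpret PT: pair_sigma_finite ?P T
    by (rule pair_sigma_finite.intro) (auto intro: FP.sigma_finite_measure_axioms sigma_finite_measure_axioms)
  have iH: "integrable (?P \<Otimes>\<^sub>M T) (\<lambda>(x, y). ?H x y)"
  proof (rule integrable_dominated)
    show "integrable (?P \<Otimes>\<^sub>M T) (\<lambda>(x, y). cmod (F x) * cmod (m n y))"
      by (rule integrable_product[OF FP.sigma_finite_measure_axioms sigma_finite_measure_axioms integrable_norm[OF iF] integrable_norm[OF mn]])
  qed (auto simp: norm_mult split: split_indicator)
  define h where "h y = (LINT x|?P. indicator E ((\<Sum>k<n. x k) + y) * F x)" for y
  have hm: "h \<in> borel_measurable T"
    unfolding h_def[abs_def] by (rule FP.borel_measurable_lebesgue_integral) measurable
  \<comment> \<open>The shifted convolution h is bounded, as integration against a complex measure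
    through its density requires.\<close>
  have hb: "cmod (h y) \<le> (LINT x|?P. cmod (F x))" for y
  proof -
    have "cmod (h y) \<le> (LINT x|?P. cmod (indicator E ((\<Sum>k<n. x k) + y) * F x))"
      unfolding h_def by (rule integral_norm_bound)
    also have "\<dots> \<le> (LINT x|?P. cmod (F x))"
      by (rule integral_mono') (use iF in \<open>auto simp: norm_mult split: split_indicator\<close>)
    finally show ?thesis .
  qed
  have hc: "complex_measure_convs n \<nu> {x. x + y \<in> E} = h y" for y
  proof -
    have "(\<lambda>x. x + y) -` E \<inter> space borel \<in> sets borel" by (rule measurable_sets[OF _ E]) simp
    then have "{x. x + y \<in> E} \<in> sets borel" by (simp add: vimage_def)
    from IH[OF this] show ?thesis by (simp add: h_def indicator_def)
  qed
  have "complex_measure_convs (Suc n) \<nu> E = complex_measure_integral (\<nu> n) h"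
    by (simp add: complex_measure_conv_def hc)
  also have "\<dots> = (LINT y|T. h y * m n y)"
    by (rule complex_measure_integral_density(2)[OF T(2) mn _ hm hb]) (use Suc.prems in auto)
  also have "\<dots> = (LINT y|T. LINT x|?P. ?H x y)"
    by (rule lint_cong) (simp add: h_def mult.assoc flip: integral_mult_left_zero)
  also have "\<dots> = (LINT x|?P. LINT y|T. ?H x y)"
    by (rule PT.Fubini_integral[OF iH])
  also have "\<dots> = (LINT x|?P. LINT y|T. indicator E (\<Sum>k<Suc n. (x(n := y)) k) * (\<Prod>k<Suc n. m k ((x(n := y)) k)))"
    by (simp add: F_def)
  also have "\<dots> = (LINT x|Pi\<^sub>M (insert n {..<n}) (\<lambda>_. T). indicator E (\<Sum>k<Suc n. x k) * (\<Prod>k<Suc n. m k (x k)))"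
  proof (rule F.product_integral_insert[symmetric])
    have i: "integrable (Pi\<^sub>M {..<Suc n} (\<lambda>_. T)) (\<lambda>x. \<Prod>k<Suc n. m k (x k))"
      by (rule F.product_integrable_prod) (use Suc.prems(1) in auto)
    have "(\<lambda>x. x k) \<in> Pi\<^sub>M {..<Suc n} (\<lambda>_. T) \<rightarrow>\<^sub>M borel" if "k < Suc n" for k
      using measurable_component_singleton[of k "{..<Suc n}" "\<lambda>_. T"] that T(2) by (simp cong: measurable_cong_sets)
    then have [measurable]: "(\<lambda>x. \<Sum>k<Suc n. x k) \<in> Pi\<^sub>M {..<Suc n} (\<lambda>_. T) \<rightarrow>\<^sub>M borel"
      by (intro borel_measurable_sum) auto
    have [measurable]: "(\<lambda>x. \<Prod>k<Suc n. m k (x k)) \<in> borel_measurable (Pi\<^sub>M {..<Suc n} (\<lambda>_. T))"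
      using i by auto
    have "integrable (Pi\<^sub>M {..<Suc n} (\<lambda>_. T)) (\<lambda>x. indicator E (\<Sum>k<Suc n. x k) * (\<Prod>k<Suc n. m k (x k)))"
    proof (rule integrable_dominated[OF i])
      show "(\<lambda>x. indicator E (\<Sum>k<Suc n. x k) * (\<Prod>k<Suc n. m k (x k))) \<in> borel_measurable (Pi\<^sub>M {..<Suc n} (\<lambda>_. T))"
        by measurable
    qed (auto simp: norm_mult split: split_indicator)
    then show "integrable (Pi\<^sub>M (insert n {..<n}) (\<lambda>_. T)) (\<lambda>x. indicator E (\<Sum>k<Suc n. x k) * (\<Prod>k<Suc n. m k (x k)))"
      by (simp only: lessThan_Suc)
  qed auto
  finally show ?case by (simp only: lessThan_Suc)
qed

text \<open>On q copies of T, let \<Psi> be the quadratic form at g of the tensor product of the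
  matrices at x 0, ..., x (q-1). It is real and non-negative at every point, and \<nu> is the image
  of this density under addition. Since the character of a sum is a product, its Fourier transform
  is the contraction of products of covariances.\<close>

lemma spectral_conv_at_fourier:
  fixes \<Omega> :: "'v::euclidean_space \<Rightarrow> ('w::euclidean_space \<Rightarrow> real) \<Rightarrow> ('w \<Rightarrow> real) \<Rightarrow> real"
    and \<mu> :: "'v set \<Rightarrow> ('w \<Rightarrow> complex) \<Rightarrow> ('w \<Rightarrow> complex) \<Rightarrow> complex"
    and q :: nat and g :: "(nat \<Rightarrow> 'w) \<Rightarrow> real"
  assumes spec: "is_spectral_measure \<Omega> \<mu>"
  defines "\<nu> \<equiv> spectral_conv_at \<mu> q g"
  shows "finite_measure \<nu>" and "sets \<nu> = sets borel"
    and "(\<Sum>I\<in>multi_indices q. \<Sum>J\<in>multi_indices q. g I * g J *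
      (\<Prod>k<q. \<Omega> v (\<lambda>x. x \<bullet> I k) (\<lambda>x. x \<bullet> J k))) = (LINT \<xi>|\<nu>. cos (2 * pi * (\<xi> \<bullet> v)))" (is "?\<Sigma> = _")
proof -
  have psd: "\<And>E. E \<in> sets borel \<Longrightarrow> psd_hermitian_form (\<mu> E)"
    and cm: "\<And>l m. linear l \<Longrightarrow> linear m \<Longrightarrow> complex_measure (\<lambda>E. \<mu> E l m)"
    and four: "\<And>v l m. linear l \<Longrightarrow> linear m \<Longrightarrow> complex_of_real (\<Omega> v l m) =
        complex_measure_integral (\<lambda>E. \<mu> E (\<lambda>x. complex_of_real (l x)) (\<lambda>x. complex_of_real (m x)))
          (\<lambda>\<xi>. exp (2 * \<i> * pi * (\<xi> \<bullet> v)))"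
    using spec unfolding is_spectral_measure_def by blast+
  obtain T :: "'v measure" and m :: "'w \<Rightarrow> 'w \<Rightarrow> 'v \<Rightarrow> complex"
    where T: "finite_measure T" "sets T = sets borel"
      and im: "\<And>i j. i \<in> Basis \<Longrightarrow> j \<in> Basis \<Longrightarrow> integrable T (m i j)"
      and M: "\<And>i j E. i \<in> Basis \<Longrightarrow> j \<in> Basis \<Longrightarrow> E \<in> sets borel \<Longrightarrow>
        \<mu> E (basis_form i) (basis_form j) = (LINT x|T. indicator E x * m i j x)"
      and pk: "\<And>x. psd_kernel Basis (\<lambda>i j. m i j x)"
  proof (rule spectral_density[of \<mu>], goal_cases)
    case (3 T m)
    show ?case by (rule 3(1)[of T m]) (fact 3(2-))+
  qed (erule psd, erule (1) cm)
  interpret finite_measure T by fact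
  let ?I = "multi_indices q :: (nat \<Rightarrow> 'w) set"
  interpret F: product_sigma_finite "\<lambda>_::nat. T" by unfold_locales
  note [measurable_cong] = T(2)
  define P where "P = Pi\<^sub>M {..<q} (\<lambda>_. T)"
  have cS: "(\<lambda>x. x k) \<in> P \<rightarrow>\<^sub>M borel" if "k < q" for k
    using measurable_component_singleton[of k "{..<q}" "\<lambda>_. T"] that T(2) by (simp add: P_def cong: measurable_cong_sets)
  define S where "S x = (\<Sum>k<q. x k)" for x :: "nat \<Rightarrow> 'v"
  have S [measurable]: "S \<in> P \<rightarrow>\<^sub>M borel"
    unfolding S_def[abs_def] by (rule borel_measurable_sum) (use cS in auto)
  have basis: "I k \<in> Basis" if "I \<in> ?I" "k < q" for I :: "nat \<Rightarrow> 'w" and k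
    using that by (auto simp: multi_indices_def)
  define R where "R I J x = (\<Prod>k<q. m (I k) (J k) (x k))" for I J and x :: "nat \<Rightarrow> 'v"
  have iR: "integrable P (R I J)" if "I \<in> ?I" "J \<in> ?I" for I J
    unfolding P_def R_def by (rule F.product_integrable_prod) (use im basis that in auto)
  define \<Psi> where "\<Psi> x = (\<Sum>I\<in>?I. \<Sum>J\<in>?I. complex_of_real (g I * g J) * R I J x)" for x
  have i\<Psi>: "integrable P \<Psi>"
    unfolding \<Psi>_def by (intro Bochner_Integration.integrable_sum integrable_mult_right iR)
  have \<Psi>: "Im (\<Psi> x) = 0" "0 \<le> Re (\<Psi> x)" for x
    unfolding \<Psi>_def R_def
    using tensor_psd_kernel[of q "\<lambda>k i j. m i j (x k)" "\<lambda>I. complex_of_real (g I)"] pk by auto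
  have [measurable]: "\<Psi> \<in> borel_measurable P" using i\<Psi> by auto
  have bnd: "integrable P (\<lambda>x. F x * f x)" if "F \<in> borel_measurable P" "\<And>x. cmod (F x) \<le> 1" "integrable P f" for F f
  proof (rule integrable_dominated[OF that(3)])
    show "(\<lambda>x. F x * f x) \<in> borel_measurable P" using that by auto
    show "AE x in P. norm (F x * f x) \<le> norm (f x)"
      using that(2) by (intro AE_I2) (auto simp: norm_mult intro: mult_left_le_one_le)
  qed
  have sum_int: "(LINT x|P. F x * \<Psi> x) = (\<Sum>I\<in>?I. \<Sum>J\<in>?I.
      complex_of_real (g I * g J) * (LINT x|P. F x * R I J x))"
    if "F \<in> borel_measurable P" "\<And>x. cmod (F x) \<le> 1" for F
  proof -
    have "(LINT x|P. F x * \<Psi> x) = (LINT x|P. (\<Sum>I\<in>?I. \<Sum>J\<in>?I.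
      complex_of_real (g I * g J) * (F x * R I J x)))"
      by (simp add: \<Psi>_def sum_distrib_left mult_ac)
    also have "\<dots> = (\<Sum>I\<in>?I. \<Sum>J\<in>?I.
      complex_of_real (g I * g J) * (LINT x|P. F x * R I J x))"
      using bnd[OF that iR] by (simp add: Bochner_Integration.integral_sum)
    finally show ?thesis .
  qed
  have indm: "(\<lambda>x. indicator E (S x) :: complex) \<in> borel_measurable P" if E: "E \<in> sets borel" for E
    using E by measurable
  have conv: "spectral_conv \<mu> q E (\<lambda>w. complex_of_real (g w)) (\<lambda>w. complex_of_real (g w)) =
      (LINT x|P. indicator E (S x) * \<Psi> x)" if E: "E \<in> sets borel" for E
  proof -
    have "complex_measure_convs q (\<lambda>k G. \<mu> G (basis_form (I k)) (basis_form (J k))) E =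
       (LINT x|P. indicator E (S x) * R I J x)" if "I \<in> ?I" "J \<in> ?I" for I J
      unfolding P_def S_def R_def
      by (rule complex_measure_convs_density[OF T _ _ E]) (use im M basis that in auto)
    moreover have "(LINT x|P. indicator E (S x) * \<Psi> x) = (\<Sum>I\<in>?I. \<Sum>J\<in>?I.
      complex_of_real (g I * g J) * (LINT x|P. indicator E (S x) * R I J x))"
      by (rule sum_int[OF indm[OF E]]) (simp split: split_indicator)
    ultimately show ?thesis unfolding spectral_conv_def by simp
  qed
  define N where "N = distr (density P (\<lambda>x. ennreal (Re (\<Psi> x)))) borel S"
  have iRe: "integrable P (\<lambda>x. Re (\<Psi> x))" using i\<Psi> by auto
  have em: "emeasure N E = ennreal (Re (spectral_conv \<mu> q E (\<lambda>w. complex_of_real (g w)) (\<lambda>w. complex_of_real (g w))))"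
    if E: "E \<in> sets borel" for E
  proof -
    have ii: "integrable P (\<lambda>x. indicator E (S x) * \<Psi> x)"
      by (rule bnd[OF indm[OF E] _ i\<Psi>]) (simp split: split_indicator)
    have ii': "integrable P (\<lambda>x. Re (indicator E (S x) * \<Psi> x))" by (rule integrable_Re[OF ii])
    have "emeasure N E = emeasure (density P (\<lambda>x. ennreal (Re (\<Psi> x)))) (S -` E \<inter> space P)"
      unfolding N_def using E by (subst emeasure_distr) auto
    also have "\<dots> = (\<integral>\<^sup>+x. ennreal (Re (\<Psi> x)) * indicator (S -` E \<inter> space P) x \<partial>P)"
      using E by (intro emeasure_density) auto
    also have "\<dots> = (\<integral>\<^sup>+x. ennreal (Re (indicator E (S x) * \<Psi> x)) \<partial>P)"
      by (intro nn_integral_cong) (auto split: split_indicator)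
    also have "\<dots> = ennreal (LINT x|P. Re (indicator E (S x) * \<Psi> x))"
      by (rule nn_integral_eq_integral[OF ii']) (auto simp: \<Psi>(2) split: split_indicator)
    also have "(LINT x|P. Re (indicator E (S x) * \<Psi> x)) = Re (LINT x|P. indicator E (S x) * \<Psi> x)"
      by (rule integral_Re[OF ii])
    finally show ?thesis unfolding conv[OF E] .
  qed
  have ss: "sigma_sets UNIV (sets borel) = sets (borel :: 'v measure)"
    using sets.sigma_sets_eq[of "borel :: 'v measure"] by simp
  \<comment> \<open>\<open>measure_of\<close> has the intended values only for a set function that
    is a measure; N provides this.\<close>
  have "\<nu> = measure_of UNIV (sets borel) (emeasure N)"
    unfolding \<nu>_def spectral_conv_at_def by (rule measure_of_eq) (auto simp: ss em)
  also have "\<dots> = N"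
    using measure_of_of_measure[of N] by (simp add: N_def)
  finally have \<nu>N: "\<nu> = N" .
  show "sets \<nu> = sets borel" by (simp add: \<nu>N N_def)
  show "finite_measure \<nu>"
    by (rule finite_measureI) (simp add: \<nu>N N_def em[unfolded N_def])
  have ex: "exp (2 * \<i> * pi * (\<xi> \<bullet> v)) = cis (2 * pi * (\<xi> \<bullet> v))" for \<xi> :: 'v
    by (simp add: cis_conv_exp mult_ac)
  have cis_m: "(\<lambda>\<xi>. cis (2 * pi * (\<xi> \<bullet> v))) \<in> borel_measurable borel"
    unfolding ex[symmetric] by measurable
  have \<Omega>: "complex_of_real (\<Omega> v (\<lambda>x. x \<bullet> i) (\<lambda>x. x \<bullet> j)) = (LINT \<xi>|T. cis (2 * pi * (\<xi> \<bullet> v)) * m i j \<xi>)"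
    and i\<Omega>: "integrable T (\<lambda>\<xi>. cis (2 * pi * (\<xi> \<bullet> v)) * m i j \<xi>)"
    if ij: "i \<in> Basis" "j \<in> Basis" for i j
  proof -
    have cm': "(\<lambda>\<xi>. cis (2 * pi * (\<xi> \<bullet> v))) \<in> borel_measurable T" using cis_m by measurable
    note cmi = complex_measure_integral_density[OF T(2) im[OF ij] M[OF ij] cm', of 1]
    show "integrable T (\<lambda>\<xi>. cis (2 * pi * (\<xi> \<bullet> v)) * m i j \<xi>)" by (rule cmi(1)) auto
    have "complex_measure_integral (\<lambda>E. \<mu> E (basis_form i) (basis_form j)) (\<lambda>\<xi>. cis (2 * pi * (\<xi> \<bullet> v))) =
      (LINT \<xi>|T. cis (2 * pi * (\<xi> \<bullet> v)) * m i j \<xi>)" by (rule cmi(2)) auto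
    then show "complex_of_real (\<Omega> v (\<lambda>x. x \<bullet> i) (\<lambda>x. x \<bullet> j)) = (LINT \<xi>|T. cis (2 * pi * (\<xi> \<bullet> v)) * m i j \<xi>)"
      using four[OF linear_inner_form linear_inner_form, of v i j] by (simp only: ex)
  qed
  let ?c = "\<lambda>x. cis (2 * pi * (S x \<bullet> v))"
  have cP: "?c \<in> borel_measurable P" by (rule measurable_compose[OF S cis_m])
  have prod: "complex_of_real (\<Prod>k<q. \<Omega> v (\<lambda>x. x \<bullet> I k) (\<lambda>x. x \<bullet> J k)) = (LINT x|P. ?c x * R I J x)"
    if IJ: "I \<in> ?I" "J \<in> ?I" for I J
  proof -
    have "complex_of_real (\<Prod>k<q. \<Omega> v (\<lambda>x. x \<bullet> I k) (\<lambda>x. x \<bullet> J k)) =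
      (\<Prod>k<q. LINT \<xi>|T. cis (2 * pi * (\<xi> \<bullet> v)) * m (I k) (J k) \<xi>)"
      unfolding of_real_prod by (intro prod.cong refl \<Omega> basis IJ) auto
    also have "\<dots> = (LINT x|P. (\<Prod>k<q. cis (2 * pi * (x k \<bullet> v)) * m (I k) (J k) (x k)))"
      unfolding P_def by (rule F.product_integral_prod[symmetric]) (auto intro!: i\<Omega> basis IJ)
    also have "\<dots> = (LINT x|P. ?c x * R I J x)"
    proof (rule lint_cong)
      fix x :: "nat \<Rightarrow> 'v"
      have "(\<Prod>k<n. cis (2 * pi * (x k \<bullet> v))) = cis (2 * pi * ((\<Sum>k<n. x k) \<bullet> v))" for n
        by (induction n) (simp_all add: cis_mult inner_add_left distrib_left)
      then show "(\<Prod>k<q. cis (2 * pi * (x k \<bullet> v)) * m (I k) (J k) (x k)) = ?c x * R I J x"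
        by (simp add: prod.distrib R_def S_def)
    qed
    finally show ?thesis .
  qed
  have eq: "complex_of_real ?\<Sigma> = (LINT x|P. ?c x * \<Psi> x)"
    by (subst sum_int[OF cP]) (auto simp: prod[symmetric])
  have "?\<Sigma> = Re (LINT x|P. ?c x * \<Psi> x)"
    unfolding eq[symmetric] Re_complex_of_real ..
  also have "\<dots> = (LINT x|P. Re (?c x * \<Psi> x))"
    by (rule integral_Re[symmetric, OF bnd[OF cP _ i\<Psi>]]) simp
  \<comment> \<open>As \<Psi> is real, taking real parts leaves only the cosine of the
    character.\<close>
  also have "\<dots> = (LINT x|P. Re (\<Psi> x) *\<^sub>R cos (2 * pi * (S x \<bullet> v)))"
    by (rule lint_cong) (simp add: \<Psi>(1) mult.commute)
  also have "\<dots> = (LINT x|density P (\<lambda>x. ennreal (Re (\<Psi> x))). cos (2 * pi * (S x \<bullet> v)))"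
    by (rule integral_density[symmetric]) (auto simp: \<Psi>(2))
  also have "\<dots> = (LINT \<xi>|\<nu>. cos (2 * pi * (\<xi> \<bullet> v)))"
    unfolding \<nu>N N_def by (rule integral_distr[symmetric]) auto
  finally show "?\<Sigma> = (LINT \<xi>|\<nu>. cos (2 * pi * (\<xi> \<bullet> v)))" .
qed

section \<open>Scaled integrals and densities at the origin\<close>

text \<open>A set closed under passing to smaller norms is determined by the supremum R of its
  norms; whether R is attained separates closed from open balls.\<close>

lemma radial_level_set:
  fixes A :: "'v::euclidean_space set"
  assumes down: "\<And>x y. x \<in> A \<Longrightarrow> norm y \<le> norm x \<Longrightarrow> y \<in> A"
  obtains "A = {}" | "A = UNIV" | R where "R > 0" "A = ball 0 R" | R where "R \<ge> 0" "A = cball 0 R"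
proof (cases "A = {} \<or> A = UNIV")
  case True
  then show ?thesis using that(1,2) by auto
next
  case False
  then obtain z where z: "z \<notin> A" by auto
  have lt: "norm x < norm z" if "x \<in> A" for x using down[OF that, of z] z by force
  define R where "R = Sup (norm ` A)"
  have bdd: "bdd_above (norm ` A)" using lt by (intro bdd_aboveI[of _ "norm z"]) (auto intro: less_imp_le)
  have ne: "norm ` A \<noteq> {}" using False by auto
  have le: "norm x \<le> R" if "x \<in> A" for x unfolding R_def using bdd that by (intro cSup_upper) auto
  have in_lt: "y \<in> A" if "norm y < R" for y
  proof -
    have "\<exists>r\<in>norm ` A. norm y < r"
      using that less_cSup_iff[OF ne bdd, of "norm y"] unfolding R_def by blast
    then obtain x where "x \<in> A" "norm y < norm x" by auto
    then show ?thesis using down[of x y] by simp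
  qed
  show ?thesis
  proof (cases "\<exists>x\<in>A. norm x = R")
    case True
    then obtain x where x: "x \<in> A" "norm x = R" by auto
    have "A = cball 0 R" using le down[OF x(1)] x(2) by auto
    then show ?thesis using x(2) by (intro that(4)) auto
  next
    case nR: False
    have *: "A = ball 0 R"
    proof (intro equalityI subsetI)
      fix x assume x: "x \<in> A"
      then have "norm x \<noteq> R" using nR by blast
      with le[OF x] show "x \<in> ball 0 R" by simp
    next
      fix x :: 'v assume "x \<in> ball 0 R"
      then show "x \<in> A" by (intro in_lt) simp
    qed
    then have "R > 0" using False by (metis ball_eq_empty not_le)
    then show ?thesis using * by (rule that(3))
  qed
qed

lemma borel_measurable_radial:
  fixes h :: "'v::euclidean_space \<Rightarrow> real"
  assumes "\<And>x y. norm x \<le> norm y \<Longrightarrow> h y \<le> h x"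
  shows "h \<in> borel_measurable borel"
  unfolding borel_measurable_iff_greater
proof
  fix a
  show "{w \<in> space borel. a < h w} \<in> sets borel"
    by (rule radial_level_set[of "{w. a < h w}"]) (use assms in \<open>force+\<close>)
qed

lemma nn_integral_layer_cake:
  assumes "sigma_finite_measure N" and f [measurable]: "f \<in> borel_measurable N" and "\<And>x. f x \<ge> 0"
  shows "(\<integral>\<^sup>+x. ennreal (f x) \<partial>N) = (\<integral>\<^sup>+t. indicator {0..} t * emeasure N {x \<in> space N. t < f x} \<partial>lborel)"
proof -
  interpret pair_sigma_finite lborel N
    by (rule pair_sigma_finite.intro) (use assms(1) in \<open>auto intro: sigma_finite_lborel\<close>)
  let ?F = "\<lambda>t x. indicator {0..} t * indicator {x \<in> space N. t < f x} x :: ennreal"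
  have [measurable]: "(\<lambda>(t, x). ?F t x) \<in> borel_measurable (lborel \<Otimes>\<^sub>M N)"
  proof -
    have "(\<lambda>p. indicator {p \<in> space (lborel \<Otimes>\<^sub>M N). 0 \<le> fst p \<and> fst p < f (snd p)} p :: ennreal)
        \<in> borel_measurable (lborel \<Otimes>\<^sub>M N)" by measurable
    then show ?thesis
      by (rule measurable_cong[THEN iffD1, rotated]) (auto simp: space_pair_measure split: split_indicator)
  qed
  have "(\<integral>\<^sup>+t. ?F t x \<partial>lborel) = ennreal (f x)" if "x \<in> space N" for x
  proof -
    have "(\<integral>\<^sup>+t. ?F t x \<partial>lborel) = (\<integral>\<^sup>+t. indicator {0..<f x} t \<partial>lborel)"
      using that by (intro nn_integral_cong) (auto split: split_indicator)
    then show ?thesis using assms(3)[of x] by simp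
  qed
  then have "(\<integral>\<^sup>+x. ennreal (f x) \<partial>N) = (\<integral>\<^sup>+x. \<integral>\<^sup>+t. ?F t x \<partial>lborel \<partial>N)"
    by (intro nn_integral_cong) simp
  also have "\<dots> = (\<integral>\<^sup>+t. \<integral>\<^sup>+x. ?F t x \<partial>N \<partial>lborel)"
    by (rule Fubini') measurable
  also have "\<dots> = (\<integral>\<^sup>+t. indicator {0..} t * emeasure N {x \<in> space N. t < f x} \<partial>lborel)"
    by (intro nn_integral_cong) (simp add: nn_integral_cmult)
  finally show ?thesis .
qed

text \<open>The level sets of \<open>h\<close> are balls, so the layer cake formula reduces the comparison to balls.\<close>

lemma nn_integral_radial_mono:
  fixes \<alpha> \<beta> :: "'v::euclidean_space measure" and h :: "'v \<Rightarrow> real" and a b :: ennreal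
  assumes \<alpha>: "sigma_finite_measure \<alpha>" "sets \<alpha> = sets borel" and \<beta>: "sigma_finite_measure \<beta>" "sets \<beta> = sets borel"
    and h: "\<And>x y. norm x \<le> norm y \<Longrightarrow> h y \<le> h x" "\<And>x. h x \<ge> 0"
    and le: "\<And>R. 0 < R \<Longrightarrow> R \<le> L \<Longrightarrow> a * emeasure \<alpha> (ball 0 R) \<le> b * emeasure \<beta> (ball 0 R)"
    and L: "L > 0" and fin: "b < \<infinity>" "emeasure \<beta> (ball 0 L) < \<infinity>"
  shows "a * (\<integral>\<^sup>+x. ennreal (h x) * indicator (ball 0 L) x \<partial>\<alpha>) \<le> b * (\<integral>\<^sup>+x. ennreal (h x) * indicator (ball 0 L) x \<partial>\<beta>)"
proof -
  have [measurable]: "h \<in> borel_measurable borel" by (rule borel_measurable_radial) fact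
  note [measurable_cong] = \<alpha>(2) \<beta>(2)
  have sp: "space \<alpha> = UNIV" "space \<beta> = UNIV" using sets_eq_imp_space_eq[OF \<alpha>(2)] sets_eq_imp_space_eq[OF \<beta>(2)] by auto
  define f where "f x = h x * indicator (ball 0 L) x" for x
  have f0: "f x \<ge> 0" for x using h(2) by (simp add: f_def)
  have fm: "f \<in> borel_measurable borel"
    unfolding f_def by (intro borel_measurable_times borel_measurable_indicator) auto
  have fh: "ennreal (h x) * indicator (ball 0 L) x = ennreal (f x)" for x
    by (auto simp: f_def split: split_indicator)
  \<comment> \<open>Level sets can be closed balls, while the hypothesis is about open ones. Radii
    decreasing to R and staying at most L give the closed case by continuity from above, where
    finiteness of \<beta> on the large ball enters.\<close>
  have cball_le: "a * emeasure \<alpha> (cball 0 R) \<le> b * emeasure \<beta> (cball 0 R)" if R: "0 \<le> R" "R < L" for R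
  proof -
    define r where "r n = R + (L - R) / real (Suc n)" for n
    have r: "R < r n" "r n \<le> L" for n
    proof -
      show "R < r n" using R by (simp add: r_def)
      have "(L - R) / real (Suc n) \<le> (L - R) / 1" using R by (intro divide_left_mono) auto
      then show "r n \<le> L" by (simp add: r_def)
    qed
    have lim: "r \<longlonglongrightarrow> R"
      unfolding r_def using LIMSEQ_inverse_real_of_nat[THEN tendsto_mult_left, of "L - R", THEN tendsto_add[OF tendsto_const[of R]]]
      by (simp add: divide_inverse)
    have int: "(\<Inter>n. ball 0 (r n)) = (cball 0 R :: 'v set)"
    proof (intro equalityI subsetI)
      fix x :: 'v assume "x \<in> (\<Inter>n. ball 0 (r n))"
      then have "norm x \<le> r n" for n by (auto intro: less_imp_le)
      then show "x \<in> cball 0 R" using LIMSEQ_le_const[OF lim, of "norm x"] by auto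
    qed (use r(1) in \<open>auto intro: le_less_trans\<close>)
    have dec: "decseq (\<lambda>n. ball 0 (r n) :: 'v set)"
      unfolding decseq_def r_def using R by (auto intro!: subset_ball add_left_mono divide_left_mono)
    have "(\<lambda>n. emeasure \<beta> (ball 0 (r n))) \<longlonglongrightarrow> emeasure \<beta> (\<Inter>n. ball 0 (r n))"
    proof (rule Lim_emeasure_decseq[OF _ dec])
      fix n
      have "emeasure \<beta> (ball 0 (r n)) \<le> emeasure \<beta> (ball 0 L)"
        using r(2)[of n] by (intro emeasure_mono subset_ball) auto
      then show "emeasure \<beta> (ball 0 (r n)) \<noteq> \<infinity>" using fin(2) by (auto simp: top_unique)
    qed auto
    then have "(\<lambda>n. b * emeasure \<beta> (ball 0 (r n))) \<longlonglongrightarrow> b * emeasure \<beta> (cball 0 R)"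
      unfolding int using fin(1) by (intro ennreal_tendsto_cmult) auto
    moreover have "a * emeasure \<alpha> (cball 0 R) \<le> b * emeasure \<beta> (ball 0 (r n))" for n
    proof -
      have "a * emeasure \<alpha> (cball 0 R) \<le> a * emeasure \<alpha> (ball 0 (r n))"
        using r(1)[of n] by (intro mult_left_mono emeasure_mono) auto
      also have "\<dots> \<le> b * emeasure \<beta> (ball 0 (r n))" using r[of n] R by (intro le) auto
      finally show ?thesis .
    qed
    ultimately show ?thesis by (intro LIMSEQ_le_const) auto
  qed
  have lev: "a * emeasure \<alpha> {x. t < f x} \<le> b * emeasure \<beta> {x. t < f x}" if "t \<ge> 0" for t
  proof -
    have eq: "{x. t < f x} = {x. t < h x} \<inter> ball 0 L"
      using that by (auto simp: f_def split: split_indicator_asm)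
    have bl: "ball 0 R \<inter> ball 0 L = (ball 0 (min R L) :: 'v set)" for R by auto
    \<comment> \<open>Closed balls of radius at least L are cut down to the open ball of radius L,
      so \<open>cball_le\<close> is needed for R < L only.\<close>
    have cl: "cball 0 R \<inter> ball 0 L = (if R < L then cball 0 R else ball 0 L :: 'v set)" for R by auto
    show ?thesis
      by (rule radial_level_set[of "{x. t < h x}"])
         (use h(1) L le cball_le in \<open>fastforce simp: eq bl cl\<close>)+
  qed
  have *: "(\<integral>\<^sup>+x. ennreal (h x) * indicator (ball 0 L) x \<partial>N) =
     (\<integral>\<^sup>+t. indicator {0..} t * emeasure N {x. t < f x} \<partial>lborel)"
    if N: "sigma_finite_measure N" "sets N = sets borel" for N
  proof -
    have "f \<in> borel_measurable N" using fm measurable_cong_sets[OF N(2) refl] by blast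
    then show ?thesis
      using nn_integral_layer_cake[OF N(1) _ f0] sets_eq_imp_space_eq[OF N(2)] by (simp add: fh)
  qed
  have meas: "(\<lambda>t. emeasure N {x. t < f x}) \<in> borel_measurable lborel" if "sets N = sets borel" for N
  proof -
    have sN: "space N = UNIV" using sets_eq_imp_space_eq[OF that] by simp
    have fN: "f \<in> borel_measurable N" using fm measurable_cong_sets[OF that refl] by blast
    have "(\<lambda>t. emeasure N {x. t < f x}) \<in> borel_measurable borel"
    proof (rule borel_measurableI_greater)
      fix y :: ennreal
      \<comment> \<open>The mass of a level set decreases in t, so superlevel sets are intervals and
        hence Borel.\<close>
      have "is_interval {t. y < emeasure N {x. t < f x}}"
        unfolding is_interval_1
      proof safe
        fix s t u :: real assume *: "y < emeasure N {x. t < f x}" "u \<le> t"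
        have "{x. u < f x} = {x \<in> space N. u < f x}" by (simp add: sN)
        also have "\<dots> \<in> sets N" using fN by measurable
        finally have "emeasure N {x. t < f x} \<le> emeasure N {x. u < f x}"
          using *(2) by (intro emeasure_mono) auto
        with *(1) show "y < emeasure N {x. u < f x}" by (rule less_le_trans)
      qed
      then show "{t \<in> space borel. y < emeasure N {x. t < f x}} \<in> sets borel"
        using real_interval_borel_measurable by simp
    qed
    then show ?thesis by simp
  qed
  have [measurable]: "(\<lambda>t. emeasure \<alpha> {x. t < f x}) \<in> borel_measurable lborel" "(\<lambda>t. emeasure \<beta> {x. t < f x}) \<in> borel_measurable lborel"
    using meas \<alpha>(2) \<beta>(2) by auto
  have "a * (\<integral>\<^sup>+x. ennreal (h x) * indicator (ball 0 L) x \<partial>\<alpha>) = (\<integral>\<^sup>+t. a * (indicator {0..} t * emeasure \<alpha> {x. t < f x}) \<partial>lborel)"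
    unfolding *[OF \<alpha>] by (rule nn_integral_cmult[symmetric]) measurable
  also have "\<dots> \<le> (\<integral>\<^sup>+t. b * (indicator {0..} t * emeasure \<beta> {x. t < f x}) \<partial>lborel)"
    by (intro nn_integral_mono) (auto split: split_indicator intro: lev)
  also have "\<dots> = b * (\<integral>\<^sup>+x. ennreal (h x) * indicator (ball 0 L) x \<partial>\<beta>)"
    unfolding *[OF \<beta>] by (rule nn_integral_cmult) measurable
  finally show ?thesis .
qed

section \<open>Scaling of measures and balls\<close>

lemma sigma_finite_distr_scale:
  fixes N :: "'v::euclidean_space measure"
  assumes "finite_measure N" "sets N = sets borel"
  shows "sigma_finite_measure (distr N borel (\<lambda>x. r *\<^sub>R x))"
proof -
  have "finite_measure (distr N borel (\<lambda>x. r *\<^sub>R x))"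
    using assms(2) by (intro finite_measure.finite_measure_distr assms(1)) (simp cong: measurable_cong_sets)
  then show ?thesis by (rule finite_measure.axioms)
qed

lemma emeasure_distr_scale_ball:
  fixes N :: "'v::euclidean_space measure"
  assumes "sets N = sets borel" "r > 0"
  shows "emeasure (distr N borel (\<lambda>x. r *\<^sub>R x)) (ball 0 R) = emeasure N (ball 0 (R / r))"
proof -
  have "(\<lambda>x. r *\<^sub>R x) -` ball 0 R \<inter> space N = ball 0 (R / r)"
    using sets_eq_imp_space_eq[OF assms(1)] assms(2) by (auto simp: field_simps)
  then show ?thesis
    using assms(1) by (subst emeasure_distr) (auto cong: measurable_cong_sets)
qed

lemma emeasure_lborel_ball_scale:
  assumes "r > 0" "R > 0"
  shows "ennreal (r ^ DIM('v)) * emeasure lborel (ball (0::'v::euclidean_space) (R / r)) = emeasure lborel (ball (0::'v) R)"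
proof -
  have e: "emeasure lborel (ball (0::'v) s) = ennreal (measure lborel (ball (0::'v) s))" for s
    using emeasure_lborel_ball_finite[of "0::'v" s] by (simp add: emeasure_eq_ennreal_measure)
  have "r ^ DIM('v) * measure lborel (ball (0::'v) (R / r)) = measure lborel (ball (0::'v) R)"
    using assms content_ball_conv_unit_ball[of "R / r" "0::'v"] content_ball_conv_unit_ball[of R "0::'v"]
    by (simp add: power_divide)
  then show ?thesis using assms by (simp add: e ennreal_mult[symmetric])
qed

lemma emeasure_lborel_ball_pos:
  "R > 0 \<Longrightarrow> emeasure lborel (ball (0::'v::euclidean_space) R) \<noteq> 0"
  using content_ball_pos[of R "0::'v"] by (auto simp: measure_def)

text \<open>Halving the radius makes the right end inclusive, as the comparison on balls up to and
  including L demands.\<close>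

lemma eventually_at_right_0_le:
  assumes "eventually P (at_right (0::real))"
  obtains d where "d > 0" "\<And>R. 0 < R \<Longrightarrow> R \<le> d \<Longrightarrow> P R"
proof -
  obtain b where b: "b > 0" "\<And>y. 0 < y \<Longrightarrow> y < b \<Longrightarrow> P y"
    using assms by (auto simp: eventually_at_right[of 0 1])
  show ?thesis by (rule that[of "b / 2"]) (use b in auto)
qed

lemma ennreal_divide_less_mult:
  fixes a b c :: ennreal
  assumes "b \<noteq> 0" "b \<noteq> \<infinity>"
  shows "a / b < c \<Longrightarrow> a \<le> c * b" "c < a / b \<Longrightarrow> c * b \<le> a"
proof -
  have "b / b = 1" using assms by (cases b) (auto simp: divide_ennreal)
  then have *: "a / b * b = a" by (simp add: ennreal_divide_times)
  show "a / b < c \<Longrightarrow> a \<le> c * b" using mult_right_mono[of "a / b" c b] by (simp add: *)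
  show "c < a / b \<Longrightarrow> c * b \<le> a" using mult_right_mono[of c "a / b" b] by (simp add: *)
qed

lemma nn_integral_scale_distr:
  fixes N :: "'v::euclidean_space measure" and F :: "'v \<Rightarrow> ennreal"
  assumes "sets N = sets borel" "F \<in> borel_measurable borel"
  shows "(\<integral>\<^sup>+x. c * F (r *\<^sub>R x) \<partial>N) = c * (\<integral>\<^sup>+x. F x \<partial>distr N borel (\<lambda>x. r *\<^sub>R x))"
proof -
  have m: "(\<lambda>x. r *\<^sub>R x) \<in> N \<rightarrow>\<^sub>M borel" using assms(1) by (simp cong: measurable_cong_sets)
  show ?thesis
    using measurable_compose[OF m assms(2)]
    by (subst nn_integral_distr[OF m]) (simp_all add: assms nn_integral_cmult)
qed

text \<open>On the shell between R/2 and R the function is at least G(R e), and the shell has volume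
  proportional to \<open>R^d\<close>. So \<open>R^d G(R e)\<close> is bounded by a multiple of the
  integral of G outside radius R/2, which tends to 0.\<close>

lemma radial_power_tendsto_0:
  fixes G :: "'v::euclidean_space \<Rightarrow> real"
  assumes G: "\<And>x y. norm x \<le> norm y \<Longrightarrow> G y \<le> G x" "\<And>x. G x \<ge> 0" "integrable lborel G"
    and e: "norm e = 1"
  shows "((\<lambda>R. R ^ DIM('v) * G (R *\<^sub>R e)) \<longlongrightarrow> 0) at_top"
proof -
  define I where "I R = (LINT x|lborel. G x * indicator {x. R / 2 \<le> norm x} x)" for R :: real
  define u where "u = measure lborel (ball (0::'v) 1)"
  have u: "u > 0" unfolding u_def by (rule content_ball_pos) simp
  have p2: "(1/2::real) ^ DIM('v) < 1" by (simp add: power_less_one_iff)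
  \<comment> \<open>The volume of the shell for R = 1.\<close>
  define k where "k = u * (1 - (1/2) ^ DIM('v))"
  have k: "k > 0" using u p2 by (simp add: k_def)
  have "(I \<longlongrightarrow> (LINT x|(lborel :: 'v measure). (0::real))) at_top"
    unfolding I_def
  proof (rule integral_dominated_convergence_at_top[where w=G
        and s="\<lambda>R x. G x * indicator {x. R / 2 \<le> norm x} x" and f="\<lambda>_. 0"])
    show "AE x in lborel. ((\<lambda>R. G x * indicator {x. R / 2 \<le> norm x} x) \<longlongrightarrow> 0) at_top"
    proof (rule AE_I2)
      fix x :: 'v
      have "eventually (\<lambda>R. G x * indicator {x. R / 2 \<le> norm x} x = 0) at_top"
        using eventually_gt_at_top[of "2 * norm x"] by eventually_elim auto
      then show "((\<lambda>R. G x * indicator {x. R / 2 \<le> norm x} x) \<longlongrightarrow> 0) at_top"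
        by (rule tendsto_eventually)
    qed
    show "\<forall>\<^sub>F i in at_top. AE x in lborel. norm (G x * indicator {x. i / 2 \<le> norm x} x) \<le> G x"
      using G(2) by (auto split: split_indicator)
  qed (use G(3) in auto)
  then have I0: "(I \<longlongrightarrow> 0) at_top" by simp
  have le: "R ^ DIM('v) * G (R *\<^sub>R e) \<le> I R / k" if R: "R > 0" for R
  proof -
    let ?A = "ball (0::'v) R - ball 0 (R / 2)"
    have fin: "emeasure lborel (ball (0::'v) s) \<noteq> \<infinity>" for s using emeasure_lborel_ball_finite[of "0::'v" s] by simp
    have "measure lborel ?A = R ^ DIM('v) * u - (R / 2) ^ DIM('v) * u"
      using R content_ball_conv_unit_ball[of R "0::'v"] content_ball_conv_unit_ball[of "R / 2" "0::'v"]
      by (subst measure_Diff) (use fin in \<open>auto simp: u_def intro!: subset_ball\<close>)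
    also have "\<dots> = R ^ DIM('v) * k" by (simp add: k_def power_divide algebra_simps)
    finally have m: "measure lborel ?A = R ^ DIM('v) * k" .
    have finA: "emeasure lborel ?A < \<infinity>"
      using emeasure_mono[of ?A "ball 0 R" lborel] fin[of R] by (auto simp: less_top[symmetric] top_unique)
    have "G (R *\<^sub>R e) * measure lborel ?A = (LINT x|lborel. G (R *\<^sub>R e) * indicator ?A x)"
      by simp
    also have "\<dots> \<le> I R"
      unfolding I_def
    proof (rule integral_mono)
      show "integrable lborel (\<lambda>x. G (R *\<^sub>R e) * indicator ?A x)"
        using finA by (intro integrable_mult_right integrable_real_indicator) auto
      show "integrable lborel (\<lambda>x. G x * indicator {x. R / 2 \<le> norm x} x)"
        using G(3) by (intro integrable_mult_indicator[where 'b=real, simplified mult.commute real_scaleR_def]) auto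
      show "G (R *\<^sub>R e) * indicator ?A x \<le> G x * indicator {x. R / 2 \<le> norm x} x" for x
        using G(1)[of x "R *\<^sub>R e"] G(2) R e by (auto split: split_indicator)
    qed
    finally show ?thesis using k by (simp add: m field_simps)
  qed
  show ?thesis
  proof (rule tendsto_sandwich[OF _ _ tendsto_const])
    show "((\<lambda>R. I R / k) \<longlongrightarrow> 0) at_top" using tendsto_divide[OF I0 tendsto_const[of k]] k by simp
    show "\<forall>\<^sub>F R in at_top. R ^ DIM('v) * G (R *\<^sub>R e) \<le> I R / k"
      using eventually_gt_at_top[of 0] by eventually_elim (rule le)
    show "\<forall>\<^sub>F R in at_top. 0 \<le> R ^ DIM('v) * G (R *\<^sub>R e)"
      using eventually_gt_at_top[of 0] by eventually_elim (use G(2) in auto)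
  qed
qed

text \<open>For C above the upper density, the image of N under dilation by r, times
  \<open>r^d\<close>, is at most C times Lebesgue measure on balls up to radius r \<delta>. Beyond
  that radius G is at most its boundary value, and the total mass of N is finite.\<close>

lemma limsup_scaled_integral_le:
  fixes N :: "'v::euclidean_space measure" and \<gamma> G :: "'v \<Rightarrow> real"
  assumes N: "finite_measure N" "sets N = sets borel"
    and \<gamma>: "\<And>x. 0 \<le> \<gamma> x" "\<And>x. \<gamma> x \<le> G x" "isCont \<gamma> 0"
    and G: "\<And>x y. norm x \<le> norm y \<Longrightarrow> G y \<le> G x" "integrable lborel G"
  shows "Limsup at_top (\<lambda>r. \<integral>\<^sup>+x. ennreal (r ^ DIM('v)) * ennreal (\<gamma> (r *\<^sub>R x)) \<partial>N)
    \<le> (\<integral>\<^sup>+x. ennreal (G x) \<partial>lborel) * upper_density_at_0 N" (is "Limsup at_top ?V \<le> ?I * ?D")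
proof -
  interpret finite_measure N by fact
  have G0: "G x \<ge> 0" for x using \<gamma>(1,2) order_trans by blast
  have [measurable]: "G \<in> borel_measurable borel" by (rule borel_measurable_radial) fact
  have Ifin: "?I < \<infinity>" using G(2) G0 by (auto simp: integrable_iff_bounded)
  obtain e :: 'v where e: "norm e = 1" using vector_choose_size[of 1] by auto
  have main: "Limsup at_top ?V \<le> C * ?I" if C: "?D < C" "C < \<infinity>" for C
  proof -
    have "eventually (\<lambda>R. emeasure N (ball 0 R) / emeasure lborel (ball (0::'v) R) < C) (at_right 0)"
      using C(1) unfolding upper_density_at_0_def by (rule Limsup_lessD)
    then obtain \<delta> where \<delta>: "\<delta> > 0"
      "\<And>R. 0 < R \<Longrightarrow> R \<le> \<delta> \<Longrightarrow> emeasure N (ball 0 R) / emeasure lborel (ball (0::'v) R) < C"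
      by (rule eventually_at_right_0_le) blast
    have ball: "emeasure N (ball 0 R) \<le> C * emeasure lborel (ball (0::'v) R)" if "0 < R" "R \<le> \<delta>" for R
      using \<delta>(2)[OF that] emeasure_lborel_ball_pos[OF that(1)] emeasure_lborel_ball_finite[of "0::'v" R]
      by (intro ennreal_divide_less_mult) auto
    \<comment> \<open>Bound for the part outside radius r \<delta>; it tends to 0 because
      \<open>r^d\<close> is a constant multiple of \<open>(r \<delta>)^d\<close>.\<close>
    define t where "t r = ennreal (r ^ DIM('v) * G ((r * \<delta>) *\<^sub>R e)) * emeasure N UNIV" for r
    have V: "?V r \<le> C * ?I + t r" if r: "r > 0" for r
    proof -
      let ?K = "distr N borel (\<lambda>x. r *\<^sub>R x)"
      let ?B = "ball (0::'v) (r * \<delta>)"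
      let ?J = "\<lambda>Q. \<integral>\<^sup>+x. ennreal (G x) * indicator ?B x \<partial>Q"
        and ?J' = "\<lambda>Q. \<integral>\<^sup>+x. ennreal (G x) * indicator (- ?B) x \<partial>Q"
      have [measurable]: "?B \<in> sets borel" by simp
      have "?V r \<le> (\<integral>\<^sup>+x. ennreal (r ^ DIM('v)) * ennreal (G (r *\<^sub>R x)) \<partial>N)"
        using r \<gamma> by (intro nn_integral_mono mult_left_mono ennreal_leI) auto
      also have "\<dots> = ennreal (r ^ DIM('v)) * (\<integral>\<^sup>+x. ennreal (G x) \<partial>?K)"
        by (rule nn_integral_scale_distr[OF N(2)]) measurable
      also have "(\<integral>\<^sup>+x. ennreal (G x) \<partial>?K) =
          (\<integral>\<^sup>+x. ennreal (G x) * indicator ?B x + ennreal (G x) * indicator (- ?B) x \<partial>?K)"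
        by (intro nn_integral_cong) (auto split: split_indicator)
      also have "\<dots> = ?J ?K + ?J' ?K"
        by (intro nn_integral_add) measurable
      also have "ennreal (r ^ DIM('v)) * \<dots> = ennreal (r ^ DIM('v)) * ?J ?K +
          ennreal (r ^ DIM('v)) * ?J' ?K"
        by (rule distrib_left)
      also have "\<dots> \<le> C * ?J lborel + t r"
      proof (rule add_mono)
        show "ennreal (r ^ DIM('v)) * ?J ?K
            \<le> C * ?J lborel"
        proof (rule nn_integral_radial_mono)
          fix R assume R: "0 < R" "R \<le> r * \<delta>"
          have "ennreal (r ^ DIM('v)) * emeasure ?K (ball 0 R) \<le>
              ennreal (r ^ DIM('v)) * (C * emeasure lborel (ball (0::'v) (R / r)))"
            unfolding emeasure_distr_scale_ball[OF N(2) r]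
            using R r by (intro mult_left_mono ball) (auto simp: field_simps)
          also have "\<dots> = C * emeasure lborel (ball (0::'v) R)"
            using emeasure_lborel_ball_scale[OF r R(1), where 'v='v] by (simp add: mult.left_commute)
          finally show "ennreal (r ^ DIM('v)) * emeasure ?K (ball 0 R) \<le> C * emeasure lborel (ball (0::'v) R)" .
        qed (use r \<delta>(1) C(2) G G0 sigma_finite_distr_scale[OF N] emeasure_lborel_ball_finite
             in \<open>auto intro: sigma_finite_lborel\<close>)
        have "?J' ?K \<le> (\<integral>\<^sup>+x. ennreal (G ((r * \<delta>) *\<^sub>R e)) \<partial>?K)"
        proof (rule nn_integral_mono)
          fix x
          show "ennreal (G x) * indicator (- ?B) x \<le> ennreal (G ((r * \<delta>) *\<^sub>R e))"
            using G(1)[of "(r * \<delta>) *\<^sub>R e" x] e r \<delta>(1) by (auto simp: abs_mult intro!: ennreal_leI split: split_indicator)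
        qed
        also have "\<dots> = ennreal (G ((r * \<delta>) *\<^sub>R e)) * emeasure N UNIV"
          using sets_eq_imp_space_eq[OF N(2)] N(2)
          by (simp add: emeasure_distr cong: measurable_cong_sets)
        finally show "ennreal (r ^ DIM('v)) * ?J' ?K \<le> t r"
          using r by (simp add: t_def ennreal_mult' G0 mult.assoc mult_left_mono)
      qed
      also have "\<dots> \<le> C * ?I + t r"
        by (intro add_mono mult_left_mono nn_integral_mono) (auto split: split_indicator)
      finally show ?thesis .
    qed
    have "((\<lambda>r. r ^ DIM('v) * G ((r * \<delta>) *\<^sub>R e)) \<longlongrightarrow> 0) at_top"
    proof -
      have "((\<lambda>r. (r * \<delta>) ^ DIM('v) * G ((r * \<delta>) *\<^sub>R e) / \<delta> ^ DIM('v)) \<longlongrightarrow> 0 / \<delta> ^ DIM('v)) at_top"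
        using filterlim_compose[OF radial_power_tendsto_0[OF G(1) G0 G(2) e], of "\<lambda>r. r * \<delta>" at_top]
          filterlim_at_top_mult_tendsto_pos[OF tendsto_const \<delta>(1) filterlim_ident] \<delta>(1)
        by (intro tendsto_divide tendsto_const) auto
      then show ?thesis using \<delta>(1) by (simp add: power_mult_distrib)
    qed
    then have "(t \<longlongrightarrow> ennreal 0 * emeasure N UNIV) at_top"
      unfolding t_def mult.commute[of _ "emeasure N UNIV"]
      using emeasure_finite[of UNIV] less_top by (intro ennreal_tendsto_cmult tendsto_ennrealI) blast+
    then have t0: "((\<lambda>r. C * ?I + t r) \<longlongrightarrow> C * ?I + 0) at_top"
      by (intro tendsto_add tendsto_const) simp
    have "Limsup at_top ?V \<le> Limsup at_top (\<lambda>r. C * ?I + t r)"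
      by (rule Limsup_mono, rule eventually_mono[OF eventually_gt_at_top[of 0]], rule V)
    also have "\<dots> = C * ?I" using lim_imp_Limsup[OF _ t0] by simp
    finally show ?thesis .
  qed
  show ?thesis
  proof (cases "?D < \<infinity>")
    case True
    \<comment> \<open>A finite density is approached strictly from above, since \<open>main\<close>
      needs C > D; finiteness of the integral of G keeps the product continuous.\<close>
    have "(\<lambda>n. ?D + ennreal (1 / real (Suc n))) \<longlonglongrightarrow> ?D + ennreal 0"
      using LIMSEQ_inverse_real_of_nat
      by (intro tendsto_add tendsto_const tendsto_ennrealI) (simp add: inverse_eq_divide)
    then have "(\<lambda>n. ?I * (?D + ennreal (1 / real (Suc n)))) \<longlonglongrightarrow> ?I * (?D + ennreal 0)"
      using Ifin by (intro ennreal_tendsto_cmult) auto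
    moreover have "Limsup at_top ?V \<le> ?I * (?D + ennreal (1 / real (Suc n)))" for n
    proof -
      have "?D < ?D + ennreal (1 / real (Suc n))"
        using True by (cases ?D) (auto simp: ennreal_plus[symmetric] ennreal_less_iff simp del: ennreal_plus)
      moreover have "?D + ennreal (1 / real (Suc n)) < \<infinity>" using True by auto
      ultimately have "Limsup at_top ?V \<le> (?D + ennreal (1 / real (Suc n))) * ?I" by (rule main)
      then show ?thesis by (subst mult.commute)
    qed
    ultimately have "Limsup at_top ?V \<le> ?I * (?D + ennreal 0)"
      by (intro LIMSEQ_le_const) auto
    then show ?thesis by simp
  next
    case False
    then have D: "?D = \<infinity>" by (cases ?D) auto
    show ?thesis
    proof (cases "?I = 0")
      case False
      then show ?thesis using D by (simp add: ennreal_mult_top)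
    next
      case True
      \<comment> \<open>Here the right-hand side is 0 times infinity, that is 0. A positive value G
        x would be a lower bound for G on the ball of radius |x| and make its integral positive, so
        \<gamma> vanishes off the origin.\<close>
      have z: "\<gamma> x = 0" if "x \<noteq> 0" for x
      proof (rule ccontr)
        assume "\<gamma> x \<noteq> 0"
        then have Gx: "G x > 0" using \<gamma>(1)[of x] \<gamma>(2)[of x] by simp
        have "0 < ennreal (G x) * emeasure lborel (ball (0::'v) (norm x))"
          using Gx emeasure_lborel_ball_pos[of "norm x", where 'v='v] that by (auto simp: ennreal_zero_less_mult_iff zero_less_iff_neq_zero)
        also have "\<dots> = (\<integral>\<^sup>+y. ennreal (G x) * indicator (ball (0::'v) (norm x)) y \<partial>lborel)"
          by (rule nn_integral_cmult_indicator[symmetric]) simp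
        also have "\<dots> \<le> ?I"
          by (intro nn_integral_mono) (auto split: split_indicator intro!: ennreal_leI G(1))
        finally show False using True by simp
      qed
      have "(\<gamma> \<longlongrightarrow> \<gamma> 0) (at 0)" using \<gamma>(3) by (simp add: isCont_def)
      moreover have "(\<gamma> \<longlongrightarrow> 0) (at 0)"
        by (rule tendsto_eventually) (auto simp: eventually_at_filter z)
      ultimately have "\<gamma> 0 = 0" by (rule tendsto_unique[OF at_neq_bot])
      then have "\<gamma> x = 0" for x using z by (cases "x = 0") auto
      then show ?thesis by (simp add: Limsup_const)
    qed
  qed
qed

text \<open>The comparison runs with the measures exchanged, and the mass of N outside radius r
  \<delta> is simply dropped. Any fixed ball lies inside radius r \<delta> once r is large.\<close>

lemma liminf_scaled_integral_ge:
  fixes N :: "'v::euclidean_space measure" and \<gamma> g :: "'v \<Rightarrow> real"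
  assumes N: "finite_measure N" "sets N = sets borel"
    and g: "\<And>x. 0 \<le> g x" "\<And>x. g x \<le> \<gamma> x" "\<And>x y. norm x \<le> norm y \<Longrightarrow> g y \<le> g x"
  shows "(\<integral>\<^sup>+x. ennreal (g x) \<partial>lborel) * lower_density_at_0 N
    \<le> Liminf at_top (\<lambda>r. \<integral>\<^sup>+x. ennreal (r ^ DIM('v)) * ennreal (\<gamma> (r *\<^sub>R x)) \<partial>N)"
    (is "?I * ?D \<le> Liminf at_top ?V")
proof -
  interpret finite_measure N by fact
  have [measurable]: "g \<in> borel_measurable borel" by (rule borel_measurable_radial) fact
  have main: "?I * c \<le> Liminf at_top ?V" if c: "c < ?D" for c
  proof -
    have "eventually (\<lambda>R. c < emeasure N (ball 0 R) / emeasure lborel (ball (0::'v) R)) (at_right 0)"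
      using c unfolding lower_density_at_0_def by (rule less_LiminfD)
    then obtain \<delta> where \<delta>: "\<delta> > 0"
      "\<And>R. 0 < R \<Longrightarrow> R \<le> \<delta> \<Longrightarrow> c < emeasure N (ball 0 R) / emeasure lborel (ball (0::'v) R)"
      by (rule eventually_at_right_0_le) blast
    have ball: "c * emeasure lborel (ball (0::'v) R) \<le> emeasure N (ball 0 R)" if "0 < R" "R \<le> \<delta>" for R
      using \<delta>(2)[OF that] emeasure_lborel_ball_pos[OF that(1)] emeasure_lborel_ball_finite[of "0::'v" R]
      by (intro ennreal_divide_less_mult) auto
    have V: "c * (\<integral>\<^sup>+x. ennreal (g x) * indicator (ball 0 (r * \<delta>)) x \<partial>lborel) \<le> ?V r" if r: "r > 0" for r
    proof -
      let ?K = "distr N borel (\<lambda>x. r *\<^sub>R x)"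
      let ?B = "ball (0::'v) (r * \<delta>)"
      have [measurable]: "?B \<in> sets borel" by simp
      have "c * (\<integral>\<^sup>+x. ennreal (g x) * indicator ?B x \<partial>lborel) \<le>
         ennreal (r ^ DIM('v)) * (\<integral>\<^sup>+x. ennreal (g x) * indicator ?B x \<partial>?K)"
      proof (rule nn_integral_radial_mono)
        fix R assume R: "0 < R" "R \<le> r * \<delta>"
        have "c * emeasure lborel (ball (0::'v) R) = ennreal (r ^ DIM('v)) * (c * emeasure lborel (ball (0::'v) (R / r)))"
          using emeasure_lborel_ball_scale[OF r R(1), where 'v='v] by (simp add: mult.left_commute)
        also have "\<dots> \<le> ennreal (r ^ DIM('v)) * emeasure ?K (ball 0 R)"
          unfolding emeasure_distr_scale_ball[OF N(2) r]
          using R r by (intro mult_left_mono ball) (auto simp: field_simps)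
        finally show "c * emeasure lborel (ball (0::'v) R) \<le> ennreal (r ^ DIM('v)) * emeasure ?K (ball 0 R)" .
      next
        show "emeasure ?K ?B < \<infinity>"
          unfolding emeasure_distr_scale_ball[OF N(2) r]
          using emeasure_finite[of "ball 0 (r * \<delta> / r)"] by (cases "emeasure N (ball 0 (r * \<delta> / r))") (simp_all del: emeasure_finite)
      qed (use r \<delta>(1) g sigma_finite_distr_scale[OF N] in \<open>auto intro: sigma_finite_lborel\<close>)
      also have "\<dots> = (\<integral>\<^sup>+x. ennreal (r ^ DIM('v)) * (ennreal (g (r *\<^sub>R x)) * indicator ?B (r *\<^sub>R x)) \<partial>N)"
        by (rule nn_integral_scale_distr[OF N(2), symmetric]) measurable
      also have "\<dots> \<le> ?V r"
        using g(2) by (intro nn_integral_mono mult_left_mono) (auto split: split_indicator intro!: ennreal_leI)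
      finally show ?thesis .
    qed
    let ?J = "\<lambda>n::nat. \<integral>\<^sup>+x. ennreal (g x) * indicator (ball 0 (real n)) x \<partial>lborel"
    have gm: "(\<lambda>x. ennreal (g x) * indicator (ball 0 s) x) \<in> borel_measurable borel" for s
    proof -
      have [measurable]: "ball (0::'v) s \<in> sets borel" by simp
      show ?thesis by measurable
    qed
    \<comment> \<open>Balls of integer radius exhaust the space, so bounds on each of them give the
      full integral by monotone convergence.\<close>
    have "(SUP n. ?J n) = (\<integral>\<^sup>+x. (SUP n::nat. ennreal (g x) * indicator (ball 0 (real n)) x) \<partial>lborel)"
      by (rule nn_integral_monotone_convergence_SUP[symmetric])
         (auto simp: incseq_def le_fun_def gm split: split_indicator)
    also have "\<dots> = ?I"
    proof (rule nn_integral_cong)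
      fix x :: 'v
      obtain n :: nat where n: "norm x < real n" using reals_Archimedean2 by blast
      show "(SUP n::nat. ennreal (g x) * indicator (ball 0 (real n)) x) = ennreal (g x)"
      proof (rule antisym)
        show "(SUP n::nat. ennreal (g x) * indicator (ball 0 (real n)) x) \<le> ennreal (g x)"
          by (intro SUP_least) (auto split: split_indicator)
        show "ennreal (g x) \<le> (SUP n::nat. ennreal (g x) * indicator (ball 0 (real n)) x)"
          using n by (intro SUP_upper2[of n]) auto
      qed
    qed
    finally have SUP: "?I * c = (SUP n. ?J n * c)"
      unfolding SUP_mult_right_ennreal[symmetric] by simp
    have "?J n * c \<le> Liminf at_top ?V" for n
    proof (rule Liminf_bounded)
      show "\<forall>\<^sub>F r in at_top. ?J n * c \<le> ?V r"
        using eventually_ge_at_top[of "real n / \<delta>"] eventually_gt_at_top[of 0]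
      proof eventually_elim
        case (elim r)
        then have "real n \<le> r * \<delta>" using \<delta>(1) by (simp add: field_simps)
        then have "?J n \<le> (\<integral>\<^sup>+x. ennreal (g x) * indicator (ball 0 (r * \<delta>)) x \<partial>lborel)"
          by (intro nn_integral_mono) (auto split: split_indicator)
        then have "?J n * c \<le> c * (\<integral>\<^sup>+x. ennreal (g x) * indicator (ball 0 (r * \<delta>)) x \<partial>lborel)"
          unfolding mult.commute[of _ c] by (rule mult_left_mono) simp
        then show ?case using V[OF elim(2)] by (rule order_trans)
      qed
    qed
    then show ?thesis unfolding SUP by (rule SUP_least)
  qed
  \<comment> \<open>The density is the supremum of the values strictly below it. This covers an
    infinite density, and also density 0, where the supremum of the empty set is 0.\<close>
  have "?I * ?D = (SUP c\<in>{..<?D}. c * ?I)"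
    using SUP_mult_right_ennreal[of "\<lambda>c. c" "{..<?D}" ?I] by (simp add: mult.commute)
  also have "\<dots> \<le> Liminf at_top ?V"
    by (intro SUP_least) (use main in \<open>auto simp: mult.commute\<close>)
  finally show ?thesis .
qed

section \<open>Asymptotics of the variance\<close>

lemma variance_chaos_Z:
  fixes M :: "'a measure" and X :: "'v::euclidean_space \<Rightarrow> 'a \<Rightarrow> 'w::euclidean_space"
    and \<mu> :: "'v set \<Rightarrow> ('w \<Rightarrow> complex) \<Rightarrow> ('w \<Rightarrow> complex) \<Rightarrow> complex"
    and f :: "'w \<Rightarrow> real" and \<phi> :: "'v \<Rightarrow> real" and q :: nat
  assumes M: "prob_space M" and meas: "measurable_field M X" and gauss: "gaussian_field M X"
    and centered: "centered_field M X" and stat: "stationary_field M X"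
    and pos: "pos_def_form (field_cov M X 0)" and spec: "is_spectral_measure (field_cov M X) \<mu>"
    and \<phi>: "integrable lborel \<phi>" and q: "q \<ge> 1" and r: "r > 0"
  defines "\<nu> \<equiv> spectral_conv_at \<mu> q (chaos_coeff (field_cov M X 0) (field_law M X) f q)"
  shows "prob_space.variance M (chaos_Z M X f q \<phi> r) =
    1 / fact q * (LINT \<xi>|\<nu>. r ^ DIM('v) * power_spectrum \<phi> (r *\<^sub>R \<xi>))"
proof -
  let ?A = "chaos_proj (field_cov M X 0) (field_law M X) f q"
  note A = chaos_proj_field[OF M meas gauss centered stat pos, where f=f and q=q]
  note N = spectral_conv_at_fourier[OF spec, where q=q and g="chaos_coeff (field_cov M X 0) (field_law M X) f q", folded \<nu>_def]
  have "(\<lambda>(v, \<omega>). ?A (X v \<omega>)) \<in> borel_measurable (borel \<Otimes>\<^sub>M M)"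
    using measurable_compose[OF meas[unfolded measurable_field_def] A(1)] by (simp add: case_prod_unfold)
  moreover have "(LINT \<omega>|M. ?A (X u \<omega>) * ?A (X v \<omega>)) = 1 / fact q * (LINT \<xi>|\<nu>. cos (2 * pi * (\<xi> \<bullet> (u - v))))" for u v
    by (simp add: A(5) N(3))
  ultimately show ?thesis
    unfolding chaos_Z_def[abs_def]
    by (rule variance_smeared_field[OF M _ A(3) A(4)[OF q] _ N(1,2) \<phi> r])
qed

theorem corollary1p2:
  fixes M :: "'a measure"
    and X :: "'v::euclidean_space \<Rightarrow> 'a \<Rightarrow> 'w::euclidean_space"
    and \<mu> :: "'v set \<Rightarrow> ('w \<Rightarrow> complex) \<Rightarrow> ('w \<Rightarrow> complex) \<Rightarrow> complex"
    and f :: "'w \<Rightarrow> real"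
    and \<phi> :: "'v \<Rightarrow> real"
    and q :: nat
  assumes "prob_space M"
    and "measurable_field M X"
    and "gaussian_field M X"
    and "centered_field M X"
    and "stationary_field M X"
    and "continuous_cov (field_cov M X)"
    and "pos_def_form (field_cov M X 0)"
    and "is_spectral_measure (field_cov M X) \<mu>"
    and "f \<in> borel_measurable borel"
    and "integrable (field_law M X) (\<lambda>x. (f x)\<^sup>2)"
    and "test_function \<phi>"
    and "q \<ge> 1"
  shows "Liminf at_top (\<lambda>r. ennreal (prob_space.variance M (chaos_Z M X f q \<phi> r)))
           \<ge> ennreal (1 / fact q) * L1_norm (radial_inf (power_spectrum \<phi>)) *
             lower_density_at_0
               (spectral_conv_at \<mu> q (chaos_coeff (field_cov M X 0) (field_law M X) f q))
       \<and> Limsup at_top (\<lambda>r. ennreal (prob_space.variance M (chaos_Z M X f q \<phi> r)))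
           \<le> ennreal (1 / fact q) * L1_norm (radial_sup (power_spectrum \<phi>)) *
             upper_density_at_0
               (spectral_conv_at \<mu> q (chaos_coeff (field_cov M X 0) (field_law M X) f q))"
proof -
  let ?\<gamma> = "power_spectrum \<phi>" and ?c = "ennreal (1 / fact q)"
  let ?g = "chaos_coeff (field_cov M X 0) (field_law M X) f q"
  let ?\<nu> = "spectral_conv_at \<mu> q ?g"
  let ?var = "\<lambda>r. ennreal (prob_space.variance M (chaos_Z M X f q \<phi> r))" and ?V = "\<lambda>r. \<integral>\<^sup>+x. ennreal (r ^ DIM('v)) * ennreal (?\<gamma> (r *\<^sub>R x)) \<partial>?\<nu>"
  have \<phi>: "integrable lborel \<phi>" and sup_int: "integrable lborel (radial_sup ?\<gamma>)"
    using assms(11) by (simp_all add: test_function_def)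
  note \<nu> = spectral_conv_at_fourier(1,2)[OF assms(8), where q=q and g="?g"]
  interpret N: finite_measure ?\<nu> by (rule \<nu>(1))
  define C where "C = (LINT v|lborel. \<bar>\<phi> v\<bar>)\<^sup>2"
  have \<gamma>_nonneg: "0 \<le> ?\<gamma> x" for x by (simp add: power_spectrum_def)
  have \<gamma>_le: "?\<gamma> x \<le> C" for x unfolding C_def by (rule power_spectrum_le[OF \<phi>])
  have \<gamma>_meas: "?\<gamma> \<in> borel_measurable borel"
    by (intro borel_measurable_continuous_onI continuous_at_imp_continuous_on ballI isCont_power_spectrum \<phi>)
  \<comment> \<open>The variance is a Bochner integral; boundedness of \<gamma> and finiteness of
    \<nu> turn it into the non-negative integral that the comparison lemmas use.\<close>
  have var: "?var r = ?c * ?V r" if r: "r > 0" for r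
  proof -
    have m: "(\<lambda>x. r ^ DIM('v) * ?\<gamma> (r *\<^sub>R x)) \<in> borel_measurable ?\<nu>"
      unfolding measurable_cong_sets[OF \<nu>(2) refl]
      by (intro borel_measurable_times measurable_compose[OF _ \<gamma>_meas]) auto
    have i: "integrable ?\<nu> (\<lambda>x. r ^ DIM('v) * ?\<gamma> (r *\<^sub>R x))"
    proof (rule N.integrable_const_bound[where B="r ^ DIM('v) * C"])
      show "AE x in ?\<nu>. norm (r ^ DIM('v) * ?\<gamma> (r *\<^sub>R x)) \<le> r ^ DIM('v) * C"
        using r by (auto simp: abs_mult \<gamma>_nonneg intro!: mult_left_mono \<gamma>_le)
    qed (rule m)
    have "ennreal (LINT x|?\<nu>. r ^ DIM('v) * ?\<gamma> (r *\<^sub>R x)) = (\<integral>\<^sup>+x. ennreal (r ^ DIM('v) * ?\<gamma> (r *\<^sub>R x)) \<partial>?\<nu>)"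
      by (rule nn_integral_eq_integral[symmetric, OF i]) (use r \<gamma>_nonneg in auto)
    also have "\<dots> = ?V r" using r by (simp add: ennreal_mult \<gamma>_nonneg)
    finally show ?thesis
      unfolding variance_chaos_Z[OF assms(1-5,7,8) \<phi> assms(12) r]
      by (subst ennreal_mult) (use r \<gamma>_nonneg in \<open>auto intro!: integral_nonneg_AE\<close>)
  qed
  \<comment> \<open>Suprema and infima of reals behave as expected only on bounded sets; C and 0 are
    the bounds.\<close>
  have bdd: "bdd_above (?\<gamma> ` S)" "bdd_below (?\<gamma> ` S)" for S
    by (rule bdd_aboveI2[OF \<gamma>_le], rule bdd_belowI2[OF \<gamma>_nonneg])
  have sup_ge: "?\<gamma> x \<le> radial_sup ?\<gamma> x" for x
    unfolding radial_sup_def by (rule cSUP_upper[OF _ bdd(1)]) simp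
  have sup_mono: "radial_sup ?\<gamma> y \<le> radial_sup ?\<gamma> x" if "norm x \<le> norm y" for x y
    unfolding radial_sup_def by (rule cSUP_subset_mono[OF _ bdd(1)]) (use that in auto)
  have inf_le: "radial_inf ?\<gamma> x \<le> ?\<gamma> x" for x
    unfolding radial_inf_def by (rule cINF_lower[OF bdd(2)]) simp
  have inf_nonneg: "0 \<le> radial_inf ?\<gamma> x" for x
    unfolding radial_inf_def by (rule cINF_greatest) (use \<gamma>_nonneg in auto)
  have inf_mono: "radial_inf ?\<gamma> y \<le> radial_inf ?\<gamma> x" if "norm x \<le> norm y" for x y
    unfolding radial_inf_def by (rule cINF_superset_mono[OF _ bdd(2)]) (use that in auto)
  have sup_nonneg: "0 \<le> radial_sup ?\<gamma> x" for x using \<gamma>_nonneg sup_ge by (rule order_trans)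
  have ev: "\<forall>\<^sub>F r in at_top. ?var r = ?c * ?V r"
    using eventually_gt_at_top[of 0] by eventually_elim (rule var)
  \<comment> \<open>Multiplication by the finite constant 1/q! is continuous and monotone, hence
    passes through both limits.\<close>
  have cont: "continuous_on UNIV ((*) ?c)" and mono: "mono ((*) ?c)"
    by (auto intro!: ennreal_continuous_on_cmult continuous_on_id monoI mult_left_mono)
  have "?c * L1_norm (radial_inf ?\<gamma>) * lower_density_at_0 ?\<nu> =
      ?c * ((\<integral>\<^sup>+x. ennreal (radial_inf ?\<gamma> x) \<partial>lborel) * lower_density_at_0 ?\<nu>)"
    by (simp add: L1_norm_def inf_nonneg mult.assoc)
  also have "\<dots> \<le> ?c * Liminf at_top ?V"
    by (intro mult_left_mono liminf_scaled_integral_ge[OF \<nu>] inf_nonneg inf_le inf_mono) auto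
  also have "\<dots> = Liminf at_top (\<lambda>r. ?c * ?V r)"
    by (rule Liminf_compose_continuous_mono[OF cont mono, symmetric]) simp
  also have "\<dots> = Liminf at_top ?var"
    by (rule Liminf_eq, rule eventually_mono[OF ev], rule sym)
  finally have lower: "?c * L1_norm (radial_inf ?\<gamma>) * lower_density_at_0 ?\<nu> \<le>
      Liminf at_top ?var" .
  have "Limsup at_top ?var = Limsup at_top (\<lambda>r. ?c * ?V r)"
    by (rule Limsup_eq) (rule ev)
  also have "\<dots> = ?c * Limsup at_top ?V"
    by (rule Limsup_compose_continuous_mono[OF cont mono]) simp
  also have "\<dots> \<le> ?c * ((\<integral>\<^sup>+x. ennreal (radial_sup ?\<gamma> x) \<partial>lborel) * upper_density_at_0 ?\<nu>)"
    by (intro mult_left_mono limsup_scaled_integral_le[OF \<nu>] \<gamma>_nonneg sup_ge sup_mono sup_int isCont_power_spectrum \<phi>) auto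
  also have "\<dots> = ?c * L1_norm (radial_sup ?\<gamma>) * upper_density_at_0 ?\<nu>"
    by (simp add: L1_norm_def sup_nonneg mult.assoc)
  finally show ?thesis using lower by blast
qed

end
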